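(* Let $Z\subset\mathbb{P}^2$ be a finite set of points admitting an irreducible unexpected curve $C=C_P$ of degree $m+1$ with a general point $P=[a_0:a_1:a_2]$ of multiplicity $m$. (a) The curve $C_P$ is unique. (b) Let $F(a,x)\in S=\mathbb{K}\big(\frac{a_1}{a_0},\frac{a_2}{a_0}\big)[x_0,x_1,x_2]$ be the form defining $C$ over the field $\mathbb{K}\big(\frac{a_1}{a_0},\frac{a_2}{a_0}\big)$. Assume that the lines dual to the points of $Z$ comprise a free line arrangement. Then $F^*(a,x)$ is bi-homogeneous of bi-degree $(m,m+1)$. Furthermore, viewing $F^*(a,x)\in\mathbb{K}[x_0,x_1,x_2][a_0,a_1,a_2]$, $F^*(a,x)$ has multiplicity $m$ in the $a$ variables at the general point $[x_0:x_1:x_2]$ (i.e. $F^*(a,x)$ has a point of multiplicity $m$ in the $a$ variables at $a=x$). (c) Assume that $F\in R=\mathbb{K}[a_0,a_1,a_2][x_0,x_1,x_2]$ is any bi-homogeneous form of bi-degree $(m,m+1)$ such that $F(a,x)$ is reduced and irreducible for a general point $a=P$ and has multiplicity $m$ both in the $a$ variables at $a=x$ and in the $x$ variables at $x=a$. Then $F_P(a,x)=(-1)^mF(x,a)$ is the tangent cone at $x=P$ to the curve $F(P,x)=0$ for $a=P$.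
   Context: $\mathbb{K}$ is an algebraically closed field of characteristic $0$. Unexpected curves: for a finite set of points $Z\subset\mathbb{P}^2$ and a general point $P$, with $I_Z$, $I_P$ the homogeneous ideals of $Z$ and $P$ and $[I]_d$ the space of forms of degree $d$ in $I$, $Z$ admits an unexpected curve of degree $d$ with a general point $P$ of multiplicity $m$ if $\dim[I_Z\cap (I_P)^m]_d>\max\{0,\dim[I_Z]_d-\binom{m+1}{2}\}$; curves defined by nonzero elements of $[I_Z\cap (I_P)^m]_d$ are then called unexpected. The general point is taken to be the generic point $P=[1:\frac{a_1}{a_0}:\frac{a_2}{a_0}]$ with $a_0,a_1,a_2$ indeterminates, written $P=[a_0:a_1:a_2]$, and one works in $S=\mathbb{K}(\frac{a_1}{a_0},\frac{a_2}{a_0})[x_0,x_1,x_2]$ or in the bi-graded ring $R=\mathbb{K}[a_0,a_1,a_2][x_0,x_1,x_2]$, where bi-degree $(s,d)$ means degree $s$ in the $a_i$ and degree $d$ in the $x_i$. The form $F^*$: for a nonconstant form $F\in S$ of degree $d$ there is, up to scalars in $\mathbb{K}$, a unique factorization $F=BG/H$ where $B,H$ are relatively prime forms in $\mathbb{K}[a_0,a_1,a_2]$ and $G\in R$ is bi-homogeneous with no factors of bi-degree $(e,0)$, $e>0$. One sets $F^*=G$. Free arrangement: the line dual to $[p_0:p_1:p_2]$ is $p_0x_0+p_1x_1+p_2x_2=0$. If $\Lambda$ is the product of the linear forms defining the lines dual to the points of $Z$, the arrangement is free if the syzygy module of the Jacobian ideal $(\Lambda_{x_0},\Lambda_{x_1},\Lambda_{x_2})$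 is free (there are no second syzygies for this ideal). Tangent cone form: for a reduced form $H$ in $x_0,x_1,x_2$ with a point $P$ of multiplicity $m$, let $\mu_j$ enumerate the monomials of degree $m$ in $x_0,x_1,x_2$, let $\mu\cdot H$ denote the action of $\mu$ on $H$ as the corresponding partial differentiation operator, and $c_j=\mu_j\cdot\mu_j$. Set $H_P=\sum_j\frac{((\mu_j\cdot H)(P))\,\mu_j}{c_j}$, the degree $m$ form defining the tangent cone of $H=0$ at $P$. For bi-homogeneous $F(a,x)$, $F_P(a,x)$ is $H_P$ for $H=F(a,x)$ regarded as a form in $x$, at the point $x=P=a$. $F(x,a)$ is obtained from $F(a,x)$ by interchanging $a_i$ and $x_i$ for all $i$. *)

theory Defs
  imports "HOL-Analysis.Analysis" "HOL-Library.Poly_Mapping"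
    "HOL-Computational_Algebra.Fraction_Field"
begin

section \<open>Forms in three variables\<close>

text \<open>The three variables are indexed by the type \<open>3\<close>, whose elements are \<open>0\<close>, \<open>1\<close>, \<open>2\<close>;
  exponents and polynomials are finitely supported functions.\<close>

type_synonym 'a poly3 = "(3 \<Rightarrow>\<^sub>0 nat) \<Rightarrow>\<^sub>0 'a"

definition mdeg :: "(3 \<Rightarrow>\<^sub>0 nat) \<Rightarrow> nat" where
  "mdeg t = (\<Sum>i\<in>UNIV. Poly_Mapping.lookup t i)"

definition homogeneous :: "nat \<Rightarrow> 'a::zero poly3 \<Rightarrow> bool" where
  "homogeneous d p \<longleftrightarrow> (\<forall>t\<in>Poly_Mapping.keys p. mdeg t = d)"

definition Cst :: "'a::zero \<Rightarrow> 'a poly3" where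
  "Cst c = Poly_Mapping.single 0 c"

definition Var :: "3 \<Rightarrow> 'a::zero_neq_one poly3" where
  "Var i = Poly_Mapping.single (Poly_Mapping.single i 1) 1"

text \<open>Apply \<open>h\<close> to the coefficients and substitute \<open>v\<close> for the variables.\<close>

definition eval_hom :: "('a::zero \<Rightarrow> 'b::comm_semiring_1) \<Rightarrow> 'b ^ 3 \<Rightarrow> 'a poly3 \<Rightarrow> 'b" where
  "eval_hom h v p = (\<Sum>t\<in>Poly_Mapping.keys p. h (Poly_Mapping.lookup p t) * (\<Prod>i\<in>UNIV. v $ i ^ Poly_Mapping.lookup t i))"

abbreviation eval3 :: "'a::comm_semiring_1 ^ 3 \<Rightarrow> 'a poly3 \<Rightarrow> 'a" where
  "eval3 \<equiv> eval_hom (\<lambda>c. c)"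

definition pd :: "3 \<Rightarrow> 'a::comm_semiring_1 poly3 \<Rightarrow> 'a poly3" where
  "pd i p = (\<Sum>t\<in>Poly_Mapping.keys p.
     Poly_Mapping.single (t - Poly_Mapping.single i 1) (of_nat (Poly_Mapping.lookup t i) * Poly_Mapping.lookup p t))"

text \<open>The action of the monomial with exponent \<open>t\<close> as a differential operator.\<close>

definition mono_act :: "(3 \<Rightarrow>\<^sub>0 nat) \<Rightarrow> 'a::comm_semiring_1 poly3 \<Rightarrow> 'a poly3" where
  "mono_act t H = (pd 0 ^^ Poly_Mapping.lookup t 0) ((pd 1 ^^ Poly_Mapping.lookup t 1) ((pd 2 ^^ Poly_Mapping.lookup t 2) H))"


section \<open>Ideals, dimensions and free modules\<close>

global_interpretation ideal: module "(*) :: 'a::comm_ring_1 \<Rightarrow> 'a \<Rightarrow> 'a"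
  by unfold_locales (simp_all add: algebra_simps)

global_interpretation pvec: module "(*s) :: 'a::comm_ring_1 \<Rightarrow> 'a ^ 'n \<Rightarrow> 'a ^ 'n"
  by unfold_locales (simp_all add: vec_eq_iff algebra_simps)

global_interpretation form_space: vector_space "\<lambda>(c::'a::field) (f::'a poly3). Cst c * f"
proof unfold_locales
  fix a b :: 'a and f g :: "'a poly3"
  show "Cst a * (f + g) = Cst a * f + Cst a * g" by (rule distrib_left)
  show "Cst (a + b) * f = Cst a * f + Cst b * f"
    by (simp add: Cst_def single_add distrib_right)
  show "Cst a * (Cst b * f) = Cst (a * b) * f"
    by (simp add: Cst_def mult_single mult.assoc[symmetric])
  show "Cst 1 * f = f" by (simp add: Cst_def)
qed

definition ideal_power :: "'a::comm_ring_1 set \<Rightarrow> nat \<Rightarrow> 'a set" where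
  "ideal_power I m = ideal.span {\<Prod>i<m. f i |f. \<forall>i<m. f i \<in> I}"

text \<open>The set \<open>V\<close> consists of coordinate vectors of projective points.\<close>

definition vanishing_ideal :: "('a::comm_ring_1 ^ 3) set \<Rightarrow> 'a poly3 set" where
  "vanishing_ideal V = ideal.span {f. (\<exists>d. homogeneous d f) \<and> (\<forall>v\<in>V. eval3 v f = 0)}"

definition degree_part :: "nat \<Rightarrow> 'a::zero poly3 set \<Rightarrow> 'a poly3 set" where
  "degree_part d I = {f \<in> I. homogeneous d f}"

definition has_multiplicity_at :: "nat \<Rightarrow> 'a::comm_ring_1 poly3 \<Rightarrow> 'a ^ 3 \<Rightarrow> bool" where
  "has_multiplicity_at m H v \<longleftrightarrow>
     H \<in> ideal_power (vanishing_ideal {v}) m \<and> H \<notin> ideal_power (vanishing_ideal {v}) (Suc m)"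

definition free_submodule :: "('a::comm_ring_1 ^ 'n) set \<Rightarrow> bool" where
  "free_submodule M \<longleftrightarrow> (\<exists>B\<subseteq>M. pvec.independent B \<and> pvec.span B = M)"


section \<open>The projective plane\<close>

definition proj_rel :: "'k::field ^ 3 \<Rightarrow> 'k ^ 3 \<Rightarrow> bool" where
  "proj_rel v w \<longleftrightarrow> v \<noteq> 0 \<and> w \<noteq> 0 \<and> (\<exists>c. c \<noteq> 0 \<and> w = c *s v)"

quotient_type (overloaded) 'k proj2 = "'k::field ^ 3" / partial: proj_rel
proof (rule part_equivpI)
  show "\<exists>x::'k ^ 3. proj_rel x x"
    by (rule exI[of _ "vec 1"]) (auto simp: proj_rel_def vec_eq_iff intro!: exI[of _ 1])
  show "symp (proj_rel :: 'k ^ 3 \<Rightarrow> _)"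
  proof (rule sympI)
    fix v w :: "'k ^ 3" assume "proj_rel v w"
    then obtain c where "v \<noteq> 0" "w \<noteq> 0" "c \<noteq> 0" "w = c *s v" by (auto simp: proj_rel_def)
    then show "proj_rel w v"
      unfolding proj_rel_def
      by (intro conjI exI[of _ "inverse c"])
        (simp_all add: vector_smult_assoc)
  qed
  show "transp (proj_rel :: 'k ^ 3 \<Rightarrow> _)"
  proof (rule transpI)
    fix u v w :: "'k ^ 3" assume "proj_rel u v" "proj_rel v w"
    then obtain c d where "u \<noteq> 0" "w \<noteq> 0" "c \<noteq> 0" "v = c *s u" "d \<noteq> 0" "w = d *s v"
      by (auto simp: proj_rel_def)
    then show "proj_rel u w"
      unfolding proj_rel_def
      by (intro conjI exI[of _ "d * c"]) (simp_all add: vector_smult_assoc)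
  qed
qed


section \<open>Free line arrangements\<close>

definition dual_line :: "'k::field proj2 \<Rightarrow> 'k poly3" where
  "dual_line p = (\<Sum>i\<in>UNIV. Cst (rep_proj2 p $ i) * Var i)"

definition arrangement_form :: "'k::field proj2 set \<Rightarrow> 'k poly3" where
  "arrangement_form Z = (\<Prod>p\<in>Z. dual_line p)"

definition jacobian_syzygies :: "'k::comm_ring_1 poly3 \<Rightarrow> ('k poly3 ^ 3) set" where
  "jacobian_syzygies \<Lambda> = {s. (\<Sum>i\<in>UNIV. s $ i * pd i \<Lambda>) = 0}"

definition free_arrangement :: "'k::field proj2 set \<Rightarrow> bool" where
  "free_arrangement Z \<longleftrightarrow> free_submodule (jacobian_syzygies (arrangement_form Z))"


section \<open>The field of definition of the generic point\<close>

text \<open>The field \<open>K(a\<^sub>1/a\<^sub>0, a\<^sub>2/a\<^sub>0)\<close> is the subfield of the fraction field of \<open>K[a\<^sub>0,a\<^sub>1,a\<^sub>2]\<close>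
  generated by \<open>K\<close> and the quotients \<open>a\<^sub>i/a\<^sub>0\<close>.\<close>

inductive_set ratfun_set :: "'k::field poly3 fract set" where
  const: "Fract (Cst c) 1 \<in> ratfun_set"
| gen: "Fract (Var i) (Var 0) \<in> ratfun_set"
| add: "x \<in> ratfun_set \<Longrightarrow> y \<in> ratfun_set \<Longrightarrow> x + y \<in> ratfun_set"
| uminus: "x \<in> ratfun_set \<Longrightarrow> - x \<in> ratfun_set"
| mult: "x \<in> ratfun_set \<Longrightarrow> y \<in> ratfun_set \<Longrightarrow> x * y \<in> ratfun_set"
| inverse: "x \<in> ratfun_set \<Longrightarrow> inverse x \<in> ratfun_set"

lemma zero_in_ratfun_set: "0 \<in> ratfun_set"
  using ratfun_set.const[of 0] by (simp add: Cst_def Zero_fract_def)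

lemma one_in_ratfun_set: "1 \<in> ratfun_set"
  using ratfun_set.const[of 1] by (simp add: Cst_def One_fract_def)

typedef (overloaded) 'k ratfun = "ratfun_set :: 'k::field poly3 fract set"
  using zero_in_ratfun_set by blast

setup_lifting type_definition_ratfun

instantiation ratfun :: (field) field
begin

lift_definition zero_ratfun :: "'a ratfun" is 0 by (rule zero_in_ratfun_set)
lift_definition one_ratfun :: "'a ratfun" is 1 by (rule one_in_ratfun_set)
lift_definition plus_ratfun :: "'a ratfun \<Rightarrow> 'a ratfun \<Rightarrow> 'a ratfun" is "(+)"
  by (rule ratfun_set.add)
lift_definition uminus_ratfun :: "'a ratfun \<Rightarrow> 'a ratfun" is uminus
  by (rule ratfun_set.uminus)
lift_definition minus_ratfun :: "'a ratfun \<Rightarrow> 'a ratfun \<Rightarrow> 'a ratfun" is "(-)"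
  unfolding diff_conv_add_uminus by (intro ratfun_set.add ratfun_set.uminus)
lift_definition times_ratfun :: "'a ratfun \<Rightarrow> 'a ratfun \<Rightarrow> 'a ratfun" is "(*)"
  by (rule ratfun_set.mult)
lift_definition inverse_ratfun :: "'a ratfun \<Rightarrow> 'a ratfun" is inverse
  by (rule ratfun_set.inverse)
lift_definition divide_ratfun :: "'a ratfun \<Rightarrow> 'a ratfun \<Rightarrow> 'a ratfun" is "(/)"
  unfolding divide_inverse by (intro ratfun_set.mult ratfun_set.inverse)

instance
proof
  fix x y z :: "'a ratfun"
  show "x * y * z = x * (y * z)" by transfer (rule mult.assoc)
  show "x * y = y * x" by transfer (rule mult.commute)
  show "1 * x = x" by transfer (rule mult_1_left)
  show "x + y + z = x + (y + z)" by transfer (rule add.assoc)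
  show "x + y = y + x" by transfer (rule add.commute)
  show "0 + x = x" by transfer (rule add_0_left)
  show "- x + x = 0" by transfer (rule left_minus)
  show "x - y = x + - y" by transfer (rule diff_conv_add_uminus)
  show "(x + y) * z = x * z + y * z" by transfer (rule distrib_right)
  show "(0 :: 'a ratfun) \<noteq> 1" by transfer (rule zero_neq_one)
  show "x \<noteq> 0 \<Longrightarrow> inverse x * x = 1" by transfer (rule left_inverse)
  show "x div y = x * inverse y" by transfer (rule divide_inverse)
  show "inverse (0 :: 'a ratfun) = 0" by transfer (rule inverse_zero)
qed

end

lift_definition ratfun_const :: "'k::field \<Rightarrow> 'k ratfun" is "\<lambda>c. Fract (Cst c) 1"
  by (rule ratfun_set.const)

lift_definition ratfun_gen :: "3 \<Rightarrow> 'k::field ratfun" is "\<lambda>i. Fract (Var i) (Var 0)"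
  by (rule ratfun_set.gen)

text \<open>The coordinates \<open>(1, a\<^sub>1/a\<^sub>0, a\<^sub>2/a\<^sub>0)\<close> of the generic point.\<close>

definition generic_point :: "'k::field ratfun ^ 3" where
  "generic_point = (\<chi> i. ratfun_gen i)"


section \<open>Unexpected curves\<close>

definition points_ideal :: "'k::field proj2 set \<Rightarrow> 'k ratfun poly3 set" where
  "points_ideal Z = vanishing_ideal ((\<lambda>p. \<chi> i. ratfun_const (rep_proj2 p $ i)) ` Z)"

definition fat_system :: "'k::field proj2 set \<Rightarrow> nat \<Rightarrow> nat \<Rightarrow> 'k ratfun poly3 set" where
  "fat_system Z d m =
     degree_part d (points_ideal Z \<inter> ideal_power (vanishing_ideal {generic_point}) m)"

definition admits_unexpected :: "'k::field proj2 set \<Rightarrow> nat \<Rightarrow> nat \<Rightarrow> bool" where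
  "admits_unexpected Z d m \<longleftrightarrow>
     int (form_space.dim (fat_system Z d m)) >
       max 0 (int (form_space.dim (degree_part d (points_ideal Z))) - int ((m + 1) choose 2))"

text \<open>\<open>F\<close> defines an unexpected curve of degree \<open>d\<close> with the generic point of multiplicity \<open>m\<close>.\<close>

definition unexpected_form :: "'k::field proj2 set \<Rightarrow> nat \<Rightarrow> nat \<Rightarrow> 'k ratfun poly3 \<Rightarrow> bool" where
  "unexpected_form Z d m F \<longleftrightarrow> admits_unexpected Z d m \<and> F \<in> fat_system Z d m \<and> F \<noteq> 0"

definition same_curve :: "'a::field poly3 \<Rightarrow> 'a poly3 \<Rightarrow> bool" where
  "same_curve F G \<longleftrightarrow> (\<exists>c. c \<noteq> 0 \<and> G = Cst c * F)"


section \<open>Bi-homogeneous forms\<close>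

text \<open>The ring \<open>R = K[a\<^sub>0,a\<^sub>1,a\<^sub>2][x\<^sub>0,x\<^sub>1,x\<^sub>2]\<close> is \<open>'k poly3 poly3\<close>:
  the outer variables are the \<open>x\<^sub>i\<close>, the inner ones the \<open>a\<^sub>i\<close>.\<close>

definition bihomogeneous :: "nat \<Rightarrow> nat \<Rightarrow> 'k::zero poly3 poly3 \<Rightarrow> bool" where
  "bihomogeneous s d G \<longleftrightarrow> homogeneous d G \<and> (\<forall>t. homogeneous s (Poly_Mapping.lookup G t))"

text \<open>From \<open>F(a,x)\<close> to \<open>F(x,a)\<close>.\<close>

definition swap_vars :: "'k::comm_semiring_1 poly3 poly3 \<Rightarrow> 'k poly3 poly3" where
  "swap_vars F = eval_hom (eval_hom (\<lambda>c. Cst (Cst c)) (\<chi> i. Var i)) (\<chi> i. Cst (Var i)) F"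

text \<open>\<open>F(P,x)\<close> for the generic point \<open>P\<close>.\<close>

definition at_generic :: "'k::field poly3 poly3 \<Rightarrow> 'k ratfun poly3" where
  "at_generic F = Poly_Mapping.map (eval_hom ratfun_const generic_point) F"

text \<open>\<open>G\<close> is the last factor in a factorization \<open>F = BG/H\<close> over the fraction field of
  \<open>K[a\<^sub>0,a\<^sub>1,a\<^sub>2]\<close>; it is unique up to scalars in \<open>K\<close>.\<close>

definition is_star :: "'k::field ratfun poly3 \<Rightarrow> 'k poly3 poly3 \<Rightarrow> bool" where
  "is_star F G \<longleftrightarrow>
     (\<exists>B H. (\<exists>b. homogeneous b B) \<and> (\<exists>h. homogeneous h H) \<and> H \<noteq> 0 \<and>
        (\<forall>D. D dvd B \<longrightarrow> D dvd H \<longrightarrow> D dvd 1) \<and>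
        Poly_Mapping.map Rep_ratfun F = Cst (Fract B H) * Poly_Mapping.map (\<lambda>c. Fract c 1) G) \<and>
     (\<exists>s d. bihomogeneous s d G) \<and>
     (\<forall>e A. e > 0 \<longrightarrow> bihomogeneous e 0 A \<longrightarrow> \<not> A dvd G)"

definition star :: "'k::field ratfun poly3 \<Rightarrow> 'k poly3 poly3" where
  "star F = (SOME G. is_star F G)"


section \<open>Tangent cones\<close>

text \<open>The constant \<open>c\<^sub>j = \<mu>\<^sub>j \<cdot> \<mu>\<^sub>j\<close> for the monomial \<open>\<mu>\<^sub>j\<close> with exponent \<open>t\<close>.\<close>

definition mono_const :: "(3 \<Rightarrow>\<^sub>0 nat) \<Rightarrow> 'k::comm_semiring_1" where
  "mono_const t = Poly_Mapping.lookup (mono_act t (Poly_Mapping.single t 1)) 0"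

text \<open>The form \<open>H\<^sub>P\<close>, for \<open>H\<close> with coefficients in a \<open>K\<close>-algebra with structure map \<open>\<iota>\<close>.
  The coefficients need not form a field, so the \<open>c\<^sub>j\<close> are inverted in \<open>K\<close>.\<close>

definition tangent_cone_form ::
  "('k::field \<Rightarrow> 'a::comm_ring_1) \<Rightarrow> nat \<Rightarrow> 'a poly3 \<Rightarrow> 'a ^ 3 \<Rightarrow> 'a poly3" where
  "tangent_cone_form \<iota> m H P =
     (\<Sum>t | mdeg t = m. Poly_Mapping.single t (\<iota> (inverse (mono_const t)) * eval3 P (mono_act t H)))"

end

theory Submission
  imports Defs "Berlekamp_Zassenhaus.Unique_Factorization_Poly"
begin

text \<open>
  A form \<open>G\<close> of degree \<open>m + 1\<close> with multiplicity \<open>m\<close> at \<open>P\<close> satisfies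
  \<open>G(x + s P) = G(x) + s G\<^sub>1(x)\<close>. If \<open>F\<close> and \<open>G\<close> are two such forms vanishing on \<open>Z\<close>, then
  \<open>G\<^sub>1 F - F\<^sub>1 G\<close> is invariant under translation by \<open>P\<close>, hence amounts to a polynomial of degree at
  most \<open>2 m + 1\<close> on the pencil of lines through \<open>P\<close>, which vanishes at the lines through \<open>Z\<close>. The
  system of all \<open>G\<close> is so large by unexpectedness that, were it not spanned by \<open>F\<close>, some \<open>G\<close> outside
  the span would make this polynomial vanish identically; an irreducible \<open>F\<close> would then divide \<open>G\<close>.

  Every \<open>F\<close> as above is \<open>\<sigma>(P \<times> x) \<sqdot> x\<close> for a vector field \<open>\<sigma>\<close> of degree \<open>m\<close>. That \<open>F\<close>
  vanishes on \<open>Z\<close> makes \<open>\<sigma>\<close>, up to a multiple of the Euler field, a syzygy of the gradient of \<open>\<Lambda>\<close> on the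
  line dual to \<open>P\<close>. For a free arrangement the Jacobian ideal is saturated, so this syzygy is the
  restriction of a combination of syzygies \<open>S\<close> over \<open>K\<close>. Each \<open>\<Phi>(a,x) = S(a \<times> x) \<sqdot> x\<close> lies in the
  system, so \<open>F\<close> is a multiple of one of them by uniqueness. The bi-degree and the multiplicity in \<open>a\<close>
  are visible on \<open>\<Phi>\<close>, and \<open>\<Phi>(a + s x, x) = \<Phi>(a, x)\<close> excludes factors of bi-degree \<open>(e,0)\<close>.

  For the tangent cone, multiplicity \<open>m\<close> and degree \<open>m\<close> in \<open>a\<close> give
  \<open>\<Phi>(a, a + s x) = (-s)\<^sup>m \<Phi>(x, a + s x)\<close>; compare the coefficients of \<open>s\<^sup>m\<close>.
\<close>

text \<open>Unexpectedness enters through one count. Forms of degree \<open>m + 1\<close> have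
  dimension (m+3 choose 2), each point of \<open>Z\<close> costs at most one condition, and (m+3
  choose 2) - (m+1 choose 2) = 2m + 3; so the system has dimension at least 2m + 4 - card Z. The
  invariant has degree 2m + 1 on the pencil and the roots given by \<open>Z\<close>; forcing the
  roots still missing from 2m + 2, at one condition each, leaves at least a plane of forms, hence
  one outside the span of \<open>F\<close>. The division needs F_1 nonzero. Otherwise
  \<open>F\<close> is a cone with vertex \<open>P\<close> and splits off the line from
  \<open>P\<close> to a point of \<open>Z\<close>; for empty \<open>Z\<close> a second count
  contradicts unexpectedness. Multiples of the Euler field may be dropped from \<sigma> because (P
  \<times> x) \<sqdot> x = 0. The field of the generic point consists of fractions of degree 0, so a
  polynomial in \<open>a\<close> that vanishes at \<open>P\<close> need not be zero, whereas a form
  must be. Denominators are therefore cleared with numerators of one common degree.\<close>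

no_notation Matrix.vec_index (infixl "$" 100)

text \<open>Instantiated with multiplication, this simp rule reassociates all products.\<close>

declare ideal.scale_scale [simp del]

abbreviation (input) lk :: "('a \<Rightarrow>\<^sub>0 'b::zero) \<Rightarrow> 'a \<Rightarrow> 'b" where "lk \<equiv> Poly_Mapping.lookup"

section \<open>Substitution homomorphisms\<close>

text \<open>Literals of this type are read modulo 3, so enumerations by 1, 2, 3 have to be turned
  into 0, 1, 2.\<close>

lemma three_eq_0: "(3::3) = 0" by simp

lemma distinct_3 [simp]: "(0::3) \<noteq> 1" "(0::3) \<noteq> 2" "(1::3) \<noteq> 2" "(1::3) \<noteq> 0" "(2::3) \<noteq> 0" "(2::3) \<noteq> 1"
  by simp_all

lemma UNIV_3_eq: "(UNIV :: 3 set) = {0, 1, 2}"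
  unfolding UNIV_3 three_eq_0 by auto

lemma sum_UNIV_3: "(\<Sum>i\<in>(UNIV :: 3 set). f i) = f 0 + f 1 + f (2::3)"
  unfolding UNIV_3_eq by (simp add: add.assoc)

lemma prod_UNIV_3: "(\<Prod>i\<in>(UNIV :: 3 set). f i) = f 0 * f 1 * f (2::3)"
  unfolding UNIV_3_eq  by (simp add: mult.assoc)

lemma all_3: "(\<forall>i::3. Q i) \<longleftrightarrow> Q 0 \<and> Q 1 \<and> Q 2"
  unfolding forall_3 three_eq_0 by blast

lemma poly_mapping_sum_single: "p = (\<Sum>t\<in>Poly_Mapping.keys p. Poly_Mapping.single t (lk p t))"
  by (rule poly_mapping_eqI)
    (simp add: lookup_sum lookup_single when_def in_keys_iff)

lemma poly_mapping_3_eq_single: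
  "(t :: 3 \<Rightarrow>\<^sub>0 'a::comm_monoid_add) = Poly_Mapping.single 0 (lk t 0) + Poly_Mapping.single 1 (lk t 1) + Poly_Mapping.single 2 (lk t 2)"
proof (rule poly_mapping_eqI)
  fix k :: 3
  have "k = 0 \<or> k = 1 \<or> k = 2" using UNIV_3_eq by blast
  then show "lk t k = lk (Poly_Mapping.single 0 (lk t 0) + Poly_Mapping.single 1 (lk t 1) + Poly_Mapping.single 2 (lk t 2)) k"
    by (auto simp: lookup_add lookup_single when_def)
qed

lemma Var_power: "Var i ^ n = Poly_Mapping.single (Poly_Mapping.single i n) (1::'a::comm_ring_1)"
  by (induction n) (simp_all add: Var_def mult_single single_add[symmetric] One_nat_def)

lemma single_eq_Cst_Var:
  "Poly_Mapping.single t (c::'a::comm_ring_1) = Cst c * (\<Prod>i\<in>UNIV. Var i ^ lk t i)"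
proof -
  have "Cst c * (\<Prod>i\<in>UNIV. Var i ^ lk t i) =
      Poly_Mapping.single (Poly_Mapping.single 0 (lk t 0) + Poly_Mapping.single 1 (lk t 1) + Poly_Mapping.single 2 (lk t 2)) c"
    by (simp add: prod_UNIV_3 Var_power Cst_def mult_single)
  then show ?thesis by (simp only: poly_mapping_3_eq_single[of t, symmetric])
qed

text \<open>Constants and variables generate the ring, so statements compatible with sums and
  products need not mention exponents. Chiefly used to compare substitutions.\<close>

lemma poly3_induct [case_names Cst Var add mult]:
  fixes p :: "'a::comm_ring_1 poly3"
  assumes "\<And>c. Q (Cst c)" "\<And>i. Q (Var i)" "\<And>p q. Q p \<Longrightarrow> Q q \<Longrightarrow> Q (p + q)" "\<And>p q. Q p \<Longrightarrow> Q q \<Longrightarrow> Q (p * q)"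
  shows "Q p"
proof -
  have one: "Q 1" using assms(1)[of 1] by (simp add: Cst_def)
  have pow: "Q (Var i ^ n)" for i n
    by (induction n) (auto intro: one assms)
  have "Q (Poly_Mapping.single t c)" for t c
    unfolding single_eq_Cst_Var prod_UNIV_3 by (intro assms pow)
  moreover have "Q 0" using assms(1)[of 0] by (simp add: Cst_def)
  ultimately have "Q (\<Sum>t\<in>A. Poly_Mapping.single t (lk p t))" for A
    by (induction A rule: infinite_finite_induct) (auto intro: assms)
  from this[of "Poly_Mapping.keys p"] show ?thesis
    by (simp only: poly_mapping_sum_single[symmetric])
qed

lemma comm_ring_homI:
  assumes "h 0 = 0" "h 1 = 1" "\<And>x y. h (x + y) = h x + h y" "\<And>x y. h (x * y) = h x * h y"
  shows "comm_ring_hom h"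
  by unfold_locales (auto simp: assms)

text \<open>The laws are restated outside the locale so that they can be instantiated at concrete
  maps such as \<open>eval_hom h v\<close>.\<close>

lemma
  assumes "comm_ring_hom h"
  shows crh_0: "h 0 = 0" and crh_1: "h 1 = 1" and crh_add: "h (x + y) = h x + h y"
    and crh_mult: "h (x * y) = h x * h y" and crh_uminus: "h (- x) = - h x"
    and crh_minus: "h (x - y) = h x - h y" and crh_power: "h (x ^ n) = h x ^ n"
    and crh_sum: "h (sum f A) = (\<Sum>a\<in>A. h (f a))"
    and crh_prod: "h (prod f A) = (\<Prod>a\<in>A. h (f a))"
    and crh_of_nat: "h (of_nat n) = of_nat n"
proof -
  interpret comm_ring_hom h by fact
  show "h 0 = 0" "h 1 = 1" "h (x + y) = h x + h y" "h (x * y) = h x * h y" "h (- x) = - h x"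
    "h (x - y) = h x - h y" "h (x ^ n) = h x ^ n" "h (sum f A) = (\<Sum>a\<in>A. h (f a))"
    "h (prod f A) = (\<Prod>a\<in>A. h (f a))"
    by (simp_all add: hom_distribs)
  show "h (of_nat n) = of_nat n" by (induction n) (simp_all add: hom_distribs)
qed

lemmas crh_simps = crh_0 crh_1 crh_add crh_mult crh_uminus crh_minus crh_power crh_sum crh_prod crh_of_nat

lemma comm_ring_hom_id [simp]: "comm_ring_hom (\<lambda>c. c)"
  by (rule comm_ring_homI) auto

lemma comm_ring_hom_comp: "comm_ring_hom g \<Longrightarrow> comm_ring_hom h \<Longrightarrow> comm_ring_hom (\<lambda>x. g (h x))"
  by (rule comm_ring_homI) (simp_all add: crh_simps[of h] crh_simps[of g])

lemma comm_ring_hom_Cst [simp]: "comm_ring_hom Cst"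
  by (rule comm_ring_homI) (simp_all add: Cst_def single_add mult_single)

lemma comm_ring_hom_const_poly [simp]: "comm_ring_hom (\<lambda>c. [:c:])"
  by (rule comm_ring_homI) simp_all

lemma comm_ring_hom_Cst_comp [simp]: "comm_ring_hom h \<Longrightarrow> comm_ring_hom (\<lambda>c. Cst (h c))"
  by (rule comm_ring_hom_comp[OF comm_ring_hom_Cst])

lemma comm_ring_hom_const_poly_comp [simp]: "comm_ring_hom h \<Longrightarrow> comm_ring_hom (\<lambda>c. [:h c:])"
  by (rule comm_ring_hom_comp[OF comm_ring_hom_const_poly])

lemma Cst_0 [simp]: "Cst 0 = 0" and Cst_1 [simp]: "Cst 1 = 1"
  by (simp_all add: Cst_def)

lemma Cst_eq_0_iff [simp]: "Cst c = 0 \<longleftrightarrow> c = 0"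
  unfolding Cst_def by (metis lookup_single_eq lookup_zero single_zero)

text \<open>Terms may cancel in a sum, so evaluations are compared over a common finite index set
  instead of the support of each polynomial.\<close>

lemma eval_hom_superset:
  assumes "h 0 = 0" "finite A" "Poly_Mapping.keys p \<subseteq> A"
  shows "eval_hom h v p = (\<Sum>t\<in>A. h (lk p t) * (\<Prod>i\<in>UNIV. v $ i ^ lk t i))"
  unfolding eval_hom_def using assms by (intro sum.mono_neutral_left) (auto simp: in_keys_iff)

lemma eval_hom_single:
  assumes "h 0 = 0"
  shows "eval_hom h v (Poly_Mapping.single t c) = h c * (\<Prod>i\<in>UNIV. v $ i ^ lk t i)"
  using eval_hom_superset[where h = h, OF assms, of "{t}" "Poly_Mapping.single t c"] by simp

lemma eval_hom_add:
  assumes "comm_ring_hom h"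
  shows "eval_hom h v (p + q) = eval_hom h v p + eval_hom h v q"
proof -
  let ?A = "Poly_Mapping.keys p \<union> Poly_Mapping.keys q"
  have "Poly_Mapping.keys (p + q) \<subseteq> ?A" by (rule Poly_Mapping.keys_add)
  then show ?thesis
    using eval_hom_superset[of h ?A p v] eval_hom_superset[of h ?A q v] eval_hom_superset[of h ?A "p + q" v] assms
    by (simp add: crh_simps[OF assms] lookup_add algebra_simps sum.distrib)
qed

lemma eval_hom_sum:
  assumes "comm_ring_hom h"
  shows "eval_hom h v (sum f A) = (\<Sum>a\<in>A. eval_hom h v (f a))"
proof -
  have "eval_hom h v 0 = 0" by (simp add: eval_hom_def)
  then show ?thesis
    by (induction A rule: infinite_finite_induct) (auto simp: eval_hom_add[OF assms])
qed

lemma eval_hom_mult: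
  assumes "comm_ring_hom h"
  shows "eval_hom h v (p * q) = eval_hom h v p * eval_hom h v q"
proof -
  let ?s = "\<lambda>p t. Poly_Mapping.single t (lk p t)"
  have *: "eval_hom h v (?s p t * ?s q u) = eval_hom h v (?s p t) * eval_hom h v (?s q u)" for t u
    unfolding mult_single eval_hom_single[where h = h, OF crh_0[OF assms]] crh_mult[OF assms]
      lookup_add power_add prod.distrib by (simp only: mult_ac)
  have "eval_hom h v ((\<Sum>t\<in>Poly_Mapping.keys p. ?s p t) * (\<Sum>t\<in>Poly_Mapping.keys q. ?s q t)) =
      eval_hom h v (\<Sum>t\<in>Poly_Mapping.keys p. ?s p t) * eval_hom h v (\<Sum>t\<in>Poly_Mapping.keys q. ?s q t)"
    unfolding sum_product eval_hom_sum[OF assms] * ..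
  then show ?thesis by (simp only: poly_mapping_sum_single[symmetric])
qed

lemma eval_hom_Cst: "comm_ring_hom h \<Longrightarrow> eval_hom h v (Cst c) = h c"
  by (simp add: Cst_def eval_hom_single crh_0)

lemma eval_hom_Var:
  assumes "comm_ring_hom h"
  shows "eval_hom h v (Var i) = v $ i"
proof -
  have "\<forall>i. eval_hom h v (Var i) = v $ i"
    unfolding all_3 using assms by (simp add: Var_def eval_hom_single crh_0 crh_1 lookup_single prod_UNIV_3)
  then show ?thesis by blast
qed

lemma comm_ring_hom_eval_hom [simp]:
  assumes "comm_ring_hom h"
  shows "comm_ring_hom (eval_hom h v)"
proof (rule comm_ring_homI)
  show "eval_hom h v 0 = 0" using eval_hom_Cst[OF assms, of v 0] by (simp add: crh_0[OF assms])
  show "eval_hom h v 1 = 1" using eval_hom_Cst[OF assms, of v 1] by (simp add: crh_1[OF assms])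
qed (rule eval_hom_add[OF assms], rule eval_hom_mult[OF assms])

lemmas eval_simps = eval_hom_Cst eval_hom_Var crh_simps[OF comm_ring_hom_eval_hom]

lemma poly3_hom_eqI:
  assumes "comm_ring_hom f" "comm_ring_hom g" "\<And>c. f (Cst c) = g (Cst c)" "\<And>i. f (Var i) = g (Var i)"
  shows "f p = g p"
  by (induction p rule: poly3_induct) (use assms in \<open>simp_all add: crh_simps[of f] crh_simps[of g]\<close>)

lemma eval_hom_comp:
  assumes "comm_ring_hom g" "comm_ring_hom h"
  shows "g (eval_hom h v p) = eval_hom (\<lambda>c. g (h c)) (\<chi> i. g (v $ i)) p"
  by (rule poly3_hom_eqI[of "\<lambda>p. g (eval_hom h v p)"])
    (use assms comm_ring_hom_comp[of g h] comm_ring_hom_comp[of g "eval_hom h v"] in \<open>simp_all add: eval_simps\<close>)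

lemma eval_hom_Cst_Var [simp]: "eval_hom Cst (\<chi> i. Var i) p = (p :: 'a::comm_ring_1 poly3)"
  by (rule poly3_hom_eqI[of "eval_hom Cst (\<chi> i. Var i)" "\<lambda>x. x"]) (auto simp: eval_simps)

text \<open>A change of coefficients is the substitution that fixes the variables; in this form it
  inherits the homomorphism laws.\<close>

lemma map_eq_eval_hom:
  assumes "comm_ring_hom h"
  shows "Poly_Mapping.map h p = eval_hom (\<lambda>c. Cst (h c)) (\<chi> i. Var i) p"
proof -
  have "lk (eval_hom (\<lambda>c. Cst (h c)) (\<chi> i. Var i) p) t = lk (Poly_Mapping.map h p) t" for t
    using assms
    by (simp add: eval_hom_def single_eq_Cst_Var[symmetric] lookup_sum Poly_Mapping.map.rep_eq lookup_single when_def
       in_keys_iff crh_simps[OF assms])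
  then show ?thesis by (simp add: poly_mapping_eqI)
qed

lemma lookup_map: "h 0 = 0 \<Longrightarrow> lk (Poly_Mapping.map h p) t = h (lk p t)"
  by (simp add: Poly_Mapping.map.rep_eq when_def)

lemma comm_ring_hom_map [simp]:
  fixes h :: "'a::comm_ring_1 \<Rightarrow> 'b::comm_ring_1"
  assumes "comm_ring_hom h"
  shows "comm_ring_hom (Poly_Mapping.map h :: 'a poly3 \<Rightarrow> 'b poly3)"
proof -
  have "(Poly_Mapping.map h :: 'a poly3 \<Rightarrow> 'b poly3) = eval_hom (\<lambda>c. Cst (h c)) (\<chi> i. Var i)"
    by (rule ext) (rule map_eq_eval_hom[OF assms])
  then show ?thesis using assms by simp
qed

lemma map_Cst: "h 0 = 0 \<Longrightarrow> Poly_Mapping.map h (Cst c) = Cst (h c)"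
  by (simp add: Cst_def)

lemma map_Var: "h 0 = 0 \<Longrightarrow> h 1 = 1 \<Longrightarrow> Poly_Mapping.map h (Var i) = Var i"
  by (simp add: Var_def)

lemma eval_hom_map:
  assumes "comm_ring_hom g" "comm_ring_hom h"
  shows "eval_hom g v (Poly_Mapping.map h p) = eval_hom (\<lambda>c. g (h c)) v p"
proof -
  have 1: "comm_ring_hom (\<lambda>c. g (h c))" by (rule comm_ring_hom_comp[OF assms])
  note 2 = comm_ring_hom_eval_hom[OF assms(1), of v]
  note 3 = comm_ring_hom_map[OF assms(2)]
  show ?thesis
  proof (rule poly3_hom_eqI[of "\<lambda>p. eval_hom g v (Poly_Mapping.map h p)"])
    show "comm_ring_hom (\<lambda>p. eval_hom g v (Poly_Mapping.map h p))"
      by (rule comm_ring_hom_comp[OF 2 3])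
    show "comm_ring_hom (eval_hom (\<lambda>c. g (h c)) v)" by (rule comm_ring_hom_eval_hom[OF 1])
    show "eval_hom g v (Poly_Mapping.map h (Cst c)) = eval_hom (\<lambda>c. g (h c)) v (Cst c)" for c
      by (simp add: map_Cst crh_0[OF assms(2)] eval_hom_Cst[OF assms(1)] eval_hom_Cst[OF 1])
    show "eval_hom g v (Poly_Mapping.map h (Var i)) = eval_hom (\<lambda>c. g (h c)) v (Var i)" for i
      by (simp add: map_Var crh_0[OF assms(2)] crh_1[OF assms(2)] eval_hom_Var[OF assms(1)] eval_hom_Var[OF 1])
  qed
qed

section \<open>Homogeneous forms\<close>

lemma mdeg_0 [simp]: "mdeg 0 = 0"
  by (simp add: mdeg_def)

lemma mdeg_add: "mdeg (s + t) = mdeg s + mdeg t"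
  by (simp add: mdeg_def lookup_add sum.distrib)

lemma mdeg_single [simp]: "mdeg (Poly_Mapping.single i n) = n"
proof -
  have "\<forall>i. mdeg (Poly_Mapping.single i n) = n"
    unfolding all_3 mdeg_def sum_UNIV_3 by (simp add: lookup_single)
  then show ?thesis by blast
qed

lemma homogeneous_iff: "homogeneous d p \<longleftrightarrow> (\<forall>t. lk p t \<noteq> 0 \<longrightarrow> mdeg t = d)"
  by (auto simp: homogeneous_def in_keys_iff)

lemma homogeneous_0 [simp]: "homogeneous d 0"
  by (simp add: homogeneous_iff)

lemma homogeneous_Cst [simp]: "homogeneous 0 (Cst c)"
  by (auto simp: homogeneous_iff Cst_def lookup_single when_def)

lemma homogeneous_1 [simp]: "homogeneous 0 (1 :: 'a::comm_ring_1 poly3)"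
  using homogeneous_Cst[of "1::'a"] by simp

lemma homogeneous_Var [simp]: "homogeneous 1 (Var i)"
  by (auto simp: homogeneous_iff Var_def lookup_single when_def)

lemma homogeneous_Var_Suc [simp]: "homogeneous (Suc 0) (Var i)"
  using homogeneous_Var[of i] by simp

lemma homogeneous_single: "mdeg t = d \<Longrightarrow> homogeneous d (Poly_Mapping.single t c)"
  by (auto simp: homogeneous_iff lookup_single when_def)

lemma homogeneous_add: "homogeneous d p \<Longrightarrow> homogeneous d q \<Longrightarrow> homogeneous d (p + q :: 'a::comm_ring_1 poly3)"
  unfolding homogeneous_iff lookup_add by (metis add.left_neutral)

lemma homogeneous_uminus: "homogeneous d p \<Longrightarrow> homogeneous d (- p :: 'a::comm_ring_1 poly3)"
  unfolding homogeneous_iff by simp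

lemma homogeneous_minus: "homogeneous d p \<Longrightarrow> homogeneous d q \<Longrightarrow> homogeneous d (p - q :: 'a::comm_ring_1 poly3)"
  using homogeneous_add[of d p "- q"] homogeneous_uminus[of d q] by simp

lemma homogeneous_sum: "(\<And>a. a \<in> A \<Longrightarrow> homogeneous d (f a)) \<Longrightarrow> homogeneous d (sum f A :: 'a::comm_ring_1 poly3)"
  by (induction A rule: infinite_finite_induct) (auto simp: homogeneous_add)

lemma homogeneous_mult:
  assumes "homogeneous d p" "homogeneous e q"
  shows "homogeneous (d + e) (p * q :: 'a::comm_ring_1 poly3)"
  unfolding homogeneous_def
proof
  fix t assume "t \<in> Poly_Mapping.keys (p * q)"
  then obtain a b where "t = a + b" "a \<in> Poly_Mapping.keys p" "b \<in> Poly_Mapping.keys q"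
    using Poly_Mapping.keys_mult[of p q] by blast
  then show "mdeg t = d + e" using assms by (simp add: homogeneous_def mdeg_add)
qed

lemma homogeneous_Cst_mult: "homogeneous d p \<Longrightarrow> homogeneous d (Cst c * p :: 'a::comm_ring_1 poly3)"
  using homogeneous_mult[OF homogeneous_Cst, of d p c] by simp

lemma homogeneous_prod:
  "finite A \<Longrightarrow> (\<And>a. a \<in> A \<Longrightarrow> homogeneous (e a) (f a)) \<Longrightarrow> homogeneous (\<Sum>a\<in>A. e a) (prod f A :: 'a::comm_ring_1 poly3)"
  by (induction A rule: finite_induct) (auto intro: homogeneous_mult)

lemma homogeneous_power:
  "homogeneous d p \<Longrightarrow> homogeneous (n * d) (p ^ n :: 'a::comm_ring_1 poly3)"
  by (induction n) (auto intro: homogeneous_mult)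

lemma homogeneous_degree_unique: "homogeneous d p \<Longrightarrow> homogeneous e p \<Longrightarrow> p \<noteq> 0 \<Longrightarrow> d = e"
  unfolding homogeneous_iff by (metis poly_mapping_eqI lookup_zero)

lemma homogeneous_degree_0:
  assumes "homogeneous 0 p"
  shows "p = Cst (lk p 0)"
proof (rule poly_mapping_eqI)
  fix t
  have "t = 0" if "mdeg t = 0"
  proof (rule poly_mapping_eqI)
    fix k :: 3
    have "lk t k \<le> mdeg t" unfolding mdeg_def by (rule member_le_sum) auto
    then show "lk t k = lk 0 k" using that by simp
  qed
  then show "lk p t = lk (Cst (lk p 0)) t"
    using assms unfolding homogeneous_iff Cst_def lookup_single when_def by metis
qed

lemma eval_hom_homogeneous_scale:
  assumes "comm_ring_hom h" "homogeneous d p"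
  shows "eval_hom h (c *s v) p = c ^ d * eval_hom h v p"
  unfolding eval_hom_def sum_distrib_left
proof (rule sum.cong[OF refl])
  fix t assume "t \<in> Poly_Mapping.keys p"
  then have d: "d = sum (lk t) UNIV"
    using assms(2) by (simp add: homogeneous_def mdeg_def)
  have "(\<Prod>i\<in>UNIV. (c *s v) $ i ^ lk t i) = (\<Prod>i\<in>UNIV. c ^ lk t i) * (\<Prod>i\<in>UNIV. v $ i ^ lk t i)"
    by (simp add: power_mult_distrib prod.distrib)
  also have "(\<Prod>i\<in>UNIV. c ^ lk t i) = c ^ d"
    unfolding d by (simp add: power_sum)
  finally show "h (lk p t) * (\<Prod>i\<in>UNIV. (c *s v) $ i ^ lk t i) = c ^ d * (h (lk p t) * (\<Prod>i\<in>UNIV. v $ i ^ lk t i))"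
    by (simp only: mult_ac)
qed

text \<open>Multiplying every variable by a new variable turns the grading into the degree in the latter.\<close>

definition grade :: "'a::comm_ring_1 poly3 \<Rightarrow> 'a poly3 poly" where
  "grade = eval_hom (\<lambda>c. [:Cst c:]) (\<chi> i. [:0, Var i:])"

definition hcomp :: "nat \<Rightarrow> 'a::comm_ring_1 poly3 \<Rightarrow> 'a poly3" where
  "hcomp d p = coeff (grade p) d"

lemma comm_ring_hom_grade [simp]: "comm_ring_hom grade"
  unfolding grade_def by simp

lemma grade_single: "grade (Poly_Mapping.single t c) = monom (Poly_Mapping.single t c) (mdeg t)"
proof -
  have X: "[:0, q:] ^ n = monom (q ^ n) n" for q :: "'a poly3" and n
    using monom_power[of q 1 n] by (simp add: monom_altdef)
  have "grade (Poly_Mapping.single t c) = monom (Cst c) 0 * (\<Prod>i\<in>UNIV. [:0, Var i:] ^ lk t i)"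
    unfolding grade_def eval_hom_single[where h = "\<lambda>c. [:Cst c:]", OF crh_0[OF comm_ring_hom_const_poly_comp[OF comm_ring_hom_Cst]]]
    by (simp add: monom_0)
  also have "\<dots> = monom (Cst c * (\<Prod>i\<in>UNIV. Var i ^ lk t i)) (mdeg t)"
    unfolding prod_UNIV_3 X mult_monom mdeg_def sum_UNIV_3 by simp
  finally show ?thesis unfolding single_eq_Cst_Var .
qed

lemma grade_eq_sum: "grade p = (\<Sum>t\<in>Poly_Mapping.keys p. monom (Poly_Mapping.single t (lk p t)) (mdeg t))"
proof -
  have "grade p = grade (\<Sum>t\<in>Poly_Mapping.keys p. Poly_Mapping.single t (lk p t))"
    by (simp only: poly_mapping_sum_single[symmetric])
  then show ?thesis by (simp only: crh_sum[OF comm_ring_hom_grade] grade_single)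
qed

lemma lookup_hcomp: "lk (hcomp d p) t = (if mdeg t = d then lk p t else 0)"
proof -
  have "lk (hcomp d p) t = (\<Sum>s\<in>Poly_Mapping.keys p. if s = t then (if mdeg t = d then lk p t else 0) else 0)"
    unfolding hcomp_def grade_eq_sum coeff_sum lookup_sum
    by (intro sum.cong refl) (auto simp: lookup_single when_def)
  then show ?thesis by (simp add: in_keys_iff)
qed

lemma homogeneous_hcomp [simp]: "homogeneous d (hcomp d p)"
  by (simp add: homogeneous_iff lookup_hcomp)

lemma hcomp_homogeneous: "homogeneous e p \<Longrightarrow> hcomp d p = (if d = e then p else 0)"
  by (rule poly_mapping_eqI) (auto simp: homogeneous_iff lookup_hcomp)

lemma hcomp_add: "hcomp d (p + q) = hcomp d p + hcomp d q"
  by (simp add: hcomp_def crh_add[OF comm_ring_hom_grade])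

lemma hcomp_sum: "hcomp d (sum f A) = (\<Sum>a\<in>A. hcomp d (f a))"
  by (simp add: hcomp_def crh_sum[OF comm_ring_hom_grade] coeff_sum)

lemma hcomp_0 [simp]: "hcomp d 0 = 0"
  by (rule poly_mapping_eqI) (simp add: lookup_hcomp)

lemma grade_homogeneous: "homogeneous d p \<Longrightarrow> grade p = monom p d"
  by (rule poly_eqI) (simp add: hcomp_def[symmetric] hcomp_homogeneous)

lemma homogeneous_grade:
  assumes "grade p = monom q d"
  shows "homogeneous d p"
  unfolding homogeneous_iff
proof (intro allI impI)
  fix t assume t: "lk p t \<noteq> 0"
  have "lk p t = lk (coeff (grade p) (mdeg t)) t" using lookup_hcomp[of "mdeg t" p t] by (simp add: hcomp_def)
  with t show "mdeg t = d" unfolding assms by (auto split: if_splits)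
qed

lemma hcomp_mult_homogeneous:
  assumes "homogeneous e p"
  shows "hcomp d (p * q) = (if d < e then 0 else p * hcomp (d - e) q)"
  by (simp add: hcomp_def crh_mult[OF comm_ring_hom_grade] grade_homogeneous[OF assms] coeff_monom_mult)

text \<open>Lowest and highest exponents are both additive over a domain. In the product they
  coincide, hence they coincide in each factor.\<close>

lemma monom_mult_eq_monom:
  fixes p q :: "'a::idom poly"
  assumes "p * q = monom c n" "c \<noteq> 0"
  shows "\<exists>a i. p = monom a i"
proof -
  have nz: "p \<noteq> 0" "q \<noteq> 0" using assms by auto
  have split: "\<exists>k r'. r = monom 1 k * r' \<and> coeff r' 0 \<noteq> 0" if r: "r \<noteq> 0" for r :: "'a poly"
  proof -
    define k where "k = (LEAST i. coeff r i \<noteq> 0)"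
    have ex: "\<exists>i. coeff r i \<noteq> 0" using r by (meson leading_coeff_0_iff)
    have k: "coeff r k \<noteq> 0" unfolding k_def by (rule LeastI_ex[OF ex])
    have "monom 1 k dvd r"
      unfolding monom_1_dvd_iff' k_def using not_less_Least by blast
    then obtain r' where r': "r = monom 1 k * r'" by (auto simp: dvd_def)
    with k have "coeff r' 0 \<noteq> 0" by (simp add: coeff_monom_mult)
    with r' show ?thesis by blast
  qed
  obtain k p' where p: "p = monom 1 k * p'" "coeff p' 0 \<noteq> 0" using split nz by blast
  obtain l q' where q: "q = monom 1 l * q'" "coeff q' 0 \<noteq> 0" using split nz by blast
  have "monom 1 k * monom 1 l = (monom 1 (k + l) :: 'a poly)" by (simp add: mult_monom)
  then have pq: "p * q = monom 1 (k + l) * (p' * q')"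
    unfolding p(1) q(1) by (metis mult.assoc mult.left_commute)
  have "coeff (p * q) (k + l) = coeff (p' * q') 0"
    unfolding pq by (subst coeff_monom_mult) simp
  then have "coeff (p * q) (k + l) \<noteq> 0"
    using p(2) q(2) by (simp add: coeff_mult_0)
  then have n: "n = k + l" using assms(1) by (auto split: if_splits)
  have "degree (p * q) = n" using assms by (simp add: degree_monom_eq)
  moreover have "p' \<noteq> 0" "q' \<noteq> 0" using p q nz by auto
  then have "degree (p * q) = k + l + (degree p' + degree q')"
    by (simp add: pq degree_mult_eq degree_monom_eq)
  ultimately have "degree p' = 0" using n by simp
  then obtain a where "p' = [:a:]" by (metis degree_eq_zeroE)
  then have "p = monom a k" using p(1) mult_monom[of 1 k a 0] by (simp add: monom_0)
  then show ?thesis by blast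
qed

text \<open>\<open>grade\<close> turns a homogeneous product into a monomial, and the factors of a
  monomial over a domain are monomials.\<close>

lemma homogeneous_factor:
  fixes p q :: "'a::idom poly3"
  assumes "homogeneous d (p * q)" "p * q \<noteq> 0"
  shows "\<exists>e. homogeneous e p"
proof -
  have "grade p * grade q = monom (p * q) d"
    using assms by (simp add: crh_mult[OF comm_ring_hom_grade, symmetric] grade_homogeneous)
  from monom_mult_eq_monom[OF this assms(2)] obtain a i where "grade p = monom a i" by blast
  then show ?thesis using homogeneous_grade by blast
qed

lemma homogeneous_factors:
  fixes p q :: "'a::idom poly3"
  assumes "homogeneous d (p * q)" "p * q \<noteq> 0"
  obtains e f where "homogeneous e p" "homogeneous f q" "e + f = d"
proof -
  have qp: "homogeneous d (q * p)" "q * p \<noteq> 0" using assms by (simp_all add: mult.commute)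
  obtain e f where *: "homogeneous e p" "homogeneous f q"
    using homogeneous_factor[OF assms] homogeneous_factor[OF qp] by blast
  then have "homogeneous (e + f) (p * q)" by (rule homogeneous_mult)
  then have "e + f = d" using assms homogeneous_degree_unique by blast
  with * show ?thesis by (rule that)
qed

lemma homogeneous_unit:
  fixes p :: "'a::comm_ring_1 poly3"
  assumes "homogeneous d p" "p dvd 1"
  shows "d = 0"
proof (rule ccontr)
  assume "d \<noteq> 0"
  obtain q where q: "1 = p * q" using assms(2) by (auto simp: dvd_def)
  \<comment> \<open>A form of positive degree vanishes at the origin and a unit does not. The origin
    is written as a multiple of itself so that the scaling law yields the factor
    \<open>0 ^ d\<close>.\<close>
  note id = comm_ring_hom_eval_hom[OF comm_ring_hom_id, of "0 *s (0 :: 'a^3)"]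
  have "eval3 (0 *s 0) p = 0"
    using eval_hom_homogeneous_scale[OF comm_ring_hom_id assms(1), of 0 0] \<open>d \<noteq> 0\<close> by (simp add: power_0_left)
  then have "eval3 (0 *s 0) (p * q) = 0" by (simp only: crh_mult[OF id] mult_zero_left)
  then show False by (simp only: q[symmetric] crh_1[OF id] zero_neq_one[symmetric])
qed

lemma is_unit_Cst:
  fixes c :: "'a::field"
  assumes "c \<noteq> 0"
  shows "Cst c dvd 1"
proof
  show "1 = Cst c * Cst (inverse c)"
    using assms by (simp add: crh_mult[OF comm_ring_hom_Cst, symmetric])
qed

lemma homogeneous_0_unit:
  fixes p :: "'a::field poly3"
  assumes "homogeneous 0 p" "p \<noteq> 0"
  shows "p dvd 1"
proof -
  have p: "p = Cst (lk p 0)" by (rule homogeneous_degree_0[OF assms(1)])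
  then have "lk p 0 \<noteq> 0" using assms(2) by auto
  from is_unit_Cst[OF this] show ?thesis by (simp only: p[symmetric])
qed

section \<open>Unique factorization, and testing polynomials at points\<close>

lemma poly_hom_eqI:
  assumes "comm_ring_hom f" "comm_ring_hom g" "\<And>c. f [:c:] = g [:c:]" "f [:0, 1:] = g [:0, 1:]"
  shows "f p = g p"
proof (induction p)
  case 0
  show ?case by (simp add: crh_0[OF assms(1)] crh_0[OF assms(2)])
next
  case (pCons a p)
  have "pCons a p = [:a:] + [:0, 1:] * p" by simp
  then show ?case
    by (simp only: crh_add[OF assms(1)] crh_add[OF assms(2)] crh_mult[OF assms(1)] crh_mult[OF assms(2)] assms(3,4) pCons.IH)
qed

lemma comm_ring_hom_poly_map_poly:
  assumes "comm_ring_hom h"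
  shows "comm_ring_hom (\<lambda>q. poly (map_poly h q) x)"
proof -
  interpret map_poly_comm_ring_hom h by (rule map_poly_comm_ring_hom.intro[OF assms])
  show ?thesis by (rule comm_ring_homI) (simp_all add: hom_distribs)
qed

lemma comm_ring_hom_poly: "comm_ring_hom (\<lambda>q. poly q x)"
  by (rule comm_ring_homI) simp_all

text \<open>Transfers unique factorization from iterated univariate polynomials.\<close>

definition nest :: "'a::comm_ring_1 poly3 \<Rightarrow> 'a poly poly poly" where
  "nest = eval_hom (\<lambda>c. [:[:[:c:]:]:]) (\<chi> i. if i = 0 then [:[:[:0, 1:]:]:] else if i = 1 then [:[:0, 1:]:] else [:0, 1:])"

definition unnest :: "'a::comm_ring_1 poly poly poly \<Rightarrow> 'a poly3" where
  "unnest q = poly (map_poly (\<lambda>q. poly (map_poly (\<lambda>q. poly (map_poly Cst q) (Var 0)) q) (Var 1)) q) (Var 2)"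

lemma comm_ring_hom_nest [simp]: "comm_ring_hom nest"
  unfolding nest_def by simp

lemma comm_ring_hom_unnest [simp]: "comm_ring_hom unnest"
  unfolding unnest_def[abs_def] by (intro comm_ring_hom_poly_map_poly comm_ring_hom_Cst)

lemma nest_Cst: "nest (Cst c) = [:[:[:c:]:]:]"
  unfolding nest_def by (simp add: eval_hom_Cst)

lemma nest_Var: "nest (Var 0) = [:[:[:0, 1:]:]:]" "nest (Var 1) = [:[:0, 1:]:]" "nest (Var 2) = [:0, 1:]"
  unfolding nest_def by (simp_all add: eval_hom_Var)

lemma poly_map_poly_const: "h 0 = 0 \<Longrightarrow> poly (map_poly h [:c:]) x = h c"
  by (cases "c = 0") (simp_all add: map_poly_pCons)

lemma unnest_simps:
  "unnest [:[:[:c:]:]:] = Cst c" "unnest [:[:[:0, 1:]:]:] = Var 0" "unnest [:[:0, 1:]:] = Var 1" "unnest [:0, 1:] = Var 2"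
  unfolding unnest_def by (simp_all add: map_poly_pCons poly_map_poly_const)

lemma unnest_nest: "unnest (nest p) = p"
proof (rule poly3_hom_eqI[of "\<lambda>p. unnest (nest p)" "\<lambda>p. p"])
  show "comm_ring_hom (\<lambda>p. unnest (nest p))" by (rule comm_ring_hom_comp) simp_all
  show "unnest (nest (Var i)) = Var i" for i
  proof -
    have "\<forall>i. unnest (nest (Var i)) = Var i" unfolding all_3 nest_Var unnest_simps by simp
    then show ?thesis by blast
  qed
qed (simp_all add: nest_Cst unnest_simps)

lemma nest_unnest: "nest (unnest q) = q"
proof (rule poly_hom_eqI[of "\<lambda>q. nest (unnest q)" "\<lambda>q. q"])
  have h: "comm_ring_hom (\<lambda>q. nest (unnest q))" by (rule comm_ring_hom_comp) simp_all
  then show "comm_ring_hom (\<lambda>q. nest (unnest q))" .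
  show "nest (unnest [:q:]) = [:q:]" for q
  proof (rule poly_hom_eqI[of "\<lambda>q. nest (unnest [:q:])" "\<lambda>q. [:q:]"])
    show h2: "comm_ring_hom (\<lambda>q. nest (unnest [:q:]))" by (rule comm_ring_hom_comp[OF h]) simp
    show "nest (unnest [:[:q:]:]) = [:[:q:]:]" for q
    proof (rule poly_hom_eqI[of "\<lambda>q. nest (unnest [:[:q:]:])" "\<lambda>q. [:[:q:]:]"])
      show "comm_ring_hom (\<lambda>q. nest (unnest [:[:q:]:]))" by (rule comm_ring_hom_comp[OF h2]) simp
    qed (simp_all only: nest_Cst nest_Var unnest_simps comm_ring_hom_const_poly_comp comm_ring_hom_const_poly)
  qed (simp_all only: nest_Var unnest_simps comm_ring_hom_const_poly)
qed (simp_all only: nest_Var unnest_simps comm_ring_hom_id)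

text \<open>Iterated polynomials over a field form a factorial ring, where irreducible elements are
  prime. \<open>nest\<close> and \<open>unnest\<close> are inverse isomorphisms, so divisibility and
  units can be moved in both directions.\<close>

lemma irreducible_imp_prime_poly3:
  fixes p :: "'a::field poly3"
  assumes "irreducible p"
  shows "prime_elem p"
proof -
  note n = crh_simps[OF comm_ring_hom_nest] and u = crh_simps[OF comm_ring_hom_unnest]
  have "irreducible (nest p)"
  proof (rule irreducibleI)
    show "nest p \<noteq> 0" using assms unnest_nest[of p] u(1) by (metis not_irreducible_zero)
    show "\<not> nest p dvd 1"
    proof
      assume "nest p dvd 1"
      then obtain q where "1 = nest p * q" by (auto simp: dvd_def)
      then have "1 = p * unnest q" using u(2,4) unnest_nest by metis
      then show False using assms irreducible_not_unit by (metis dvdI)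
    qed
    fix a b assume "nest p = a * b"
    then have "p = unnest a * unnest b" using u(4) unnest_nest by metis
    then have "unnest a dvd 1 \<or> unnest b dvd 1" using assms by (metis irreducibleD)
    moreover have "a dvd 1" if dv: "unnest a dvd 1" for a
    proof -
      obtain c where "1 = unnest a * c" using dv by (elim dvdE)
      then have "1 = a * nest c" using n(2,4) nest_unnest by metis
      then show ?thesis by (rule dvdI)
    qed
    ultimately show "a dvd 1 \<or> b dvd 1" by blast
  qed
  then have pr: "prime_elem (nest p)" by simp
  show ?thesis
  proof (rule prime_elemI)
    show "p \<noteq> 0" "\<not> p dvd 1" using assms by (auto simp: irreducible_def)
    fix a b assume "p dvd a * b"
    then obtain c where "a * b = p * c" by (auto simp: dvd_def)
    then have "nest a * nest b = nest p * nest c" by (metis n(4))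
    then have "nest p dvd nest a \<or> nest p dvd nest b" using pr by (metis dvdI prime_elem_dvd_multD)
    moreover have "p dvd a" if dv: "nest p dvd nest a" for a
    proof -
      obtain c where "nest a = nest p * c" using dv by (elim dvdE)
      then have "a = p * unnest c" using u(4) unnest_nest by metis
      then show ?thesis by (rule dvdI)
    qed
    ultimately show "p dvd a \<or> p dvd b" by blast
  qed
qed

text \<open>A nonzero univariate polynomial over a domain has finitely many roots, while the
  constants form an infinite set in characteristic zero. The argument is repeated layer by
  layer.\<close>

lemma nested_poly_zeroI:
  fixes q :: "'a::{idom,ring_char_0} poly poly poly"
  assumes "\<And>a b c. poly (poly (poly q [:[:c:]:]) [:b:]) a = 0"
  shows "q = 0"
proof -
  have inf: "infinite (UNIV :: 'a set)" by (rule infinite_UNIV_char_0)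
  have 1: "r = 0" if r: "\<And>a b. poly (poly r [:b:]) a = 0" for r :: "'a poly poly"
  proof (rule ccontr)
    assume "r \<noteq> 0"
    then have fin: "finite {x. poly r x = 0}" by (rule poly_roots_finite)
    have "poly r [:b:] = 0" for b using r poly_all_0_iff_0 by blast
    then have "range (\<lambda>b. [:b:]) \<subseteq> {x. poly r x = 0}" by auto
    moreover have "infinite (range (\<lambda>b::'a. [:b:]))" by (use inf in \<open>auto dest!: finite_imageD simp: inj_def\<close>)
    ultimately show False using fin finite_subset by blast
  qed
  show ?thesis
  proof (rule ccontr)
    assume "q \<noteq> 0"
    then have fin: "finite {x. poly q x = 0}" by (rule poly_roots_finite)
    have "poly q [:[:c:]:] = 0" for c by (rule 1) (rule assms)
    then have "range (\<lambda>c. [:[:c:]:]) \<subseteq> {x. poly q x = 0}" by auto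
    moreover have "infinite (range (\<lambda>c::'a. [:[:c:]:]))" by (use inf in \<open>auto dest!: finite_imageD simp: inj_def\<close>)
    ultimately show False using fin finite_subset by blast
  qed
qed

lemma poly3_zeroI:
  fixes p :: "'a::{idom,ring_char_0} poly3"
  assumes "\<And>v. eval3 v p = 0"
  shows "p = 0"
proof -
  have "poly (poly (poly (nest p) [:[:c:]:]) [:b:]) a = 0" for a b c
  proof -
    let ?v = "\<chi> i. if i = 0 then a else if i = 1 then b else c"
    have "poly (poly (poly (nest p) [:[:c:]:]) [:b:]) a = eval3 ?v p"
    proof (rule poly3_hom_eqI[of "\<lambda>p. poly (poly (poly (nest p) [:[:c:]:]) [:b:]) a"])
      show "comm_ring_hom (\<lambda>p. poly (poly (poly (nest p) [:[:c:]:]) [:b:]) a)"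
        by (intro comm_ring_hom_comp[OF comm_ring_hom_poly] comm_ring_hom_nest)
      show "poly (poly (poly (nest (Var i)) [:[:c:]:]) [:b:]) a = eval3 ?v (Var i)" for i
      proof -
        have "\<forall>i. poly (poly (poly (nest (Var i)) [:[:c:]:]) [:b:]) a = eval3 ?v (Var i)"
          unfolding all_3 nest_Var by (simp add: eval_hom_Var)
        then show ?thesis by blast
      qed
    qed (simp_all add: nest_Cst eval_hom_Cst)
    then show ?thesis using assms by simp
  qed
  then have "nest p = 0" by (rule nested_poly_zeroI)
  then show ?thesis using unnest_nest[of p] crh_0[OF comm_ring_hom_unnest] by metis
qed

lemma poly3_eqI:
  fixes p q :: "'a::{idom,ring_char_0} poly3"
  assumes "\<And>v. eval3 v p = eval3 v q"
  shows "p = q"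
proof -
  have "p - q = 0" by (rule poly3_zeroI) (simp add: assms eval_simps)
  then show ?thesis by simp
qed

text \<open>Descent on the degree: in a product of two non-units both factors are forms of positive
  degree, because nonzero forms of degree 0 over a field are units.\<close>

lemma ex_prime_factor_homogeneous:
  fixes p :: "'a::field poly3"
  assumes "homogeneous d p" "p \<noteq> 0" "\<not> p dvd 1"
  shows "\<exists>q. prime_elem q \<and> q dvd p"
  using assms
proof (induction d arbitrary: p rule: less_induct)
  case (less d)
  show ?case
  proof (cases "irreducible p")
    case True
    then show ?thesis by (intro exI[of _ p] conjI irreducible_imp_prime_poly3 dvd_refl)
  next
    case False
    with less.prems(2,3) have "\<exists>a b. p = a * b \<and> \<not> a dvd 1 \<and> \<not> b dvd 1"
      unfolding irreducible_def by metis
    then obtain a b where ab: "p = a * b" "\<not> a dvd 1" "\<not> b dvd 1" by (elim exE conjE)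
    obtain e f where ef: "homogeneous e a" "homogeneous f b" "e + f = d"
      using less.prems(1,2) unfolding ab(1) by (rule homogeneous_factors)
    have nz: "a \<noteq> 0" "b \<noteq> 0" using less.prems(2) unfolding ab(1) by simp_all
    have "f \<noteq> 0"
    proof
      assume "f = 0"
      then have "homogeneous 0 b" using ef(2) by (simp only:)
      from homogeneous_0_unit[OF this nz(2)] ab(3) show False by (rule notE[rotated])
    qed
    then have "e < d" using ef(3) by linarith
    from less.IH[OF this ef(1) nz(1) ab(2)] obtain q where "prime_elem q" "q dvd a" by (elim exE conjE)
    then have "prime_elem q \<and> q dvd a * b" by (intro conjI dvd_mult2)
    then show ?thesis unfolding ab(1) by (rule exI)
  qed
qed

declare prime_elem_iff_irreducible [iff del]

section \<open>Derivatives and Taylor expansion along lines\<close>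

lemma lookup_Cst_mult: "lk (Cst c * p) t = c * lk (p :: 'a::comm_ring_1 poly3) t"
  unfolding Cst_def mult_map_scale_conv_mult[symmetric] by (simp add: lookup_map)

lemma lookup_Var_mult: "lk (Var i * p) (t + Poly_Mapping.single i 1) = lk (p :: 'a::comm_ring_1 poly3) t"
proof -
  have "Var i * p = (\<Sum>s\<in>Poly_Mapping.keys p. Poly_Mapping.single (s + Poly_Mapping.single i 1) (lk p s))"
    by (subst (1) poly_mapping_sum_single[of p], subst sum_distrib_left)
      (simp add: Var_def mult_single add.commute)
  then show ?thesis by (simp add: lookup_sum lookup_single when_def in_keys_iff)
qed

lemma lookup_Var_mult_eq_0:
  assumes "lk t i = 0"
  shows "lk (Var i * p) t = (0 :: 'a::comm_ring_1)"
proof -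
  have "Var i * p = (\<Sum>s\<in>Poly_Mapping.keys p. Poly_Mapping.single (s + Poly_Mapping.single i 1) (lk p s))"
    by (subst (1) poly_mapping_sum_single[of p], subst sum_distrib_left)
      (simp add: Var_def mult_single add.commute)
  moreover have "s + Poly_Mapping.single i 1 \<noteq> t" for s
  proof
    assume *: "s + Poly_Mapping.single i 1 = t"
    have "lk (s + Poly_Mapping.single i 1) i = lk s i + 1" by (simp add: lookup_add)
    with assms show False unfolding * by simp
  qed
  ultimately show ?thesis by (simp add: lookup_sum lookup_single when_def)
qed

lemma single_1_minus_add:
  assumes "lk t i \<noteq> (0::nat)"
  shows "t - Poly_Mapping.single i 1 + Poly_Mapping.single i 1 = t"
  by (rule poly_mapping_eqI) (use assms in \<open>auto simp: lookup_add lookup_minus lookup_single when_def\<close>)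

lemma lookup_pd: "lk (pd i p) s = of_nat (Suc (lk s i)) * lk p (s + Poly_Mapping.single i 1)"
proof -
  have *: "(of_nat (lk t i) * lk p t when t - Poly_Mapping.single i 1 = s) =
      (if t = s + Poly_Mapping.single i 1 then of_nat (Suc (lk s i)) * lk p (s + Poly_Mapping.single i 1) else 0)" for t
  proof (cases "lk t i = 0")
    case True
    then have "t \<noteq> s + Poly_Mapping.single i 1" by (auto simp: lookup_add)
    then show ?thesis using True by simp
  next
    case False
    have e: "t - Poly_Mapping.single i 1 = s \<longleftrightarrow> t = s + Poly_Mapping.single i 1"
    proof
      assume "t - Poly_Mapping.single i 1 = s"
      then show "t = s + Poly_Mapping.single i 1" by (rule subst) (rule single_1_minus_add[OF False, symmetric])
    next
      assume "t = s + Poly_Mapping.single i 1"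
      then show "t - Poly_Mapping.single i 1 = s" by (simp only: add_diff_cancel_right')
    qed
    show ?thesis unfolding e when_def by (rule if_cong[OF refl]) (simp_all add: lookup_add)
  qed
  show ?thesis
    unfolding pd_def lookup_sum lookup_single * by (simp add: in_keys_iff)
qed

lemma pd_add: "pd i (p + q) = pd i p + pd i q"
  by (rule poly_mapping_eqI) (simp only: lookup_pd lookup_add distrib_left)

lemma pd_0 [simp]: "pd i 0 = 0"
  by (rule poly_mapping_eqI) (simp add: lookup_pd)

lemma pd_sum: "pd i (sum f A) = (\<Sum>a\<in>A. pd i (f a))"
  by (induction A rule: infinite_finite_induct) (simp_all add: pd_add)

lemma pd_Cst_mult: "pd i (Cst c * p) = Cst c * pd i (p :: 'a::comm_ring_1 poly3)"
  by (rule poly_mapping_eqI) (simp only: lookup_pd lookup_Cst_mult mult.left_commute)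

lemma pd_map:
  assumes "comm_ring_hom h"
  shows "pd i (Poly_Mapping.map h p) = Poly_Mapping.map h (pd i p)"
  by (rule poly_mapping_eqI)
    (simp add: lookup_pd lookup_map crh_0[OF assms] crh_mult[OF assms] crh_of_nat[OF assms] crh_add[OF assms] crh_1[OF assms])

lemma homogeneous_pd: "homogeneous (Suc d) p \<Longrightarrow> homogeneous d (pd i p)"
  unfolding homogeneous_iff lookup_pd
proof (intro allI impI)
  fix t
  assume h: "\<forall>t. lk p t \<noteq> 0 \<longrightarrow> mdeg t = Suc d"
    and t: "of_nat (Suc (lk t i)) * lk p (t + Poly_Mapping.single i 1) \<noteq> 0"
  from t have "lk p (t + Poly_Mapping.single i 1) \<noteq> 0" by (metis mult_zero_right)
  with h have "mdeg (t + Poly_Mapping.single i 1) = Suc d" by blast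
  then show "mdeg t = d" by (simp add: mdeg_add)
qed

lemma pd_single: "pd i (Poly_Mapping.single n c) = Poly_Mapping.single (n - Poly_Mapping.single i 1) (of_nat (lk n i) * c)"
proof (cases "c = 0")
  case False
  then have "Poly_Mapping.keys (Poly_Mapping.single n c) = {n}" by simp
  then show ?thesis unfolding pd_def by simp
qed simp

text \<open>The falling factorial is split as \<open>fact k * (lk n i choose k)\<close>: the
  factorial will cancel against \<open>mono_const\<close> and the binomial is a Taylor coefficient.
  The binomial also vanishes exactly when the subtraction of exponents would be truncated.\<close>

lemma pd_funpow_single:
  "(pd i ^^ k) (Poly_Mapping.single n c) =
    Poly_Mapping.single (n - Poly_Mapping.single i k) (of_nat (fact k * (lk n i choose k)) * c)"
proof (induction k)
  case 0
  have "n - Poly_Mapping.single i 0 = n" by (rule poly_mapping_eqI) (simp add: lookup_minus)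
  then show ?case by simp
next
  case (Suc k)
  have e: "n - Poly_Mapping.single i k - Poly_Mapping.single i 1 = n - Poly_Mapping.single i (Suc k)"
    by (rule poly_mapping_eqI) (simp add: lookup_minus lookup_single when_def)
  have b: "(m - k) * (m choose k) = Suc k * (m choose Suc k)" for m
    unfolding binomial_absorb_comp binomial_absorption ..
  have "(lk n i - k) * (fact k * (lk n i choose k)) = fact k * ((lk n i - k) * (lk n i choose k))"
    by (simp only: mult.left_commute)
  also have "\<dots> = fact (Suc k) * (lk n i choose Suc k)"
    unfolding b fact_Suc of_nat_id by (simp only: mult_ac)
  finally have f: "of_nat (lk n i - k) * (of_nat (fact k * (lk n i choose k)) * c) =
      of_nat (fact (Suc k) * (lk n i choose Suc k)) * c"
    unfolding mult.assoc[symmetric] of_nat_mult[symmetric] by (simp only: mult.assoc)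
  have l: "lk (n - Poly_Mapping.single i k) i = lk n i - k"
    by (simp add: lookup_minus)
  show ?case unfolding funpow.simps o_apply Suc.IH pd_single e l f ..
qed

lemma mono_act_single:
  "mono_act t (Poly_Mapping.single n c) =
    Poly_Mapping.single (n - t) (of_nat (\<Prod>i\<in>UNIV. fact (lk t i) * (lk n i choose lk t i)) * c)"
proof -
  have l: "lk (n - Poly_Mapping.single 2 (lk t 2)) 1 = lk n 1"
    "lk (n - Poly_Mapping.single 2 (lk t 2) - Poly_Mapping.single 1 (lk t 1)) 0 = lk n 0"
    by (simp_all add: lookup_minus lookup_single)
  have "n - Poly_Mapping.single 2 (lk t 2) - Poly_Mapping.single 1 (lk t 1) - Poly_Mapping.single 0 (lk t 0) =
      n - (Poly_Mapping.single 0 (lk t 0) + Poly_Mapping.single 1 (lk t 1) + Poly_Mapping.single 2 (lk t 2))"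
    by (rule poly_mapping_eqI) (simp add: lookup_minus lookup_add)
  then have e: "n - Poly_Mapping.single 2 (lk t 2) - Poly_Mapping.single 1 (lk t 1) - Poly_Mapping.single 0 (lk t 0) = n - t"
    by (simp only: poly_mapping_3_eq_single[of t, symmetric])
  show ?thesis
    unfolding mono_act_def pd_funpow_single l e prod_UNIV_3 of_nat_mult by (simp only: mult_ac)
qed

lemma mono_const_eq: "mono_const t = of_nat (\<Prod>i\<in>UNIV. fact (lk t i))"
proof -
  have "t - t = 0" by (rule poly_mapping_eqI) (simp add: lookup_minus)
  then show ?thesis unfolding mono_const_def mono_act_single by simp
qed

lemma pd_funpow_add: "(pd i ^^ k) (p + q) = (pd i ^^ k) p + (pd i ^^ k) q"
  by (induction k) (simp_all add: pd_add)

lemma mono_act_add: "mono_act t (p + q) = mono_act t p + mono_act t q"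
  by (simp add: mono_act_def pd_funpow_add)

lemma pd_funpow_map:
  "comm_ring_hom h \<Longrightarrow> (pd i ^^ k) (Poly_Mapping.map h p) = Poly_Mapping.map h ((pd i ^^ k) p)"
  by (induction k) (simp_all add: pd_map)

lemma mono_act_map:
  "comm_ring_hom h \<Longrightarrow> mono_act t (Poly_Mapping.map h p) = Poly_Mapping.map h (mono_act t p)"
  by (simp add: mono_act_def pd_funpow_map)

definition mk3 :: "nat \<Rightarrow> nat \<Rightarrow> nat \<Rightarrow> 3 \<Rightarrow>\<^sub>0 nat" where
  "mk3 a b c = Poly_Mapping.single 0 a + Poly_Mapping.single 1 b + Poly_Mapping.single 2 c"

lemma lookup_mk3 [simp]: "lk (mk3 a b c) 0 = a" "lk (mk3 a b c) 1 = b" "lk (mk3 a b c) 2 = c"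
  by (simp_all add: mk3_def lookup_add lookup_single)

lemma mk3_lookup: "mk3 (lk t 0) (lk t 1) (lk t 2) = t"
  unfolding mk3_def by (rule poly_mapping_3_eq_single[symmetric])

lemma mdeg_mk3: "mdeg (mk3 a b c) = a + b + c"
  by (simp add: mdeg_def sum_UNIV_3)

text \<open>Exponents are indexed by the partial sums t_0 + t_1 and t_0, which is the indexing that
  the Cauchy formula gives for a product of three univariate polynomials.\<close>

lemma mdeg_eq_image: "{t. mdeg t = k} = (\<lambda>(i, j). mk3 j (i - j) (k - i)) ` (SIGMA i:{..k}. {..i})"
proof (intro equalityI subsetI)
  fix t assume "t \<in> {t. mdeg t = k}"
  then have "k = lk t 0 + lk t 1 + lk t 2" by (simp add: mdeg_def sum_UNIV_3)
  then show "t \<in> (\<lambda>(i, j). mk3 j (i - j) (k - i)) ` (SIGMA i:{..k}. {..i})"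
    by (intro image_eqI[of _ _ "(lk t 0 + lk t 1, lk t 0)"]) (simp_all add: mk3_lookup)
qed (auto simp: mdeg_mk3)

lemma finite_mdeg [simp]: "finite {t. mdeg t = k}"
  unfolding mdeg_eq_image by simp

lemma sum_mdeg: "(\<Sum>t | mdeg t = k. f t) = (\<Sum>i\<le>k. \<Sum>j\<le>i. f (mk3 j (i - j) (k - i)))"
proof -
  have "inj_on (\<lambda>(i, j). mk3 j (i - j) (k - i)) (SIGMA i:{..k}. {..i})"
    by (rule inj_on_inverseI[of _ "\<lambda>t. (lk t 0 + lk t 1, lk t 0)"]) auto
  then show ?thesis
    unfolding mdeg_eq_image by (subst sum.reindex) (simp_all add: sum.Sigma case_prod_unfold o_def)
qed

lemma card_mdeg: "card {t. mdeg t = k} = (k + 2) choose 2"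
proof -
  have "card {t. mdeg t = k} = (\<Sum>i\<le>k. Suc i)"
    using sum_mdeg[of "\<lambda>_. 1::nat" k] by simp
  also have "\<dots> = (k + 2) choose 2"
    by (induction k) (simp_all add: numeral_2_eq_2)
  finally show ?thesis .
qed

text \<open>The restriction to the line v + s w as a polynomial in s. Multiplicity at
  \<open>v\<close> becomes divisibility by a power of s, and derivatives at \<open>v\<close> become
  coefficients.\<close>

definition line_poly :: "('a::comm_ring_1 \<Rightarrow> 'b::comm_ring_1) \<Rightarrow> 'b ^ 3 \<Rightarrow> 'b ^ 3 \<Rightarrow> 'a poly3 \<Rightarrow> 'b poly" where
  "line_poly h v w = eval_hom (\<lambda>c. [:h c:]) (\<chi> i. [:v $ i, w $ i:])"

lemma comm_ring_hom_line_poly [simp]: "comm_ring_hom h \<Longrightarrow> comm_ring_hom (line_poly h v w)"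
  unfolding line_poly_def by simp

lemma poly_line_poly:
  assumes "comm_ring_hom h"
  shows "poly (line_poly h v w p) s = eval_hom h (v + s *s w) p"
proof (rule poly3_hom_eqI[of "\<lambda>p. poly (line_poly h v w p) s"])
  show "comm_ring_hom (\<lambda>p. poly (line_poly h v w p) s)"
    by (rule comm_ring_hom_comp[OF comm_ring_hom_poly]) (use assms in simp)
qed (use assms in \<open>simp_all add: line_poly_def eval_hom_Cst eval_hom_Var\<close>)

lemma coeff_lin_power:
  fixes a b :: "'a::comm_ring_1"
  shows "coeff ([:a, b:] ^ n) j = of_nat (n choose j) * b ^ j * a ^ (n - j)"
proof (cases "j \<le> n")
  case True
  then show ?thesis by (rule coeff_linear_poly_power)
next
  case False
  have "degree ([:a, b:] ^ n) \<le> n"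
    using degree_power_le[of "[:a, b:]" n] by (simp split: if_splits)
  with False show ?thesis by (simp add: coeff_eq_0 binomial_eq_0)
qed

lemma line_poly_single:
  assumes "comm_ring_hom h"
  shows "line_poly h v w (Poly_Mapping.single n c) =
    [:h c:] * ([:v $ 0, w $ 0:] ^ lk n 0 * [:v $ 1, w $ 1:] ^ lk n 1 * [:v $ 2, w $ 2:] ^ lk n 2)"
  unfolding line_poly_def
    eval_hom_single[where h = "\<lambda>c. [:h c:]", OF crh_0[OF comm_ring_hom_const_poly_comp[OF assms]]] prod_UNIV_3
  by simp

lemma poly3_additive_induct:
  fixes p :: "'a::comm_ring_1 poly3"
  assumes "\<And>t c. Q (Poly_Mapping.single t c)" "\<And>p q. Q p \<Longrightarrow> Q q \<Longrightarrow> Q (p + q)"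
  shows "Q p"
proof -
  have 0: "Q 0" using assms(1)[of 0 0] by simp
  have "Q (\<Sum>t\<in>A. Poly_Mapping.single t (lk p t))" for A
    by (induction A rule: infinite_finite_induct) (simp_all add: 0 assms)
  from this[of "Poly_Mapping.keys p"] show ?thesis
    by (simp only: poly_mapping_sum_single[symmetric])
qed

text \<open>Both sides are additive in \<open>H\<close>. For a monomial the right side is a product
  of three binomial expansions, and the factorials from \<open>mono_act\<close> cancel against
  \<open>mono_const\<close>. So the tangent cone form is the Taylor term of order
  \<open>m\<close>.\<close>

lemma taylor_line_poly:
  fixes \<iota> :: "'k::field_char_0 \<Rightarrow> 'a::comm_ring_1"
  assumes "comm_ring_hom \<iota>"
  shows "eval3 w (tangent_cone_form \<iota> m H v) = coeff (line_poly (\<lambda>c. c) v w H) m"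
proof -
  have ev: "eval3 w (tangent_cone_form \<iota> m H v) =
      (\<Sum>t | mdeg t = m. \<iota> (inverse (mono_const t)) * eval3 v (mono_act t H) * (\<Prod>i\<in>UNIV. w $ i ^ lk t i))" for H
    unfolding tangent_cone_form_def crh_sum[OF comm_ring_hom_eval_hom[OF comm_ring_hom_id]]
    by (simp add: eval_hom_single)
  show ?thesis
  proof (induction H rule: poly3_additive_induct)
    case (1 n c)
    let ?f = "\<lambda>t. c * (\<Prod>i\<in>UNIV. of_nat (lk n i choose lk t i) * w $ i ^ lk t i * v $ i ^ (lk n i - lk t i))"
    have "\<iota> (inverse (mono_const t)) * eval3 v (mono_act t (Poly_Mapping.single n c)) * (\<Prod>i\<in>UNIV. w $ i ^ lk t i) = ?f t" for t
    proof -
      let ?N = "\<Prod>i\<in>UNIV. fact (lk t i) :: nat" and ?B = "\<Prod>i\<in>UNIV. (lk n i choose lk t i)"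
      \<comment> \<open>The coefficient ring need not be a field, so the factorials are cancelled in
        the ground field and the result is transported by \<iota>.\<close>
      have "\<iota> (inverse (of_nat ?N)) * of_nat ?N = \<iota> (inverse (of_nat ?N) * of_nat ?N)"
        by (simp only: crh_mult[OF assms] crh_of_nat[OF assms])
      also have "\<dots> = 1"
      proof -
        have "?N \<noteq> 0" by simp
        then have "(of_nat ?N :: 'k) \<noteq> 0" by (simp only: of_nat_eq_0_iff not_False_eq_True)
        from left_inverse[OF this] show ?thesis by (simp only: crh_1[OF assms])
      qed
      finally have u: "\<iota> (inverse (mono_const t)) * of_nat ?N = 1" unfolding mono_const_eq .
      have "eval3 v (mono_act t (Poly_Mapping.single n c)) =
          of_nat ?N * (of_nat ?B * c * (\<Prod>i\<in>UNIV. v $ i ^ (lk n i - lk t i)))"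
        unfolding mono_act_single prod.distrib of_nat_mult eval_hom_single[where h = "\<lambda>c. c", OF refl] lookup_minus
        by (simp only: mult_ac)
      then have "\<iota> (inverse (mono_const t)) * eval3 v (mono_act t (Poly_Mapping.single n c)) =
          of_nat ?B * c * (\<Prod>i\<in>UNIV. v $ i ^ (lk n i - lk t i))"
        using u by (simp only: mult.assoc[symmetric] mult_1_left)
      then show ?thesis
        unfolding prod_UNIV_3 of_nat_mult by (simp only: mult_ac)
    qed
    then have "eval3 w (tangent_cone_form \<iota> m (Poly_Mapping.single n c) v) = (\<Sum>t | mdeg t = m. ?f t)"
      unfolding ev by simp
    also have "\<dots> = c * coeff ([:v $ 0, w $ 0:] ^ lk n 0 * [:v $ 1, w $ 1:] ^ lk n 1 * [:v $ 2, w $ 2:] ^ lk n 2) m"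
      unfolding sum_mdeg coeff_mult coeff_lin_power prod_UNIV_3 lookup_mk3 sum_distrib_left sum_distrib_right
      by (simp only: mult_ac)
    also have "\<dots> = coeff (line_poly (\<lambda>c. c) v w (Poly_Mapping.single n c)) m"
      unfolding line_poly_single[OF comm_ring_hom_id] by simp
    finally show ?case .
  next
    case (2 p q)
    have "eval3 w (tangent_cone_form \<iota> m (p + q) v) =
        eval3 w (tangent_cone_form \<iota> m p v) + eval3 w (tangent_cone_form \<iota> m q v)"
      unfolding ev mono_act_add eval_hom_add[OF comm_ring_hom_id] distrib_left distrib_right sum.distrib ..
    then show ?case by (simp only: 2 crh_add[OF comm_ring_hom_line_poly[OF comm_ring_hom_id]] coeff_add)
  qed
qed

lemma tangent_cone_form_map:
  fixes h :: "'a::comm_ring_1 \<Rightarrow> 'b::comm_ring_1"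
  assumes "comm_ring_hom h"
  shows "Poly_Mapping.map h (tangent_cone_form \<iota> m H v) =
    tangent_cone_form (\<lambda>c. h (\<iota> c)) m (Poly_Mapping.map h H) (\<chi> i. h (v $ i))"
proof -
  have "h (eval3 v p) = eval3 (\<chi> i. h (v $ i)) (Poly_Mapping.map h p)" for p
    unfolding eval_hom_map[OF comm_ring_hom_id assms] by (rule eval_hom_comp[OF assms comm_ring_hom_id])
  then show ?thesis
    unfolding tangent_cone_form_def crh_sum[OF comm_ring_hom_map[OF assms]]
    by (simp add: map_single crh_0[OF assms] crh_mult[OF assms] mono_act_map[OF assms])
qed

lemma sum_mdeg_1: "(\<Sum>t | mdeg t = 1. f t) = f (mk3 1 0 0) + f (mk3 0 1 0) + f (mk3 0 0 1)"
  unfolding sum_mdeg One_nat_def sum.atMost_Suc by (simp add: add.commute add.left_commute)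

text \<open>The Taylor expansion in order one, where every \<open>mono_const\<close> equals
  1.\<close>

lemma coeff_1_line_poly:
  fixes v :: "'a::field_char_0 ^ 3"
  shows "coeff (line_poly (\<lambda>c. c) v w H) 1 = (\<Sum>i\<in>UNIV. w $ i * eval3 v (pd i H))"
proof -
  have 1: "mono_const (mk3 0 0 1) = (1::'a)" "mono_const (mk3 0 1 0) = (1::'a)" "mono_const (mk3 1 0 0) = (1::'a)"
    by (simp_all add: mono_const_eq prod_UNIV_3)
  have 2: "mono_act (mk3 0 0 1) H = pd 2 H" "mono_act (mk3 0 1 0) H = pd 1 H" "mono_act (mk3 1 0 0) H = pd 0 H"
    by (simp_all add: mono_act_def)
  have "coeff (line_poly (\<lambda>c. c) v w H) 1 = eval3 w (tangent_cone_form (\<lambda>c. c) 1 H v)"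
    by (rule taylor_line_poly[OF comm_ring_hom_id, symmetric])
  also have "\<dots> = (\<Sum>t | mdeg t = 1. inverse (mono_const t) * eval3 v (mono_act t H) * (\<Prod>i\<in>UNIV. w $ i ^ lk t i))"
    unfolding tangent_cone_form_def crh_sum[OF comm_ring_hom_eval_hom[OF comm_ring_hom_id]]
    by (simp add: eval_hom_single)
  also have "\<dots> = (\<Sum>i\<in>UNIV. w $ i * eval3 v (pd i H))"
    unfolding sum_mdeg_1 sum_UNIV_3 1 2 prod_UNIV_3 lookup_mk3
    by (simp only: inverse_1 power_0 power_one_right mult_1_left mult_1_right) (simp only: mult.commute)
  finally show ?thesis .
qed

section \<open>Powers of the ideal of a point\<close>

lemma coeff_mult_top:
  fixes p q :: "'a::comm_ring_1 poly"
  assumes "degree p \<le> d" "degree q \<le> e"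
  shows "coeff (p * q) (d + e) = coeff p d * coeff q e"
proof -
  have "(\<Sum>i\<le>d + e. coeff p i * coeff q (d + e - i)) = (\<Sum>i\<in>{d}. coeff p i * coeff q (d + e - i))"
  proof (rule sum.mono_neutral_right)
    show "\<forall>i\<in>{..d + e} - {d}. coeff p i * coeff q (d + e - i) = 0"
    proof
      fix i assume "i \<in> {..d + e} - {d}"
      then have "d < i \<or> e < d + e - i" by auto
      then show "coeff p i * coeff q (d + e - i) = 0"
        using assms by (auto simp: coeff_eq_0)
    qed
  qed auto
  then show ?thesis by (simp add: coeff_mult)
qed

lemma degree_lin_power: "degree ([:a, b:] ^ n :: 'a::comm_ring_1 poly) \<le> n"
  using degree_power_le[of "[:a, b:]" n] by (simp split: if_splits)

text \<open>Every variable contributes one linear factor in s, and its leading coefficient comes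
  from \<open>w\<close>; the top coefficient therefore forgets the base point
  \<open>v\<close>.\<close>

lemma line_poly_homogeneous:
  assumes "comm_ring_hom h" "homogeneous d f"
  shows degree_line_poly: "degree (line_poly h v w f) \<le> d"
    and coeff_line_poly_top: "coeff (line_poly h v w f) d = eval_hom h w f"
proof -
  let ?L = "\<lambda>t. line_poly h v w (Poly_Mapping.single t (lk f t))"
  have sing: "degree (?L t) \<le> d \<and> coeff (?L t) d = h (lk f t) * (\<Prod>i\<in>UNIV. w $ i ^ lk t i)"
    if t: "t \<in> Poly_Mapping.keys f" for t
  proof -
    have d: "d = 0 + (lk t 0 + lk t 1 + lk t 2)"
      using assms(2) t by (simp add: homogeneous_def mdeg_def sum_UNIV_3)
    let ?A = "[:v $ 0, w $ 0:] ^ lk t 0" and ?B = "[:v $ 1, w $ 1:] ^ lk t 1" and ?C = "[:v $ 2, w $ 2:] ^ lk t 2"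
    note deg = degree_lin_power[of "v $ 0" "w $ 0" "lk t 0"] degree_lin_power[of "v $ 1" "w $ 1" "lk t 1"]
      degree_lin_power[of "v $ 2" "w $ 2" "lk t 2"]
    have AB: "degree (?A * ?B) \<le> lk t 0 + lk t 1"
      using degree_mult_le[of ?A ?B] deg by linarith
    have ABC: "degree (?A * ?B * ?C) \<le> lk t 0 + lk t 1 + lk t 2"
      using degree_mult_le[of "?A * ?B" ?C] AB deg by linarith
    have c: "degree [:h (lk f t):] \<le> 0" by simp
    have "degree ([:h (lk f t):] * (?A * ?B * ?C)) \<le> d"
      using degree_mult_le[of "[:h (lk f t):]" "?A * ?B * ?C"] ABC c d by linarith
    moreover have "coeff ([:h (lk f t):] * (?A * ?B * ?C)) d = h (lk f t) * (\<Prod>i\<in>UNIV. w $ i ^ lk t i)"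
      unfolding d coeff_mult_top[OF c ABC] coeff_mult_top[OF AB deg(3)] coeff_mult_top[OF deg(1,2)] coeff_lin_power
        prod_UNIV_3 by simp
    ultimately show ?thesis unfolding line_poly_single[OF assms(1)] by blast
  qed
  have "line_poly h v w f = line_poly h v w (\<Sum>t\<in>Poly_Mapping.keys f. Poly_Mapping.single t (lk f t))"
    by (simp only: poly_mapping_sum_single[symmetric])
  then have sum: "line_poly h v w f = (\<Sum>t\<in>Poly_Mapping.keys f. ?L t)"
    by (simp only: crh_sum[OF comm_ring_hom_line_poly[OF assms(1)]])
  show "degree (line_poly h v w f) \<le> d"
    unfolding sum by (rule degree_sum_le) (use sing in auto)
  show "coeff (line_poly h v w f) d = eval_hom h w f"
    unfolding sum coeff_sum eval_hom_def by (rule sum.cong) (use sing in auto)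
qed

lemma coeff_0_line_poly: "comm_ring_hom h \<Longrightarrow> coeff (line_poly h v w f) 0 = eval_hom h v f"
  using poly_line_poly[of h v w f 0] by (simp add: poly_0_coeff_0)

lemma span_ideal_induct [consumes 1, case_names base zero add scale]:
  fixes S :: "'a::comm_ring_1 set"
  assumes "p \<in> ideal.span S"
    and "\<And>p. p \<in> S \<Longrightarrow> Q p" and "Q 0"
    and "\<And>p q. Q p \<Longrightarrow> Q q \<Longrightarrow> Q (p + q)" and "\<And>c p. Q p \<Longrightarrow> Q (c * p)"
  shows "Q p"
  using assms(1)
proof (rule ideal.span_induct)
  show "ideal.subspace (Collect Q)"
    unfolding ideal.subspace_def mem_Collect_eq by (intro conjI ballI allI impI assms(3-5)) simp_all
qed (rule assms(2))

lemma ideal_power_prod: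
  assumes "\<forall>i<m. f i \<in> I"
  shows "(\<Prod>i<m. f i) \<in> ideal_power I m"
  unfolding ideal_power_def
  by (rule ideal.span_base, rule CollectI, rule exI[of _ f]) (use assms in simp)

lemma ideal_power_induct [consumes 1, case_names prod zero add scale]:
  assumes "p \<in> ideal_power I m"
    and "\<And>f. \<forall>i<m. f i \<in> I \<Longrightarrow> Q (\<Prod>i<m. f i)" and "Q 0"
    and "\<And>p q. Q p \<Longrightarrow> Q q \<Longrightarrow> Q (p + q)" and "\<And>c p. Q p \<Longrightarrow> Q (c * p)"
  shows "Q p"
  using assms(1) unfolding ideal_power_def
proof (induction rule: span_ideal_induct)
  case (base p)
  then obtain f where "p = (\<Prod>i<m. f i)" "\<forall>i<m. f i \<in> I" by (elim CollectE exE conjE)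
  then show ?case using assms(2) by simp
qed (rule assms(3-5); assumption)+

lemma ideal_power_add: "p \<in> ideal_power I n \<Longrightarrow> q \<in> ideal_power I n \<Longrightarrow> p + q \<in> ideal_power I n"
  unfolding ideal_power_def by (rule ideal.span_add)

lemma ideal_power_scale: "p \<in> ideal_power I n \<Longrightarrow> c * p \<in> ideal_power I n"
  unfolding ideal_power_def by (rule ideal.span_scale)

lemma ideal_power_zero: "0 \<in> ideal_power I n"
  unfolding ideal_power_def by (rule ideal.span_zero)

lemma ideal_power_mult:
  fixes I :: "'a::comm_ring_1 set"
  assumes p: "p \<in> ideal_power I a" and q: "q \<in> ideal_power I b"
  shows "p * q \<in> ideal_power I (a + b)"
proof -
  have gen: "(\<Prod>i<a. f i) * (\<Prod>i<b. g i) \<in> ideal_power I (a + b)" if f: "\<forall>i<a. f i \<in> I" and g: "\<forall>i<b. g i \<in> I" for f g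
  proof -
    let ?k = "\<lambda>i. if i < a then f i else g (i - a)"
    have "(\<Prod>i<a + b'. ?k i) = (\<Prod>i<a. f i) * (\<Prod>i<b'. g i)" for b'
    proof (induction b')
      case (Suc b')
      have "(\<Prod>i<a + Suc b'. ?k i) = (\<Prod>i<a + b'. ?k i) * g b'" by simp
      then show ?case unfolding Suc.IH by (simp only: prod.lessThan_Suc mult.assoc)
    qed simp
    moreover have "\<forall>i<a + b. ?k i \<in> I" using f g by simp
    ultimately show ?thesis using ideal_power_prod[of "a + b" ?k I] by (simp only:)
  qed
  from q show ?thesis
  proof (induction rule: ideal_power_induct)
    case (prod g)
    from p show ?case
    proof (induction rule: ideal_power_induct)
      case (prod f)
      show ?case by (rule gen) fact+
    next
      case zero
      show ?case unfolding mult_zero_left by (rule ideal_power_zero)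
    next
      case (add p q)
      then show ?case unfolding distrib_right by (rule ideal_power_add)
    next
      case (scale c p)
      then show ?case unfolding mult.assoc by (rule ideal_power_scale)
    qed
  next
    case zero
    show ?case unfolding mult_zero_right by (rule ideal_power_zero)
  next
    case (add p q)
    then show ?case unfolding distrib_left by (rule ideal_power_add)
  next
    case (scale c p)
    then show ?case unfolding mult.left_commute[of _ c] by (rule ideal_power_scale)
  qed
qed

lemma ideal_power_power:
  assumes "p \<in> I"
  shows "p ^ n \<in> ideal_power I n"
  using ideal_power_prod[of n "\<lambda>_. p" I] assms by simp

lemma eval_hom_in_ideal_power:
  assumes "homogeneous d f" "\<And>i. Y $ i \<in> I"
  shows "eval_hom h Y f \<in> ideal_power I d"
  unfolding eval_hom_def ideal_power_def
proof (intro ideal.span_sum ideal.span_scale)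
  fix t assume "t \<in> Poly_Mapping.keys f"
  then have d: "d = lk t 0 + lk t 1 + lk t 2"
    using assms(1) by (simp add: homogeneous_def mdeg_def sum_UNIV_3)
  show "(\<Prod>i\<in>UNIV. Y $ i ^ lk t i) \<in> ideal.span {\<Prod>i<d. f i |f. \<forall>i<d. f i \<in> I}"
    unfolding ideal_power_def[symmetric] d prod_UNIV_3
    by (intro ideal_power_mult ideal_power_power assms)
qed

lemma vanishing_idealI: "homogeneous d f \<Longrightarrow> (\<And>v. v \<in> V \<Longrightarrow> eval3 v f = 0) \<Longrightarrow> f \<in> vanishing_ideal V"
  unfolding vanishing_ideal_def by (intro ideal.span_base) auto

text \<open>The generators are homogeneous, so vanishing at one coordinate vector spreads to all its
  multiples, also after an extension \<open>h\<close> of the scalars. The scalar will be a_0, which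
  turns P into the vector of indeterminates a.\<close>

lemma vanishing_ideal_eval_scale:
  assumes "f \<in> vanishing_ideal V" "v \<in> V" "comm_ring_hom h"
  shows "eval_hom h (s *s (\<chi> i. h (v $ i))) f = 0"
  using assms(1) unfolding vanishing_ideal_def
proof (induction rule: span_ideal_induct)
  case (base f)
  then obtain d where d: "homogeneous d f" and f: "eval3 v f = 0" using assms(2) by blast
  have "eval_hom h (\<chi> i. h (v $ i)) f = h (eval3 v f)"
    by (rule eval_hom_comp[OF assms(3) comm_ring_hom_id, symmetric])
  then show ?case
    unfolding eval_hom_homogeneous_scale[OF assms(3) d] f by (simp add: crh_0[OF assms(3)])
qed (simp_all add: eval_simps assms(3))

lemma vanishing_ideal_eval:
  assumes "f \<in> vanishing_ideal V" "v \<in> V"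
  shows "eval3 v f = 0"
  using vanishing_ideal_eval_scale[OF assms comm_ring_hom_id, of 1] by simp

text \<open>On a line through the point, each of the \<open>m\<close> factors of a generator
  vanishes at the parameter 0 and so contributes one power of the parameter.\<close>

lemma line_poly_ideal_power:
  fixes h :: "'a::comm_ring_1 \<Rightarrow> 'b::comm_ring_1"
  assumes "f \<in> ideal_power (vanishing_ideal {v}) m" "comm_ring_hom h"
  shows "monom 1 m dvd line_poly h (s *s (\<chi> i. h (v $ i))) w f"
proof -
  let ?L = "line_poly h (s *s (\<chi> i. h (v $ i))) w"
  note L = crh_simps[OF comm_ring_hom_line_poly[OF assms(2)]]
  show ?thesis using assms(1)
  proof (induction rule: ideal_power_induct)
    case (prod g)
    have "monom 1 1 dvd ?L (g i)" if "i < m" for i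
    proof -
      have "eval_hom h (s *s (\<chi> i. h (v $ i))) (g i) = 0"
        by (rule vanishing_ideal_eval_scale[OF _ _ assms(2)]) (use prod that in auto)
      then show ?thesis unfolding monom_1_dvd_iff' by (simp add: coeff_0_line_poly[OF assms(2)])
    qed
    then have "(\<Prod>i<m. monom 1 1) dvd (\<Prod>i<m. ?L (g i))"
      by (intro prod_dvd_prod) simp
    moreover have "(\<Prod>i<m. monom 1 1) = (monom 1 m :: 'b poly)" by (simp add: monom_power)
    ultimately show ?case unfolding L by (simp only:)
  next
    case zero
    show ?case unfolding L by (rule dvd_0_right)
  next
    case (add p q)
    then show ?case unfolding L by (rule dvd_add)
  next
    case (scale c p)
    then show ?case unfolding L by (rule dvd_mult)
  qed
qed

text \<open>Multiplicity cannot exceed the degree: on a line through \<open>v\<close> the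
  coefficient of order \<open>m\<close> is the value of \<open>f\<close> at the direction, so a
  higher multiplicity would make \<open>f\<close> vanish everywhere.\<close>

lemma has_multiplicity_atI:
  fixes f :: "'a::{idom,ring_char_0} poly3"
  assumes "homogeneous m f" "f \<noteq> 0" "f \<in> ideal_power (vanishing_ideal {v}) m"
  shows "has_multiplicity_at m f v"
  unfolding has_multiplicity_at_def
proof (intro conjI notI)
  assume *: "f \<in> ideal_power (vanishing_ideal {v}) (Suc m)"
  have "f = 0"
  proof (rule poly3_zeroI)
    fix w
    have "monom 1 (Suc m) dvd line_poly (\<lambda>c. c) (1 *s (\<chi> i. v $ i)) w f"
      by (rule line_poly_ideal_power[OF * comm_ring_hom_id])
    then have "coeff (line_poly (\<lambda>c. c) (1 *s (\<chi> i. v $ i)) w f) m = 0"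
      unfolding monom_1_dvd_iff' by blast
    then show "eval3 w f = 0" unfolding coeff_line_poly_top[OF comm_ring_hom_id assms(1)] .
  qed
  with assms(2) show False by (rule notE)
qed (rule assms)

lemma eval_pd:
  fixes p :: "'a::field_char_0 poly3"
  shows "eval3 v (pd i p) = coeff (line_poly (\<lambda>c. c) v (axis i 1) p) 1"
proof -
  have "(\<Sum>j\<in>UNIV. axis i 1 $ j * eval3 v (pd j p)) = (\<Sum>j\<in>UNIV. if j = i then eval3 v (pd j p) else 0)"
    by (rule sum.cong) (auto simp: axis_def)
  then show ?thesis unfolding coeff_1_line_poly by simp
qed

text \<open>The Leibniz rule is read off from the coefficient of order one in a product of
  restrictions to a line.\<close>

lemma pd_mult:
  fixes p q :: "'a::field_char_0 poly3"
  shows "pd i (p * q) = pd i p * q + p * pd i q"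
proof (rule poly3_eqI)
  fix v :: "'a ^ 3"
  note id = comm_ring_hom_id and L = comm_ring_hom_line_poly[OF comm_ring_hom_id]
  have c: "coeff (a * b) 1 = coeff a 1 * coeff b 0 + coeff a 0 * coeff b 1" for a b :: "'a poly"
    unfolding coeff_mult One_nat_def sum.atMost_Suc by simp
  show "eval3 v (pd i (p * q)) = eval3 v (pd i p * q + p * pd i q)"
    unfolding eval_pd crh_mult[OF L] c eval_hom_add[OF id] eval_hom_mult[OF id] coeff_0_line_poly[OF id] ..
qed

lemma pd_1: "pd i (1 :: 'a::comm_ring_1 poly3) = 0"
  using pd_single[of i 0 "1::'a"] by simp

lemma pd_prod:
  fixes f :: "'b \<Rightarrow> 'a::field_char_0 poly3"
  assumes "finite A"
  shows "pd i (prod f A) = (\<Sum>a\<in>A. pd i (f a) * prod f (A - {a}))"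
  using assms
proof (induction rule: finite_induct)
  case empty
  show ?case by (simp add: pd_1)
next
  case (insert x A)
  have "(\<Sum>a\<in>A. pd i (f a) * prod f (insert x A - {a})) = (\<Sum>a\<in>A. f x * (pd i (f a) * prod f (A - {a})))"
  proof (rule sum.cong[OF refl])
    fix a assume a: "a \<in> A"
    then have "insert x A - {a} = insert x (A - {a})" using insert by auto
    then have "prod f (insert x A - {a}) = f x * prod f (A - {a})" using insert by simp
    then show "pd i (f a) * prod f (insert x A - {a}) = f x * (pd i (f a) * prod f (A - {a}))"
      by (simp only: mult.left_commute)
  qed
  moreover have "insert x A - {x} = A" using insert by auto
  ultimately show ?case
    using insert by (simp add: pd_mult sum_distrib_left)
qed

lemma pd_Var: "pd i (Var j :: 'a::comm_ring_1 poly3) = (if i = j then 1 else 0)"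
proof -
  have "Poly_Mapping.single i 1 - Poly_Mapping.single i 1 = (0 :: 3 \<Rightarrow>\<^sub>0 nat)" for i :: 3
    by (rule poly_mapping_eqI) (simp add: lookup_minus)
  then show ?thesis unfolding Var_def pd_single by (auto simp: lookup_single when_def)
qed

lemma pd_linear_form: "pd i (\<Sum>j\<in>UNIV. Cst (c j) * Var j) = Cst (c i :: 'a::comm_ring_1)"
proof -
  have "pd i (\<Sum>j\<in>UNIV. Cst (c j) * Var j) = (\<Sum>j\<in>UNIV. if j = i then Cst (c j) else 0)"
    unfolding pd_sum pd_Cst_mult pd_Var by (rule sum.cong) auto
  then show ?thesis by simp
qed

lemma euler_identity:
  fixes p :: "'a::comm_ring_1 poly3"
  assumes "homogeneous d p"
  shows "(\<Sum>i\<in>UNIV. Var i * pd i p) = Cst (of_nat d) * p"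
proof (rule poly_mapping_eqI)
  fix t
  have *: "lk (Var i * pd i p) t = of_nat (lk t i) * lk p t" for i
  proof (cases "lk t i = 0")
    case True
    then show ?thesis by (simp add: lookup_Var_mult_eq_0)
  next
    case False
    let ?s = "t - Poly_Mapping.single i 1"
    have s: "?s + Poly_Mapping.single i 1 = t" by (rule single_1_minus_add[OF False])
    have "lk (Var i * pd i p) (?s + Poly_Mapping.single i 1) = of_nat (Suc (lk ?s i)) * lk p (?s + Poly_Mapping.single i 1)"
      unfolding lookup_Var_mult lookup_pd ..
    moreover have "Suc (lk ?s i) = lk t i" using False by (simp add: lookup_minus)
    ultimately show ?thesis unfolding s by (simp only:)
  qed
  have "lk (\<Sum>i\<in>UNIV. Var i * pd i p) t = of_nat (mdeg t) * lk p t"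
    unfolding lookup_sum * mdeg_def of_nat_sum sum_distrib_right ..
  also have "\<dots> = of_nat d * lk p t"
    using assms unfolding homogeneous_iff by (cases "lk p t = 0") auto
  finally show "lk (\<Sum>i\<in>UNIV. Var i * pd i p) t = lk (Cst (of_nat d) * p) t"
    unfolding lookup_Cst_mult .
qed

section \<open>The generic point and bi-homogeneous forms\<close>

lemma comm_ring_hom_Fract [simp]: "comm_ring_hom (\<lambda>p. Fract p 1)"
  by (rule comm_ring_homI) (simp_all add: Zero_fract_def One_fract_def)

lemma comm_ring_hom_Rep_ratfun [simp]: "comm_ring_hom Rep_ratfun"
  by (rule comm_ring_homI)
    (simp_all add: zero_ratfun.rep_eq one_ratfun.rep_eq plus_ratfun.rep_eq times_ratfun.rep_eq)

lemma Rep_ratfun_eq_0_iff: "Rep_ratfun x = 0 \<longleftrightarrow> x = 0"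
  by (metis Rep_ratfun_inject zero_ratfun.rep_eq)

lemma comm_ring_hom_Fract_Cst [simp]: "comm_ring_hom (\<lambda>c. Fract (Cst c) 1)"
  by (rule comm_ring_hom_comp[OF comm_ring_hom_Fract comm_ring_hom_Cst])

lemma ratfun_eqI: "Rep_ratfun x = Rep_ratfun y \<Longrightarrow> x = y"
  by (simp only: Rep_ratfun_inject)

lemma comm_ring_hom_ratfun_const [simp]: "comm_ring_hom ratfun_const"
proof (rule comm_ring_homI)
  note c = crh_simps[OF comm_ring_hom_Fract_Cst]
  show "ratfun_const 0 = 0" "ratfun_const 1 = 1"
    by (rule ratfun_eqI, simp only: ratfun_const.rep_eq c zero_ratfun.rep_eq one_ratfun.rep_eq)+
  show "ratfun_const (x + y) = ratfun_const x + ratfun_const y"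
    "ratfun_const (x * y) = ratfun_const x * ratfun_const y" for x y
    by (rule ratfun_eqI, simp only: ratfun_const.rep_eq c plus_ratfun.rep_eq times_ratfun.rep_eq)+
qed

lemma Fract_eq_0: "Fract p 1 = 0 \<longleftrightarrow> p = 0"
  by (simp add: Zero_fract_def eq_fract)

lemma ratfun_const_eq_0_iff: "ratfun_const c = 0 \<longleftrightarrow> c = 0"
  unfolding Rep_ratfun_eq_0_iff[symmetric] ratfun_const.rep_eq Fract_eq_0 by simp

instance ratfun :: (field_char_0) field_char_0
proof
  show "inj (of_nat :: nat \<Rightarrow> 'a ratfun)"
  proof (rule injI)
    fix m n :: nat assume *: "(of_nat m :: 'a ratfun) = of_nat n"
    have "ratfun_const (of_nat m - of_nat n :: 'a) = 0"
      unfolding crh_minus[OF comm_ring_hom_ratfun_const] crh_of_nat[OF comm_ring_hom_ratfun_const] * by simp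
    then show "m = n" unfolding ratfun_const_eq_0_iff by simp
  qed
qed

abbreviation at_P :: "'k::field poly3 \<Rightarrow> 'k ratfun" where
  "at_P \<equiv> eval_hom ratfun_const generic_point"

lemma comm_ring_hom_at_P: "comm_ring_hom at_P"
  by simp

lemma at_P_Cst: "at_P (Cst c) = ratfun_const c"
  by (simp add: eval_hom_Cst)

lemma at_P_Var: "at_P (Var i) = generic_point $ i"
  by (simp add: eval_hom_Var)

lemma Var_neq_0 [simp]: "Var i \<noteq> (0 :: 'a::comm_ring_1 poly3)"
  unfolding Var_def by (metis lookup_single_eq lookup_zero zero_neq_one)

lemma generic_point_0 [simp]: "generic_point $ 0 = 1"
proof (rule ratfun_eqI)
  show "Rep_ratfun (generic_point $ 0) = Rep_ratfun 1"
    by (simp add: generic_point_def ratfun_gen.rep_eq one_ratfun.rep_eq One_fract_def eq_fract)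
qed

lemma Fract_Var: "Fract (Var i) 1 = Fract (Var 0) 1 * Rep_ratfun (generic_point $ i)"
  by (simp add: generic_point_def ratfun_gen.rep_eq eq_fract)

lemma Fract_eq_eval: "Fract p 1 = eval_hom (\<lambda>c. Fract (Cst c) 1) (\<chi> i. Fract (Var i) 1) p"
proof -
  have "Fract (eval_hom Cst (\<chi> i. Var i) p) 1 = eval_hom (\<lambda>c. Fract (Cst c) 1) (\<chi> i. Fract ((\<chi> i. Var i) $ i) 1) p"
    by (rule eval_hom_comp[OF comm_ring_hom_Fract comm_ring_hom_Cst])
  then show ?thesis by simp
qed

lemma Rep_at_P: "Rep_ratfun (at_P p) = eval_hom (\<lambda>c. Fract (Cst c) 1) (\<chi> i. Rep_ratfun (generic_point $ i)) p"
  using eval_hom_comp[OF comm_ring_hom_Rep_ratfun comm_ring_hom_ratfun_const, of generic_point p]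
  by (simp only: ratfun_const.rep_eq)

lemma Fract_Var_vec: "(\<chi> i. Fract (Var i) 1) = Fract (Var 0) 1 *s (\<chi> i. Rep_ratfun (generic_point $ i))"
proof (rule Finite_Cartesian_Product.vec_eq_iff[THEN iffD2], rule allI)
  fix i
  show "(\<chi> i. Fract (Var i) 1) $ i = (Fract (Var 0) 1 *s (\<chi> i. Rep_ratfun (generic_point $ i))) $ i"
    using Fract_Var[of i] by (simp only: vec_lambda_beta vector_smult_component)
qed

text \<open>Dehomogenization: a = a_0 P, and a form of degree \<open>d\<close> scales by the
  \<open>d\<close>-th power.\<close>

lemma Fract_homogeneous:
  assumes "homogeneous d p"
  shows "Fract p 1 = Fract (Var 0) 1 ^ d * Rep_ratfun (at_P p)"
  unfolding Fract_eq_eval[of p] Fract_Var_vec eval_hom_homogeneous_scale[OF comm_ring_hom_Fract_Cst assms] Rep_at_P ..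

text \<open>Homogeneity is essential: \<open>Var 0 - 1\<close> vanishes at \<open>P\<close>, whose
  first coordinate is 1.\<close>

lemma at_P_eq_0_homogeneous:
  assumes "homogeneous d p" "at_P p = 0"
  shows "p = 0"
proof -
  have "Fract p 1 = 0"
    unfolding Fract_homogeneous[OF assms(1)] assms(2) by (simp add: zero_ratfun.rep_eq)
  then show ?thesis by (simp only: Fract_eq_0)
qed

lemma sum_hcomp: "(\<Sum>d\<le>degree (grade p). hcomp d p) = p"
proof -
  have "poly (grade p) 1 = p"
  proof (rule poly3_hom_eqI[of "\<lambda>p. poly (grade p) 1" "\<lambda>p. p"])
    show "comm_ring_hom (\<lambda>p. poly (grade p) 1)"
      by (rule comm_ring_hom_comp[OF comm_ring_hom_poly comm_ring_hom_grade])
  qed (simp_all add: grade_def eval_hom_Cst eval_hom_Var)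
  then show ?thesis unfolding poly_altdef hcomp_def by simp
qed

text \<open>Homogenizing with powers of \<open>Var 0\<close> changes the value neither at
  \<open>P\<close> nor at \<open>v\<close>, and the resulting form is zero. This is how identities
  over the generic point are specialised.\<close>

lemma at_P_eq_0_eval:
  assumes "at_P p = 0" "v $ 0 = 1"
  shows "eval3 v p = 0"
proof -
  let ?N = "degree (grade p)"
  let ?q = "\<Sum>d\<le>?N. Var 0 ^ (?N - d) * hcomp d p"
  have 1: "g ?q = g p" if g: "comm_ring_hom g" "g (Var 0) = 1" for g :: "'a poly3 \<Rightarrow> 'b::comm_ring_1"
  proof -
    have "g ?q = (\<Sum>d\<le>?N. g (hcomp d p))"
      by (simp add: crh_sum[OF g(1)] crh_mult[OF g(1)] crh_power[OF g(1)] g(2))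
    also have "\<dots> = g p" unfolding crh_sum[OF g(1), symmetric] sum_hcomp ..
    finally show ?thesis .
  qed
  have "homogeneous ?N ?q"
  proof (rule homogeneous_sum)
    fix d assume "d \<in> {..?N}"
    then have "(?N - d) * 1 + d = ?N" by simp
    moreover have "homogeneous ((?N - d) * 1 + d) (Var 0 ^ (?N - d) * hcomp d p)"
      by (intro homogeneous_mult homogeneous_power homogeneous_Var homogeneous_hcomp)
    ultimately show "homogeneous ?N (Var 0 ^ (?N - d) * hcomp d p)" by (simp only:)
  qed
  moreover have "at_P ?q = 0"
    unfolding assms(1)[symmetric] by (rule 1) (simp_all add: at_P_Var)
  ultimately have q: "?q = 0" by (rule at_P_eq_0_homogeneous)
  have "eval3 v p = eval3 v ?q"
    by (rule 1[symmetric]) (simp_all add: eval_hom_Var assms(2))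
  then show ?thesis unfolding q by (simp add: eval_simps)
qed

lemma at_generic_eq_map: "at_generic F = Poly_Mapping.map at_P F"
  by (simp add: at_generic_def)

lemma comm_ring_hom_at_generic: "comm_ring_hom at_generic"
  using comm_ring_hom_map[OF comm_ring_hom_at_P] by (simp add: at_generic_eq_map[abs_def])

lemma lookup_at_generic: "lk (at_generic F) t = at_P (lk F t)"
  unfolding at_generic_eq_map by (rule lookup_map) (rule crh_0[OF comm_ring_hom_at_P])

lemma eval_at_generic: "comm_ring_hom h \<Longrightarrow> eval_hom h v (at_generic F) = eval_hom (\<lambda>p. h (at_P p)) v F"
  unfolding at_generic_eq_map by (rule eval_hom_map[OF _ comm_ring_hom_at_P])

lemma bihomogeneous_iff:
  "bihomogeneous s d G \<longleftrightarrow> (\<forall>t u. lk (lk G t) u \<noteq> 0 \<longrightarrow> mdeg t = d \<and> mdeg u = s)"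
proof -
  have "lk G t \<noteq> 0 \<longleftrightarrow> (\<exists>u. lk (lk G t) u \<noteq> 0)" for t
    by (auto simp: poly_mapping_eq_iff fun_eq_iff)
  then show ?thesis unfolding bihomogeneous_def homogeneous_iff by blast
qed

lemma homogeneous_at_generic: "bihomogeneous s d G \<Longrightarrow> homogeneous d (at_generic G)"
  unfolding bihomogeneous_def homogeneous_iff lookup_at_generic
  using crh_0[OF comm_ring_hom_at_P] by metis

lemma comm_ring_hom_swap_vars [simp]: "comm_ring_hom (swap_vars :: 'k::comm_ring_1 poly3 poly3 \<Rightarrow> _)"
  unfolding swap_vars_def[abs_def]
  by (intro comm_ring_hom_eval_hom comm_ring_hom_comp[OF comm_ring_hom_Cst comm_ring_hom_Cst])

lemma eval_swap_vars:
  fixes h :: "'k::comm_ring_1 \<Rightarrow> 'b::comm_ring_1"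
  assumes "comm_ring_hom h"
  shows "eval_hom (eval_hom h v) w (swap_vars F) = eval_hom (eval_hom h w) v F"
proof -
  note CC = comm_ring_hom_comp[OF comm_ring_hom_Cst comm_ring_hom_Cst]
  have e: "comm_ring_hom (eval_hom h v)" "comm_ring_hom (eval_hom h w)" using assms by simp_all
  show ?thesis
  proof (rule poly3_hom_eqI[of "\<lambda>F. eval_hom (eval_hom h v) w (swap_vars F)"])
    show "comm_ring_hom (\<lambda>F. eval_hom (eval_hom h v) w (swap_vars F))"
      by (rule comm_ring_hom_comp[OF comm_ring_hom_eval_hom[OF e(1)] comm_ring_hom_swap_vars])
    show "comm_ring_hom (eval_hom (eval_hom h w) v)" by (rule comm_ring_hom_eval_hom[OF e(2)])
    show "eval_hom (eval_hom h v) w (swap_vars (Cst q)) = eval_hom (eval_hom h w) v (Cst q)" for q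
    proof -
      have s: "swap_vars (Cst q) = eval_hom (\<lambda>c. Cst (Cst c)) (\<chi> i. Var i) q"
        unfolding swap_vars_def by (rule eval_hom_Cst[OF comm_ring_hom_eval_hom[OF CC]])
      show ?thesis
        unfolding s eval_hom_Cst[OF e(2)]
      proof (rule poly3_hom_eqI[of "\<lambda>q. eval_hom (eval_hom h v) w (eval_hom (\<lambda>c. Cst (Cst c)) (\<chi> i. Var i) q)"])
        show "comm_ring_hom (\<lambda>q. eval_hom (eval_hom h v) w (eval_hom (\<lambda>c. Cst (Cst c)) (\<chi> i. Var i) q))"
          by (rule comm_ring_hom_comp[OF comm_ring_hom_eval_hom[OF e(1)] comm_ring_hom_eval_hom[OF CC]])
      qed (simp_all add: e eval_hom_Cst[OF CC] eval_hom_Var[OF CC] eval_hom_Cst[OF e(1)] eval_hom_Var[OF e(1)] eval_hom_Cst[OF assms] eval_hom_Var[OF assms])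
    qed
    show "eval_hom (eval_hom h v) w (swap_vars (Var i)) = eval_hom (eval_hom h w) v (Var i)" for i
    proof -
      have s: "swap_vars (Var i) = Cst (Var i :: 'k poly3)"
        unfolding swap_vars_def by (subst eval_hom_Var[OF comm_ring_hom_eval_hom[OF CC]]) simp
      show ?thesis unfolding s eval_hom_Cst[OF e(1)] eval_hom_Var[OF e(2)] eval_hom_Var[OF assms] ..
    qed
  qed
qed

lemma swap_vars_single: "swap_vars (Poly_Mapping.single t (Poly_Mapping.single u (c :: 'k::comm_ring_1))) =
    Poly_Mapping.single u (Poly_Mapping.single t c)"
proof -
  note CC = comm_ring_hom_comp[OF comm_ring_hom_Cst comm_ring_hom_Cst]
  have "swap_vars (Poly_Mapping.single t (Poly_Mapping.single u c)) =
      (Cst (Cst c) * (\<Prod>i\<in>UNIV. Var i ^ lk u i)) * (\<Prod>i\<in>UNIV. Cst (Var i) ^ lk t i)"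
    unfolding swap_vars_def eval_hom_single[where h = "eval_hom (\<lambda>c. Cst (Cst c)) (\<chi> i. Var i)", OF crh_0[OF comm_ring_hom_eval_hom[OF CC]]]
      eval_hom_single[where h = "\<lambda>c. Cst (Cst c)", OF crh_0[OF CC]] by simp
  also have "\<dots> = (Cst (Cst c) * Cst (\<Prod>i\<in>UNIV. Var i ^ lk t i)) * (\<Prod>i\<in>UNIV. Var i ^ lk u i)"
    unfolding crh_prod[OF comm_ring_hom_Cst] crh_power[OF comm_ring_hom_Cst] by (simp only: mult_ac)
  also have "\<dots> = Poly_Mapping.single u (Poly_Mapping.single t c)"
    unfolding crh_mult[OF comm_ring_hom_Cst, symmetric] single_eq_Cst_Var[symmetric] ..
  finally show ?thesis .
qed

lemma lookup_swap_vars: "lk (lk (swap_vars F) u) t = lk (lk (F :: 'k::comm_ring_1 poly3 poly3) t) u"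
proof (induction F rule: poly3_additive_induct)
  case (1 s c)
  show ?case
  proof (induction c rule: poly3_additive_induct)
    case (1 r c)
    show ?case unfolding swap_vars_single by (simp add: lookup_single when_def)
  next
    case (2 p q)
    then show ?case by (simp add: single_add crh_add[OF comm_ring_hom_swap_vars] lookup_add)
  qed
next
  case (2 p q)
  then show ?case by (simp add: crh_add[OF comm_ring_hom_swap_vars] lookup_add)
qed

lemma bihomogeneous_swap_vars: "bihomogeneous s d F \<Longrightarrow> bihomogeneous d s (swap_vars (F :: 'k::comm_ring_1 poly3 poly3))"
  unfolding bihomogeneous_iff lookup_swap_vars by blast

lemma poly3_poly3_eqI:
  fixes F G :: "'k::{idom,ring_char_0} poly3 poly3"
  assumes "\<And>v w. eval_hom (eval3 v) w F = eval_hom (eval3 v) w G"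
  shows "F = G"
proof (rule poly_mapping_eqI, rule poly3_eqI)
  fix t v
  have e: "comm_ring_hom (eval3 v :: 'k poly3 \<Rightarrow> 'k)" by simp
  have "Poly_Mapping.map (eval3 v) F = Poly_Mapping.map (eval3 v) G"
  proof (rule poly3_eqI)
    show "eval3 w (Poly_Mapping.map (eval3 v) F) = eval3 w (Poly_Mapping.map (eval3 v) G)" for w
      unfolding eval_hom_map[OF comm_ring_hom_id e] by (rule assms)
  qed
  then have "lk (Poly_Mapping.map (eval3 v) F) t = lk (Poly_Mapping.map (eval3 v) G) t" by (rule arg_cong)
  then show "eval3 v (lk F t) = eval3 v (lk G t)"
    unfolding lookup_map[of "eval3 v", OF crh_0[OF e]] .
qed

text \<open>In the \<open>a\<close> variables the form has degree \<open>m\<close> and lies in the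
  \<open>m\<close>-th power of the ideal of x, so along x + s w only the term of order
  \<open>m\<close> survives. The hypothesis concerns the generic point; homogeneity carries the
  identity to indeterminates, which are then specialised to \<open>v\<close>.\<close>

lemma translate_of_multiplicity:
  fixes F :: "'k::field_char_0 poly3 poly3"
  assumes "bihomogeneous m d F"
    and "at_generic (swap_vars F) \<in> ideal_power (vanishing_ideal {generic_point}) m"
  shows "eval_hom (eval3 (v + s *s w)) v F = s ^ m * eval_hom (eval3 w) v F"
proof -
  let ?K = "\<lambda>c. Fract (Cst c) 1 :: 'k poly3 fract"
  let ?G = "at_generic (swap_vars F)"
  let ?den = "Fract (Var 0) 1 :: 'k poly3 fract" and ?P = "(\<chi> i. Rep_ratfun (generic_point $ i)) :: 'k poly3 fract ^ 3"
  let ?a = "(\<chi> i. Fract (Var i) 1) :: 'k poly3 fract ^ 3"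
  note K = comm_ring_hom_Fract_Cst and R = comm_ring_hom_Rep_ratfun and Fr = comm_ring_hom_Fract
  have G: "homogeneous m ?G"
    by (rule homogeneous_at_generic[OF bihomogeneous_swap_vars[OF assms(1)]])
  have F: "homogeneous d F" using assms(1) by (simp add: bihomogeneous_def)
  have evG: "eval_hom Rep_ratfun y ?G = eval_hom (eval_hom ?K y) ?P F" for y
  proof -
    have "eval_hom Rep_ratfun y ?G = eval_hom (\<lambda>p. Rep_ratfun (at_P p)) y (swap_vars F)"
      by (rule eval_at_generic[OF R])
    also have "(\<lambda>p. Rep_ratfun (at_P p)) = eval_hom ?K ?P" by (rule ext) (rule Rep_at_P)
    also have "eval_hom (eval_hom ?K ?P) y (swap_vars F) = eval_hom (eval_hom ?K y) ?P F"
      by (rule eval_swap_vars[OF K])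
    finally show ?thesis .
  qed
  have main: "eval_hom Rep_ratfun (?a + r *s y) ?G = r ^ m * eval_hom Rep_ratfun y ?G" for r y
  proof -
    let ?L = "line_poly Rep_ratfun ?a y ?G"
    have "monom 1 m dvd ?L"
      unfolding Fract_Var_vec by (rule line_poly_ideal_power[OF assms(2) R])
    then have low: "coeff ?L k = 0" if "k < m" for k using that unfolding monom_1_dvd_iff' by blast
    have high: "coeff ?L k = 0" if "k > m" for k
      using degree_line_poly[OF R G, of ?a y] that by (intro coeff_eq_0) linarith
    \<comment> \<open>Multiplicity removes the coefficients below \<open>m\<close> and the degree
      removes those above.\<close>
    have "?L = monom (eval_hom Rep_ratfun y ?G) m"
    proof (rule poly_eqI)
      fix k
      show "coeff ?L k = coeff (monom (eval_hom Rep_ratfun y ?G) m) k"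
        using low high coeff_line_poly_top[OF R G, of ?a y] by (cases k m rule: linorder_cases) simp_all
    qed
    then have "poly ?L r = eval_hom Rep_ratfun y ?G * r ^ m" by (simp add: poly_monom)
    then show ?thesis unfolding poly_line_poly[OF R] by (simp only: mult.commute)
  qed
  have main2: "eval_hom (eval_hom ?K (?a + r *s y)) ?a F = r ^ m * eval_hom (eval_hom ?K y) ?a F" for r y
  proof -
    \<comment> \<open>Replacing P by a multiplies both sides by the same power of a_0, by
      homogeneity in the x variables.\<close>
    have sc: "eval_hom (eval_hom ?K z) ?a F = ?den ^ d * eval_hom Rep_ratfun z ?G" for z
      unfolding evG Fract_Var_vec
      by (rule eval_hom_homogeneous_scale[OF comm_ring_hom_eval_hom[OF K] F])
    show ?thesis unfolding sc main by (simp only: mult.left_commute)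
  qed
  let ?v = "\<lambda>y. (\<chi> i. Fract (y $ i) 1) :: 'k poly3 fract ^ 3"
  have evFr: "eval_hom (eval_hom ?K (?v y)) ?a F = Fract (eval_hom (eval_hom Cst y) (\<chi> i. Var i) F) 1" for y
  proof -
    have "Fract (eval_hom (eval_hom Cst y) (\<chi> i. Var i) F) 1 =
        eval_hom (\<lambda>q. Fract (eval_hom Cst y q) 1) (\<chi> i. Fract ((\<chi> i. Var i) $ i) 1) F"
      by (rule eval_hom_comp[OF Fr comm_ring_hom_eval_hom[OF comm_ring_hom_Cst]])
    also have "(\<lambda>q. Fract (eval_hom Cst y q) 1) = eval_hom ?K (?v y)"
      by (rule ext) (rule eval_hom_comp[OF Fr comm_ring_hom_Cst])
    finally show ?thesis by simp
  qed
  let ?w = "\<chi> i. Cst (w $ i)"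
  have "?a + Fract (Cst s) 1 *s ?v ?w = ?v ((\<chi> i. Var i) + Cst s *s ?w)"
    unfolding Finite_Cartesian_Product.vec_eq_iff by simp
  with main2[of "Fract (Cst s) 1" "?v ?w"]
  have "Fract (eval_hom (eval_hom Cst ((\<chi> i. Var i) + Cst s *s ?w)) (\<chi> i. Var i) F) 1 =
      Fract (Cst s) 1 ^ m * Fract (eval_hom (eval_hom Cst ?w) (\<chi> i. Var i) F) 1"
    by (simp only: evFr)
  also have "\<dots> = Fract (Cst s ^ m * eval_hom (eval_hom Cst ?w) (\<chi> i. Var i) F) 1"
    by (simp only: crh_power[OF Fr] crh_mult[OF Fr])
  finally have eq: "eval_hom (eval_hom Cst ((\<chi> i. Var i) + Cst s *s ?w)) (\<chi> i. Var i) F =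
      Cst s ^ m * eval_hom (eval_hom Cst ?w) (\<chi> i. Var i) F"
    by (simp add: eq_fract)
  have e: "comm_ring_hom (eval3 v :: 'k poly3 \<Rightarrow> 'k)" by simp
  \<comment> \<open>The identity now lives in polynomials whose variables stand for the point x;
    evaluation at \<open>v\<close> specialises it.\<close>
  have spec: "eval3 v (eval_hom (eval_hom Cst y) (\<chi> i. Var i) F) = eval_hom (eval3 (\<chi> i. eval3 v (y $ i))) v F" for y
  proof -
    have "eval3 v (eval_hom (eval_hom Cst y) (\<chi> i. Var i) F) =
        eval_hom (\<lambda>q. eval3 v (eval_hom Cst y q)) (\<chi> i. eval3 v ((\<chi> i. Var i) $ i)) F"
      by (rule eval_hom_comp[OF e comm_ring_hom_eval_hom[OF comm_ring_hom_Cst]])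
    also have "(\<lambda>q. eval3 v (eval_hom Cst y q)) = eval_hom (\<lambda>c. eval3 v (Cst c)) (\<chi> i. eval3 v (y $ i))"
      by (rule ext) (rule eval_hom_comp[OF e comm_ring_hom_Cst])
    finally show ?thesis by (simp add: eval_hom_Cst eval_hom_Var)
  qed
  have "(\<chi> i. eval3 v (((\<chi> i. Var i) + Cst s *s ?w) $ i)) = v + s *s w" "(\<chi> i. eval3 v (?w $ i)) = w"
    unfolding Finite_Cartesian_Product.vec_eq_iff by (simp_all add: eval_simps)
  then have "eval_hom (eval3 (v + s *s w)) v F = eval3 v (eval_hom (eval_hom Cst ((\<chi> i. Var i) + Cst s *s ?w)) (\<chi> i. Var i) F)"
    and "eval_hom (eval3 w) v F = eval3 v (eval_hom (eval_hom Cst ?w) (\<chi> i. Var i) F)"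
    by (simp_all only: spec)
  then show ?thesis
    unfolding eq crh_mult[OF e] crh_power[OF e] by (simp add: eval_hom_Cst)
qed

theorem tangent_cone_eq_swap_vars:
  fixes F :: "'k::field_char_0 poly3 poly3"
  assumes "bihomogeneous m d F"
    and "at_generic (swap_vars F) \<in> ideal_power (vanishing_ideal {generic_point}) m"
  shows "tangent_cone_form Cst m F (\<chi> i. Var i) = (- 1) ^ m * swap_vars F"
proof (rule poly3_poly3_eqI)
  fix v w :: "'k ^ 3"
  note id = comm_ring_hom_id
  have e: "comm_ring_hom (eval3 y :: 'k poly3 \<Rightarrow> 'k)" for y by simp
  let ?F = "\<lambda>y. Poly_Mapping.map (eval3 y) F"
  let ?q = "line_poly (\<lambda>c. c) v w (?F v)" and ?r = "line_poly (\<lambda>c. c) v w (?F w)"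
  have qr: "?q = monom ((- 1) ^ m) m * ?r"
  proof -
    have "poly ?q s = poly (monom ((- 1) ^ m) m * ?r) s" for s
    proof -
      \<comment> \<open>With x = v + s w the first argument is v = x - s w, so the translation
        formula applies with centre x and parameter -s.\<close>
      have "poly ?q s = eval_hom (eval3 (v + s *s w + (- s) *s w)) (v + s *s w) F"
        unfolding poly_line_poly[OF id] eval_hom_map[OF id e] by (simp add: vector_smult_lneg)
      also have "\<dots> = (- s) ^ m * eval_hom (eval3 w) (v + s *s w) F"
        by (rule translate_of_multiplicity[OF assms])
      also have "\<dots> = poly (monom ((- 1) ^ m) m * ?r) s"
        unfolding poly_mult poly_monom poly_line_poly[OF id] eval_hom_map[OF id e] power_minus[of s] ..
      finally show ?thesis .
    qed
    then show ?thesis unfolding poly_eq_poly_eq_iff[symmetric] by (intro ext)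
  qed
  have "eval_hom (eval3 v) w (tangent_cone_form Cst m F (\<chi> i. Var i)) =
      eval3 w (Poly_Mapping.map (eval3 v) (tangent_cone_form Cst m F (\<chi> i. Var i)))"
    unfolding eval_hom_map[OF id e] ..
  also have "\<dots> = eval3 w (tangent_cone_form (\<lambda>c. c) m (?F v) v)"
    unfolding tangent_cone_form_map[OF e] by (simp add: eval_hom_Cst eval_hom_Var)
  also have "\<dots> = coeff ?q m" by (rule taylor_line_poly[OF id])
  also have "\<dots> = (- 1) ^ m * eval_hom (eval3 w) v F"
    unfolding qr coeff_monom_mult by (simp add: coeff_0_line_poly eval_hom_map e)
  also have "\<dots> = eval_hom (eval3 v) w ((- 1) ^ m * swap_vars F)"
    unfolding crh_mult[OF comm_ring_hom_eval_hom[OF e]] crh_power[OF comm_ring_hom_eval_hom[OF e]]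
      crh_uminus[OF comm_ring_hom_eval_hom[OF e]] crh_1[OF comm_ring_hom_eval_hom[OF e]] eval_swap_vars[OF id] ..
  finally show "eval_hom (eval3 v) w (tangent_cone_form Cst m F (\<chi> i. Var i)) = eval_hom (eval3 v) w ((- 1) ^ m * swap_vars F)" .
qed

lemma at_generic_tangent_cone:
  "tangent_cone_form ratfun_const m (at_generic F) generic_point = at_generic (tangent_cone_form Cst m F (\<chi> i. Var i))"
  unfolding at_generic_eq_map tangent_cone_form_map[OF comm_ring_hom_at_P] by (simp add: at_P_Cst at_P_Var)

section \<open>Uniqueness of the unexpected curve\<close>

text \<open>A basis of the kernel together with one vector on which \<phi> does not vanish spans
  \<open>S\<close>. The finite set \<open>B0\<close> excludes infinite bases, whose cardinality
  would be 0.\<close>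

lemma form_space_dim_kernel_step:
  fixes \<phi> :: "'a::field poly3 \<Rightarrow> 'a"
  assumes S: "form_space.subspace S" and B0: "finite B0" "S \<subseteq> form_space.span B0"
    and add: "\<And>x y. \<phi> (x + y) = \<phi> x + \<phi> y" and scale: "\<And>c x. \<phi> (Cst c * x) = c * \<phi> x"
  shows "form_space.dim S \<le> form_space.dim {x \<in> S. \<phi> x = 0} + 1"
proof (cases "\<forall>x\<in>S. \<phi> x = 0")
  case True
  then have "{x \<in> S. \<phi> x = 0} = S" by auto
  then show ?thesis by simp
next
  case False
  then obtain v where v: "v \<in> S" "\<phi> v \<noteq> 0" by auto
  let ?K = "{x \<in> S. \<phi> x = 0}"
  obtain B where B: "B \<subseteq> ?K" "form_space.independent B" "?K \<subseteq> form_space.span B" "card B = form_space.dim ?K"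
    using form_space.basis_exists[of ?K] by blast
  have "B \<subseteq> form_space.span B0" using B(1) B0(2) by auto
  then have fin: "finite B" using form_space.independent_span_bound[OF B0(1) B(2)] by blast
  have "S \<subseteq> form_space.span (insert v B)"
  proof
    fix x assume x: "x \<in> S"
    define c where "c = - (\<phi> x / \<phi> v)"
    let ?y = "x + Cst c * v"
    have "?y \<in> S" using S x v(1) by (simp add: form_space.subspace_add form_space.subspace_scale)
    moreover have "\<phi> ?y = 0" unfolding add scale unfolding c_def using v(2) by simp
    ultimately have "?y \<in> form_space.span B" using B(3) by blast
    then have y: "?y \<in> form_space.span (insert v B)"
      using form_space.span_mono[of B "insert v B"] by blast
    have "Cst (- c) * v \<in> form_space.span (insert v B)"
      by (rule form_space.span_scale) (rule form_space.span_base, simp)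
    with y have "?y + Cst (- c) * v \<in> form_space.span (insert v B)" by (rule form_space.span_add)
    moreover have "?y + Cst (- c) * v = x"
      unfolding crh_uminus[OF comm_ring_hom_Cst] by simp
    ultimately show "x \<in> form_space.span (insert v B)" by (simp only:)
  qed
  then have "form_space.dim S \<le> card (insert v B)"
    using fin by (intro form_space.dim_le_card) simp_all
  also have "\<dots> \<le> form_space.dim ?K + 1" using fin B(4) by (simp add: card_insert_if)
  finally show ?thesis .
qed

lemma form_space_dim_kernel:
  fixes \<phi> :: "'i \<Rightarrow> 'a::field poly3 \<Rightarrow> 'a"
  assumes "finite I" and S: "form_space.subspace S" and B0: "finite B0" "S \<subseteq> form_space.span B0"
    and add: "\<And>i x y. \<phi> i (x + y) = \<phi> i x + \<phi> i y" and scale: "\<And>i c x. \<phi> i (Cst c * x) = c * \<phi> i x"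
  shows "form_space.dim S \<le> form_space.dim {x \<in> S. \<forall>i\<in>I. \<phi> i x = 0} + card I"
  using assms(1)
proof (induction I rule: finite_induct)
  case (insert j I)
  let ?K = "{x \<in> S. \<forall>i\<in>I. \<phi> i x = 0}"
  have zero: "\<phi> i 0 = 0" for i using scale[of i 0 0] by simp
  have "form_space.subspace ?K"
    using S unfolding form_space.subspace_def by (simp add: add scale zero)
  moreover have "?K \<subseteq> form_space.span B0" using B0(2) by blast
  ultimately have "form_space.dim ?K \<le> form_space.dim {x \<in> ?K. \<phi> j x = 0} + 1"
    by (intro form_space_dim_kernel_step[OF _ B0(1)] add scale)
  moreover have "{x \<in> ?K. \<phi> j x = 0} = {x \<in> S. \<forall>i\<in>insert j I. \<phi> i x = 0}" by blast
  ultimately show ?case using insert by simp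
qed simp

section \<open>Dimensions and polar forms\<close>

definition monomials :: "nat \<Rightarrow> 'a::comm_ring_1 poly3 set" where
  "monomials d = (\<lambda>t. Poly_Mapping.single t 1) ` {t. mdeg t = d}"

lemma finite_monomials [simp]: "finite (monomials d)"
  by (simp add: monomials_def)

lemma homogeneous_in_span_monomials:
  assumes "homogeneous d (p :: 'a::field poly3)"
  shows "p \<in> form_space.span (monomials d)"
proof -
  have "(\<Sum>t\<in>Poly_Mapping.keys p. Cst (lk p t) * Poly_Mapping.single t 1) \<in> form_space.span (monomials d)"
  proof (intro form_space.span_sum form_space.span_scale form_space.span_base)
    fix t assume "t \<in> Poly_Mapping.keys p"
    then show "Poly_Mapping.single t 1 \<in> monomials d"
      using assms by (simp add: homogeneous_def monomials_def)
  qed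
  moreover have "(\<Sum>t\<in>Poly_Mapping.keys p. Cst (lk p t) * Poly_Mapping.single t 1) = p"
    unfolding Cst_def mult_single by (simp add: poly_mapping_sum_single[symmetric])
  ultimately show ?thesis by (simp only:)
qed

lemma inj_single_1: "inj (\<lambda>t. Poly_Mapping.single t (1::'a::zero_neq_one))"
proof (rule injI)
  fix t u :: 'b assume "Poly_Mapping.single t (1::'a) = Poly_Mapping.single u 1"
  then have "Poly_Mapping.keys (Poly_Mapping.single t (1::'a)) = Poly_Mapping.keys (Poly_Mapping.single u (1::'a))"
    by (rule arg_cong)
  then show "t = u" by simp
qed

lemma independent_monomials: "form_space.independent (monomials d :: 'a::field poly3 set)"
proof (rule form_space.independent_if_scalars_zero)
  fix f :: "'a poly3 \<Rightarrow> 'a" and x :: "'a poly3"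
  assume s: "(\<Sum>x\<in>monomials d. Cst (f x) * x) = 0" and "x \<in> monomials d"
  then obtain t where t: "mdeg t = d" "x = Poly_Mapping.single t 1" by (auto simp: monomials_def)
  have "lk (Cst (f y) * y) t = (if y = x then f x else 0)" if y: "y \<in> monomials d" for y
  proof -
    obtain u where u: "y = Poly_Mapping.single u 1" using y by (auto simp: monomials_def)
    show ?thesis
    proof (cases "u = t")
      case True
      then have "y = x" unfolding u t(2) by (rule arg_cong)
      then show ?thesis unfolding lookup_Cst_mult by (simp add: t(2))
    next
      case False
      then have "y \<noteq> x" unfolding u t(2) by (meson injD[OF inj_single_1])
      moreover have "lk y t = 0" unfolding u using False by (rule lookup_single_not_eq)
      ultimately show ?thesis unfolding lookup_Cst_mult by simp
    qed
  qed
  then have "(\<Sum>y\<in>monomials d. lk (Cst (f y) * y) t) = (\<Sum>y\<in>monomials d. if y = x then f x else 0)"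
    by (rule sum.cong[OF refl])
  then have "lk (\<Sum>y\<in>monomials d. Cst (f y) * y) t = f x"
    using \<open>x \<in> monomials d\<close> by (simp add: lookup_sum)
  then show "f x = 0" unfolding s by simp
qed simp

lemma dim_homogeneous: "form_space.dim {p :: 'a::field poly3. homogeneous d p} = (d + 2) choose 2"
proof -
  have 1: "(monomials d :: 'a poly3 set) \<subseteq> {p. homogeneous d p}"
    by (auto simp: monomials_def homogeneous_single)
  have 2: "{p :: 'a poly3. homogeneous d p} \<subseteq> form_space.span (monomials d)"
    using homogeneous_in_span_monomials by blast
  have "card (monomials d :: 'a poly3 set) = form_space.dim {p :: 'a poly3. homogeneous d p}"
    by (rule form_space.basis_card_eq_dim[OF 1 2 independent_monomials])
  moreover have "card (monomials d :: 'a poly3 set) = card {t. mdeg t = d}"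
    unfolding monomials_def by (rule card_image) (rule inj_on_subset[OF inj_single_1], simp)
  ultimately show ?thesis by (simp only: card_mdeg)
qed

lemma subspace_homogeneous: "form_space.subspace {p :: 'a::field poly3. homogeneous d p}"
  unfolding form_space.subspace_def by (simp add: homogeneous_add homogeneous_Cst_mult)

text \<open>For v = P and a form G of degree \<open>m + 1\<close> with multiplicity \<open>m\<close>
  at P, this is the form G_1 in G(x + s P) = G(x) + s G_1(x).\<close>

definition dir_deriv :: "'a::comm_ring_1 ^ 3 \<Rightarrow> 'a poly3 \<Rightarrow> 'a poly3" where
  "dir_deriv v p = (\<Sum>i\<in>UNIV. Cst (v $ i) * pd i p)"

lemma homogeneous_dir_deriv: "homogeneous (Suc d) p \<Longrightarrow> homogeneous d (dir_deriv v p)"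
  unfolding dir_deriv_def by (intro homogeneous_sum homogeneous_Cst_mult homogeneous_pd)

lemma dir_deriv_add: "dir_deriv v (p + q) = dir_deriv v p + dir_deriv v q"
  by (simp add: dir_deriv_def pd_add distrib_left sum.distrib)

lemma dir_deriv_scale: "dir_deriv v (Cst c * p) = Cst c * dir_deriv v p"
  unfolding dir_deriv_def pd_Cst_mult sum_distrib_left by (simp only: mult.left_commute)

lemma eval_dir_deriv:
  fixes p :: "'a::field_char_0 poly3"
  shows "eval3 x (dir_deriv v p) = coeff (line_poly (\<lambda>c. c) x v p) 1"
  unfolding coeff_1_line_poly by (simp add: dir_deriv_def eval_simps)

text \<open>Seen from the point \<open>v\<close>, the form is c s^m + G(x) s^(m+1) along v + s x.
  Replacing s by 1/s and rescaling gives a linear function of s along x + s v, whose slope c is the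
  directional derivative.\<close>

lemma eval_translate:
  fixes G :: "'a::field_char_0 poly3"
  assumes "homogeneous (Suc m) G" "G \<in> ideal_power (vanishing_ideal {v}) m"
  shows "eval3 (x + s *s v) G = eval3 x G + s * eval3 x (dir_deriv v G)"
proof -
  note id = comm_ring_hom_id
  let ?q = "line_poly (\<lambda>c. c) v x G"
  define c where "c = coeff ?q m"
  have "monom 1 m dvd line_poly (\<lambda>c. c) (1 *s (\<chi> i. v $ i)) x G"
    by (rule line_poly_ideal_power[OF assms(2) id])
  then have low: "coeff ?q k = 0" if "k < m" for k using that unfolding monom_1_dvd_iff' by simp
  have high: "coeff ?q k = 0" if "k > Suc m" for k
    using degree_line_poly[OF id assms(1), of v x] that by (intro coeff_eq_0) linarith
  have q: "?q = monom c m + monom (eval3 x G) (Suc m)"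
  proof (rule poly_eqI)
    fix k
    consider "k < m" | "k = m" | "k = Suc m" | "k > Suc m" by linarith
    then show "coeff ?q k = coeff (monom c m + monom (eval3 x G) (Suc m)) k"
      by cases (simp_all add: low high c_def coeff_line_poly_top[OF id assms(1)])
  qed
  have 1: "eval3 (x + s *s v) G = eval3 x G + s * c" for s
  proof (cases "s = 0")
    case False
    have "s *s (v + inverse s *s x) = s *s v + (s * inverse s) *s x"
      by (simp only: vector_add_ldistrib vector_smult_assoc)
    then have "x + s *s v = s *s (v + inverse s *s x)"
      using False by (simp add: add.commute)
    then have "eval3 (x + s *s v) G = s ^ Suc m * poly ?q (inverse s)"
      unfolding poly_line_poly[OF id] by (simp only: eval_hom_homogeneous_scale[OF id assms(1)])
    also have "\<dots> = eval3 x G + s * c"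
    proof -
      have i: "s ^ m * inverse s ^ m = 1" "s * inverse s = 1"
        using False by (simp_all flip: power_mult_distrib)
      have "s ^ Suc m * poly ?q (inverse s) =
          s * c * (s ^ m * inverse s ^ m) + eval3 x G * (s * inverse s) * (s ^ m * inverse s ^ m)"
        unfolding q poly_add poly_monom by (simp only: power_Suc distrib_left mult_ac)
      then show ?thesis unfolding i by (simp add: add.commute)
    qed
    finally show ?thesis .
  qed simp
  have "line_poly (\<lambda>c. c) x v G = [:eval3 x G, c:]"
  proof -
    have "poly (line_poly (\<lambda>c. c) x v G) s = poly [:eval3 x G, c:] s" for s
      unfolding poly_line_poly[OF id] 1 by simp
    then show ?thesis unfolding poly_eq_poly_eq_iff[symmetric] by (intro ext)
  qed
  then have "eval3 x (dir_deriv v G) = c" unfolding eval_dir_deriv by simp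
  then show ?thesis using 1 by simp
qed

text \<open>Translate by s + 1 in one step and in two steps, and compare.\<close>

lemma eval_dir_deriv_translate:
  fixes G :: "'a::field_char_0 poly3"
  assumes "homogeneous (Suc m) G" "G \<in> ideal_power (vanishing_ideal {v}) m"
  shows "eval3 (x + s *s v) (dir_deriv v G) = eval3 x (dir_deriv v G)"
proof -
  note t = eval_translate[OF assms]
  have "x + s *s v + 1 *s v = x + (s + 1) *s v"
    by (simp add: Finite_Cartesian_Product.vec_eq_iff distrib_right)
  then have "eval3 (x + (s + 1) *s v) G = eval3 (x + s *s v) G + 1 * eval3 (x + s *s v) (dir_deriv v G)"
    using t[of "x + s *s v" 1] by (simp only:)
  then show ?thesis unfolding t by (simp add: algebra_simps)
qed

text \<open>Serves to replace the variables, modulo one or two linear forms, by a parametrization of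
  the locus where these vanish.\<close>

lemma eval_cong_mod:
  assumes "\<And>i. v $ i - w $ i \<in> ideal.span S" "comm_ring_hom h"
  shows "eval_hom h v p - eval_hom h w p \<in> ideal.span S"
proof (induction p rule: poly3_induct)
  case (Cst c)
  show ?case by (simp add: eval_hom_Cst assms(2) ideal.span_zero)
next
  case (Var i)
  show ?case by (simp add: eval_hom_Var assms)
next
  case (add p q)
  then have "(eval_hom h v p - eval_hom h w p) + (eval_hom h v q - eval_hom h w q) \<in> ideal.span S"
    by (rule ideal.span_add)
  then show ?case unfolding eval_hom_add[OF assms(2)] by (simp only: add_diff_add)
next
  case (mult p q)
  have "eval_hom h v (p * q) - eval_hom h w (p * q) =
      eval_hom h v p * (eval_hom h v q - eval_hom h w q) + eval_hom h w q * (eval_hom h v p - eval_hom h w p)"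
    unfolding eval_hom_mult[OF assms(2)] by (simp add: right_diff_distrib mult.commute)
  then show ?case using mult by (simp only: ideal.span_add ideal.span_scale)
qed

definition const_point :: "'k::field proj2 \<Rightarrow> 'k ratfun ^ 3" where
  "const_point p = (\<chi> i. ratfun_const (rep_proj2 p $ i))"

lemma fat_systemD:
  assumes "G \<in> fat_system Z d m"
  shows "homogeneous d G" and "G \<in> ideal_power (vanishing_ideal {generic_point}) m"
    and "p \<in> Z \<Longrightarrow> eval3 (const_point p) G = 0"
proof -
  have *: "G \<in> points_ideal Z" "homogeneous d G" "G \<in> ideal_power (vanishing_ideal {generic_point}) m"
    using assms unfolding fat_system_def degree_part_def by blast+
  show "homogeneous d G" "G \<in> ideal_power (vanishing_ideal {generic_point}) m" by (rule *)+
  assume "p \<in> Z"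
  then show "eval3 (const_point p) G = 0"
    using *(1) unfolding points_ideal_def const_point_def by (intro vanishing_ideal_eval) auto
qed

lemma points_idealI:
  assumes "homogeneous d G" "\<And>p. p \<in> Z \<Longrightarrow> eval3 (const_point p) G = 0"
  shows "G \<in> points_ideal Z"
  unfolding points_ideal_def using assms by (intro vanishing_idealI) (auto simp: const_point_def)

lemma fat_systemI:
  assumes "homogeneous d G" "\<And>p. p \<in> Z \<Longrightarrow> eval3 (const_point p) G = 0"
    "G \<in> ideal_power (vanishing_ideal {generic_point}) m"
  shows "G \<in> fat_system Z d m"
  unfolding fat_system_def degree_part_def using assms points_idealI[OF assms(1,2)] by blast

lemma subspace_fat_system: "form_space.subspace (fat_system Z d m)"
  unfolding form_space.subspace_def
proof (intro conjI ballI allI)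
  show "0 \<in> fat_system Z d m"
    by (rule fat_systemI) (simp_all add: ideal_power_zero eval_simps)
next
  fix x y assume *: "x \<in> fat_system Z d m" "y \<in> fat_system Z d m"
  show "x + y \<in> fat_system Z d m"
    using fat_systemD[OF *(1)] fat_systemD[OF *(2)]
    by (intro fat_systemI homogeneous_add ideal_power_add) (simp_all add: eval_simps)
next
  fix c x assume *: "x \<in> fat_system Z d m"
  show "Cst c * x \<in> fat_system Z d m"
    using fat_systemD[OF *]
    by (intro fat_systemI homogeneous_Cst_mult ideal_power_scale) (simp_all add: eval_simps)
qed

lemma fat_system_span: "fat_system Z d m \<subseteq> form_space.span (monomials d)"
  using fat_systemD(1) homogeneous_in_span_monomials by blast

lemma dim_points_ideal:
  assumes "finite Z"
  shows "(d + 2) choose 2 \<le> form_space.dim (degree_part d (points_ideal Z)) + card Z"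
proof -
  let ?S = "{p. homogeneous d p} :: 'a ratfun poly3 set"
  have "form_space.dim ?S \<le> form_space.dim {x \<in> ?S. \<forall>p\<in>Z. eval3 (const_point p) x = 0} + card Z"
    using homogeneous_in_span_monomials
    by (intro form_space_dim_kernel[OF assms subspace_homogeneous finite_monomials]) (auto simp: eval_simps)
  also have "{x \<in> ?S. \<forall>p\<in>Z. eval3 (const_point p) x = 0} = degree_part d (points_ideal Z)"
  proof (intro equalityI subsetI)
    fix x assume "x \<in> degree_part d (points_ideal Z)"
    then have x: "x \<in> points_ideal Z" "homogeneous d x" by (auto simp: degree_part_def)
    have "eval3 (const_point p) x = 0" if "p \<in> Z" for p
      using x(1) that unfolding points_ideal_def const_point_def by (intro vanishing_ideal_eval) auto
    then show "x \<in> {x \<in> ?S. \<forall>p\<in>Z. eval3 (const_point p) x = 0}" using x(2) by blast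
  qed (use points_idealI in \<open>auto simp: degree_part_def\<close>)
  finally show ?thesis unfolding dim_homogeneous .
qed

lemma ideal_power_0: "ideal_power I 0 = UNIV"
proof -
  have "1 \<in> ideal_power I 0" using ideal_power_prod[of 0 "\<lambda>_. 0" I] by simp
  from ideal_power_scale[OF this] show ?thesis by auto
qed

lemma admits_unexpected_dim:
  assumes "finite Z" "admits_unexpected Z (m + 1) m"
  shows "2 * m + 4 \<le> form_space.dim (fat_system Z (m + 1) m) + card Z" and "m \<noteq> 0"
proof -
  let ?r = "form_space.dim (fat_system Z (m + 1) m)" and ?s = "form_space.dim (degree_part (m + 1) (points_ideal Z))"
  have u: "int ?r > max 0 (int ?s - int ((m + 1) choose 2))"
    using assms(2) unfolding admits_unexpected_def .
  have "(m + 1 + 2) choose 2 \<le> ?s + card Z" by (rule dim_points_ideal[OF assms(1)])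
  moreover have "(m + 1 + 2) choose 2 = ((m + 1) choose 2) + (2 * m + 3)"
  proof -
    have s: "Suc n choose 2 = n + (n choose 2)" for n unfolding numeral_2_eq_2 by simp
    have "(m + 1 + 2) choose 2 = Suc (Suc (m + 1)) choose 2" by simp
    then show ?thesis unfolding s by linarith
  qed
  ultimately show "2 * m + 4 \<le> ?r + card Z" using u by linarith
  \<comment> \<open>For multiplicity 0 no condition is imposed at P, so the actual and the expected
    dimension agree and nothing is unexpected.\<close>
  show "m \<noteq> 0"
  proof
    assume m: "m = 0"
    have "fat_system Z (m + 1) m = degree_part (m + 1) (points_ideal Z)"
      unfolding fat_system_def m ideal_power_0 by simp
    then have r: "?r = ?s" by (rule arg_cong)
    have c: "(m + 1) choose 2 = 0" unfolding m by (rule binomial_eq_0) simp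
    show False using u unfolding r c by linarith
  qed
qed

lemma proj2_eqI:
  fixes p q :: "'k::field proj2"
  assumes "\<And>i j. rep_proj2 p $ i * rep_proj2 q $ j = rep_proj2 p $ j * rep_proj2 q $ i"
  shows "p = q"
proof -
  have rel: "proj_rel (rep_proj2 p) (rep_proj2 p)" for p :: "'k proj2"
    using Quotient3_rep_reflp[OF Quotient3_proj2] .
  then have nz: "rep_proj2 p \<noteq> 0" for p :: "'k proj2" by (metis proj_rel_def)
  obtain i where i: "rep_proj2 p $ i \<noteq> 0"
    using nz[of p] unfolding Finite_Cartesian_Product.vec_eq_iff by auto
  let ?c = "rep_proj2 q $ i / rep_proj2 p $ i"
  have q: "rep_proj2 q = ?c *s rep_proj2 p"
    unfolding Finite_Cartesian_Product.vec_eq_iff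
  proof
    fix j
    have "rep_proj2 p $ i * rep_proj2 q $ j = rep_proj2 q $ i * rep_proj2 p $ j"
      using assms[of i j] by (simp only: mult.commute)
    then show "rep_proj2 q $ j = (?c *s rep_proj2 p) $ j"
      using i by (simp add: nonzero_eq_divide_eq mult.commute)
  qed
  moreover have "?c \<noteq> 0"
  proof
    assume "?c = 0"
    with q have "rep_proj2 q = 0" by simp
    with nz show False by blast
  qed
  ultimately have "proj_rel (rep_proj2 p) (rep_proj2 q)"
    unfolding proj_rel_def using nz by blast
  then show ?thesis using Quotient3_rel_rep[OF Quotient3_proj2] by blast
qed

lemma rep_proj2_nonzero: "rep_proj2 p \<noteq> 0"
  using Quotient3_rep_reflp[OF Quotient3_proj2, of p] by (simp add: proj_rel_def)

text \<open>The pencil of lines through the generic point \<open>P\<close> is parametrized by the points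
  \<open>e\<^sub>1 + u e\<^sub>2\<close> with \<open>e\<^sub>1 = (0,0,1)\<close> and \<open>e\<^sub>2 = (0,1,p\<^sub>1)\<close>. The line joining \<open>P\<close> to \<open>e\<^sub>2\<close>,
  on which \<open>offset\<close> vanishes, contains no constant point.\<close>

definition pencil1 :: "'k::field ratfun ^ 3" where
  "pencil1 = (\<chi> i. if i = 2 then 1 else 0)"

definition pencil2 :: "'k::field ratfun ^ 3" where
  "pencil2 = (\<chi> i. if i = 0 then 0 else if i = 1 then 1 else generic_point $ 1)"

text \<open>Together with x_1 - x_0 p_1 and x_0, this is the coordinate vector of \<open>x\<close>
  in the basis \<open>pencil1\<close>, \<open>pencil2\<close>, P. The last entry p_1 of
  \<open>pencil2\<close> is chosen so that for constant \<open>x\<close> the value x_2 - x_1 p_1 +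
  x_0 (p_1^2 - p_2) vanishes only if all coordinates of \<open>x\<close> do.\<close>

definition offset :: "'k::field ratfun ^ 3 \<Rightarrow> 'k ratfun" where
  "offset x = x $ 2 - x $ 0 * generic_point $ 2 - (x $ 1 - x $ 0 * generic_point $ 1) * generic_point $ 1"

definition offset_form :: "'k::field ratfun poly3" where
  "offset_form = Var 2 - Var 0 * Cst (generic_point $ 2) - (Var 1 - Var 0 * Cst (generic_point $ 1)) * Cst (generic_point $ 1)"

definition slope_form :: "'k::field ratfun poly3" where
  "slope_form = Var 1 - Var 0 * Cst (generic_point $ 1)"

lemma eval_offset_form: "eval3 x offset_form = offset x"
  by (simp add: offset_form_def offset_def eval_simps)

lemma eval_slope_form: "eval3 x slope_form = x $ 1 - x $ 0 * generic_point $ 1"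
  by (simp add: slope_form_def eval_simps)

lemma pencil_decomposition:
  "x = (offset x *s pencil1 + (x $ 1 - x $ 0 * generic_point $ 1) *s pencil2) + x $ 0 *s generic_point"
proof -
  have "\<forall>i. x $ i = ((offset x *s pencil1 + (x $ 1 - x $ 0 * generic_point $ 1) *s pencil2) + x $ 0 *s generic_point) $ i"
    unfolding all_3 by (simp add: pencil1_def pencil2_def offset_def left_diff_distrib)
  then show ?thesis by (rule Finite_Cartesian_Product.vec_eq_iff[THEN iffD2])
qed

definition slope :: "'k::field ratfun ^ 3 \<Rightarrow> 'k ratfun" where
  "slope x = (x $ 1 - x $ 0 * generic_point $ 1) / offset x"

lemma pencil_decomposition':
  assumes "offset x \<noteq> 0"
  shows "x = offset x *s (pencil1 + slope x *s pencil2) + x $ 0 *s generic_point"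
proof -
  have "offset x * slope x = x $ 1 - x $ 0 * generic_point $ 1"
    using assms by (simp add: slope_def)
  then have "offset x *s pencil1 + (x $ 1 - x $ 0 * generic_point $ 1) *s pencil2 =
      offset x *s (pencil1 + slope x *s pencil2)"
    by (simp only: vector_add_ldistrib vector_smult_assoc)
  with pencil_decomposition[of x] show ?thesis by (rule back_subst[of "\<lambda>y. x = y + x $ 0 *s generic_point"])
qed

definition vec3 :: "'a \<Rightarrow> 'a \<Rightarrow> 'a \<Rightarrow> 'a ^ 3" where
  "vec3 a b c = (\<chi> i. if i = 0 then a else if i = 1 then b else c)"

lemma vec3_nth [simp]: "vec3 a b c $ 0 = a" "vec3 a b c $ 1 = b" "vec3 a b c $ 2 = c"
  by (simp_all add: vec3_def)

lemma offset_const_point: "offset (const_point p) \<noteq> 0"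
proof
  assume 0: "offset (const_point p) = 0"
  let ?z = "\<lambda>i. rep_proj2 p $ i"
  let ?q = "Cst (?z 2) - Cst (?z 0) * Var 2 - (Cst (?z 1) - Cst (?z 0) * Var 1) * Var 1"
  have "at_P ?q = 0"
    using 0 unfolding offset_def const_point_def by (simp add: eval_simps)
  then have e: "eval3 (vec3 1 b c) ?q = 0" for b c by (rule at_P_eq_0_eval) simp
  have "?z 2 = 0" using e[of 0 0] by (simp add: eval_simps)
  moreover have "?z 0 = 0" using e[of 0 1] calculation by (simp add: eval_simps)
  moreover have "?z 1 = 0" using e[of 1 0] calculation by (simp add: eval_simps)
  ultimately have "\<forall>i. ?z i = 0" unfolding all_3 by blast
  then have "rep_proj2 p = 0" by (simp add: Finite_Cartesian_Product.vec_eq_iff)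
  then show False using rep_proj2_nonzero by blast
qed

text \<open>Equality of slopes is a polynomial identity in p_1 and p_2. Three specialisations of it
  give the three minors of the coordinate vectors of \<open>p\<close> and \<open>q\<close>.\<close>

lemma inj_slope_const_point:
  assumes "slope (const_point p) = slope (const_point q)"
  shows "p = q"
proof (rule proj2_eqI)
  let ?z = "\<lambda>i. rep_proj2 p $ i" and ?y = "\<lambda>i. rep_proj2 q $ i"
  let ?s = "\<lambda>z. Cst (z 1) - Cst (z 0) * Var 1" and ?o = "\<lambda>z. Cst (z 2) - Cst (z 0) * Var 2 - (Cst (z 1) - Cst (z 0) * Var 1) * Var 1"
  have "at_P (?s ?z * ?o ?y - ?s ?y * ?o ?z) = 0"
    using assms offset_const_point[of p] offset_const_point[of q]
    unfolding slope_def
    by (simp add: frac_eq_eq eval_simps) (simp add: offset_def const_point_def)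
  then have e: "eval3 (vec3 1 b c) (?s ?z * ?o ?y - ?s ?y * ?o ?z) = 0" for b c by (rule at_P_eq_0_eval) simp
  have 21: "?z 1 * ?y 2 = ?y 1 * ?z 2" using e[of 0 0] by (simp add: eval_simps)
  have "?z 1 * (?y 2 - ?y 0) = ?y 1 * (?z 2 - ?z 0)" using e[of 0 1] by (simp add: eval_simps)
  then have 10: "?z 1 * ?y 0 = ?y 1 * ?z 0" using 21 by (simp add: right_diff_distrib)
  have "(?z 1 - ?z 0) * (?y 2 - (?y 1 - ?y 0)) = (?y 1 - ?y 0) * (?z 2 - (?z 1 - ?z 0))"
    using e[of 1 0] by (simp add: eval_simps)
  then have "?z 1 * ?y 2 - ?z 0 * ?y 2 - (?z 1 - ?z 0) * (?y 1 - ?y 0) = ?y 1 * ?z 2 - ?y 0 * ?z 2 - (?y 1 - ?y 0) * (?z 1 - ?z 0)"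
    by (simp only: right_diff_distrib[of "?z 1 - ?z 0" "?y 2"] right_diff_distrib[of "?y 1 - ?y 0" "?z 2"]
      left_diff_distrib[of "?z 1" "?z 0" "?y 2"] left_diff_distrib[of "?y 1" "?y 0" "?z 2"])
  then have 20: "?z 0 * ?y 2 = ?y 0 * ?z 2"
    using 21 mult.commute[of "?z 1 - ?z 0" "?y 1 - ?y 0"] by simp
  have "\<forall>i. \<forall>j. ?z i * ?y j = ?z j * ?y i"
    unfolding all_3 using 21 10 20 by (simp add: mult.commute)
  then show "?z i * ?y j = ?z j * ?y i" for i j by blast
qed

text \<open>On the pencil, \<open>H\<close> is a polynomial of degree at most \<open>d\<close> with
  more than \<open>d\<close> roots. Invariance and homogeneity extend its vanishing to every point
  off the line where \<open>offset\<close> is zero.\<close>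

lemma pencil_vanishing:
  fixes H :: "'k::field_char_0 ratfun poly3"
  assumes "homogeneous d H" "\<And>x s. eval3 (x + s *s generic_point) H = eval3 x H"
    and "finite U" "card U > d" "\<And>u. u \<in> U \<Longrightarrow> eval3 (pencil1 + u *s pencil2) H = 0"
  shows "H = 0"
proof -
  note id = comm_ring_hom_id
  let ?q = "line_poly (\<lambda>c. c) pencil1 pencil2 H"
  have "?q = 0"
  proof (rule ccontr)
    assume nz: "?q \<noteq> 0"
    have "U \<subseteq> {x. poly ?q x = 0}" using assms(5) by (auto simp: poly_line_poly[OF id])
    then have "card U \<le> card {x. poly ?q x = 0}" by (rule card_mono[OF poly_roots_finite[OF nz]])
    also have "\<dots> \<le> degree ?q" by (rule poly_roots_degree[OF nz])
    also have "\<dots> \<le> d" by (rule degree_line_poly[OF id assms(1)])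
    finally show False using assms(4) by simp
  qed
  then have w: "eval3 (pencil1 + u *s pencil2) H = 0" for u
    unfolding poly_line_poly[OF id, symmetric] by simp
  \<comment> \<open>Multiplying by the equation of the exceptional line makes the product vanish
    everywhere; the ring being a domain, the factor can be removed again.\<close>
  have "H * offset_form = 0"
  proof (rule poly3_zeroI)
    fix x :: "'k ratfun ^ 3"
    have "eval3 x H = 0" if o: "offset x \<noteq> 0"
    proof -
      have "eval3 x H = eval3 (offset x *s (pencil1 + slope x *s pencil2) + x $ 0 *s generic_point) H"
        using pencil_decomposition'[OF o] by (rule arg_cong)
      also have "\<dots> = offset x ^ d * eval3 (pencil1 + slope x *s pencil2) H"
        unfolding assms(2) by (rule eval_hom_homogeneous_scale[OF id assms(1)])
      finally show ?thesis unfolding w by simp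
    qed
    then show "eval3 x (H * offset_form) = 0" by (auto simp: eval_simps eval_offset_form)
  qed
  moreover have "offset_form \<noteq> (0 :: 'k ratfun poly3)"
  proof
    assume "offset_form = (0 :: 'k ratfun poly3)"
    then have "eval3 (vec3 0 0 1) (offset_form :: 'k ratfun poly3) = 0" by (simp add: eval_simps)
    then show False by (simp add: eval_offset_form offset_def)
  qed
  ultimately show ?thesis by simp
qed

lemma dvd_homogeneous_same_degree:
  fixes F G :: "'a::field poly3"
  assumes "homogeneous d F" "homogeneous d G" "F \<noteq> 0" "F dvd G"
  shows "\<exists>c. G = Cst c * F"
proof (cases "G = 0")
  case True
  then have "G = Cst 0 * F" by simp
  then show ?thesis by (rule exI)
next
  case False
  obtain Q where Q: "G = F * Q" using assms(4) by (rule dvdE)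
  obtain e f where ef: "homogeneous e F" "homogeneous f Q" "e + f = d"
    using assms(2) False unfolding Q by (rule homogeneous_factors)
  have "e = d" by (rule homogeneous_degree_unique[OF ef(1) assms(1,3)])
  then have "homogeneous 0 Q" using ef(2,3) by simp
  then obtain c where "Q = Cst c" using homogeneous_degree_0 by blast
  then have "G = Cst c * F" unfolding Q by (simp only: mult.commute)
  then show ?thesis by (rule exI)
qed

lemma not_dvd_homogeneous_smaller_degree:
  fixes F G :: "'a::field poly3"
  assumes "homogeneous d F" "homogeneous e G" "e < d" "G \<noteq> 0"
  shows "\<not> F dvd G"
proof
  assume "F dvd G"
  then obtain Q where Q: "G = F * Q" by (rule dvdE)
  have "F \<noteq> 0" using assms(4) unfolding Q by simp
  obtain e' f where ef: "homogeneous e' F" "homogeneous f Q" "e' + f = e"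
    using assms(2,4) unfolding Q by (rule homogeneous_factors)
  have "e' = d" by (rule homogeneous_degree_unique[OF ef(1) assms(1) \<open>F \<noteq> 0\<close>])
  then show False using ef(3) assms(3) by linarith
qed

text \<open>A form that is constant in the direction P and vanishes at \<open>x\<close> vanishes on
  the whole line joining them. The equation of that line is then a factor, and it is proper since
  the degree exceeds 1.\<close>

lemma cone_reducible:
  fixes F :: "'k::field_char_0 ratfun poly3"
  assumes F: "homogeneous (Suc m) F" "m \<noteq> 0" and tr: "\<And>x s. eval3 (x + s *s generic_point) F = eval3 x F"
    and x: "offset x \<noteq> 0" "eval3 x F = 0"
  shows "\<not> irreducible F"
proof
  assume irr: "irreducible F"
  note id = comm_ring_hom_id
  let ?u = "slope x"
  \<comment> \<open>The line through P and x: both forms vanish at P, and their ratio at x is the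
    slope.\<close>
  let ?l = "slope_form - Cst ?u * offset_form"
  let ?w = "pencil1 + ?u *s pencil2"
  have w: "eval3 ?w F = 0"
  proof -
    have "eval3 x F = eval3 (offset x *s ?w + x $ 0 *s generic_point) F"
      using pencil_decomposition'[OF x(1)] by (rule arg_cong)
    also have "\<dots> = offset x ^ Suc m * eval3 ?w F"
      unfolding tr by (rule eval_hom_homogeneous_scale[OF id F(1)])
    finally have "offset x ^ Suc m * eval3 ?w F = 0" unfolding x(2) by (rule sym)
    then have "offset x ^ Suc m = 0 \<or> eval3 ?w F = 0" by (rule mult_eq_0_iff[THEN iffD1])
    then show ?thesis using power_not_zero[OF x(1)] by blast
  qed
  let ?v = "(\<chi> i. Var i) :: 'k ratfun poly3 ^ 3"
  \<comment> \<open>Modulo the equation \<open>?l\<close> the general point agrees with this point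
    of the line, at which \<open>F\<close> is a multiple of its value at \<open>?w\<close>, namely
    0.\<close>
  let ?y = "(\<chi> i. offset_form * Cst (?w $ i) + Var 0 * Cst (generic_point $ i)) :: 'k ratfun poly3 ^ 3"
  have cong: "eval_hom Cst ?v F - eval_hom Cst ?y F \<in> ideal.span {?l}"
  proof (rule eval_cong_mod[OF _ comm_ring_hom_Cst])
    fix i
    have "?v $ i - ?y $ i = Cst (pencil2 $ i) * ?l"
    proof (rule poly3_eqI)
      fix z :: "'k ratfun ^ 3"
      have "(\<forall>i. z $ i = ((offset z *s pencil1 + (z $ 1 - z $ 0 * generic_point $ 1) *s pencil2) + z $ 0 *s generic_point) $ i)"
        using pencil_decomposition[of z] by (rule Finite_Cartesian_Product.vec_eq_iff[THEN iffD1])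
      then have z: "z $ i = offset z * pencil1 $ i + (z $ 1 - z $ 0 * generic_point $ 1) * pencil2 $ i + z $ 0 * generic_point $ i"
        by (rule allE[of _ i]) (simp only: vector_add_component vector_smult_component)
      have "eval3 z (?v $ i - ?y $ i) = z $ i - (offset z * (pencil1 $ i + ?u * pencil2 $ i) + z $ 0 * generic_point $ i)"
        by (simp add: eval_simps eval_offset_form)
      also have "\<dots> = pencil2 $ i * ((z $ 1 - z $ 0 * generic_point $ 1) - ?u * offset z)"
      proof -
        have "offset z * (pencil1 $ i + ?u * pencil2 $ i) = offset z * pencil1 $ i + pencil2 $ i * (?u * offset z)"
          by (simp only: distrib_left mult_ac)
        moreover have "a + Y * b + c - (a + b * t + c) = b * (Y - t)" for a b c Y t :: "'k ratfun"
          by (simp add: right_diff_distrib mult.commute[of Y b])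
        ultimately show ?thesis unfolding z by (simp only:)
      qed
      also have "\<dots> = eval3 z (Cst (pencil2 $ i) * ?l)"
        by (simp add: eval_simps eval_offset_form eval_slope_form)
      finally show "eval3 z (?v $ i - ?y $ i) = eval3 z (Cst (pencil2 $ i) * ?l)" .
    qed
    moreover have "Cst (pencil2 $ i) * ?l \<in> ideal.span {?l}"
      by (rule ideal.span_scale) (rule ideal.span_base, simp)
    ultimately show "?v $ i - ?y $ i \<in> ideal.span {?l}" by (simp only:)
  qed
  have "eval_hom Cst ?y F = 0"
  proof (rule poly3_zeroI)
    fix z :: "'k ratfun ^ 3"
    have "eval3 z (eval_hom Cst ?y F) = eval_hom (\<lambda>c. eval3 z (Cst c)) (\<chi> i. eval3 z (?y $ i)) F"
      by (rule eval_hom_comp[OF comm_ring_hom_eval_hom[OF id] comm_ring_hom_Cst])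
    also have "(\<lambda>c. eval3 z (Cst c)) = (\<lambda>c. c)" by (simp add: eval_hom_Cst)
    also have "(\<chi> i. eval3 z (?y $ i)) = offset z *s ?w + z $ 0 *s generic_point"
      unfolding Finite_Cartesian_Product.vec_eq_iff
      by (simp only: vec_lambda_beta eval_simps comm_ring_hom_id eval_offset_form vector_add_component vector_smult_component) simp
    also have "eval3 \<dots> F = offset z ^ Suc m * eval3 ?w F"
      unfolding tr by (rule eval_hom_homogeneous_scale[OF id F(1)])
    finally show "eval3 z (eval_hom Cst ?y F) = 0" unfolding w by simp
  qed
  with cong have "F \<in> ideal.span {?l}" by simp
  then have "?l dvd F"
  proof (induction rule: span_ideal_induct)
    case (base p)
    then show ?case by simp
  next
    case (add p q)
    then show ?case by (rule dvd_add)
  next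
    case (scale c p)
    then show ?case by (rule dvd_mult)
  qed simp
  then obtain Q where Q: "F = ?l * Q" by (rule dvdE)
  have nz: "F \<noteq> 0" using irr by (auto simp: irreducible_def)
  obtain e f where ef: "homogeneous e ?l" "homogeneous f Q" "e + f = Suc m"
    using F(1) nz unfolding Q by (rule homogeneous_factors)
  have l1: "homogeneous 1 ?l"
    unfolding slope_form_def offset_form_def
    by (intro homogeneous_minus homogeneous_Cst_mult homogeneous_Var)
      (simp_all add: mult.commute[of _ "Cst _"] homogeneous_minus homogeneous_Cst_mult)
  have "?l \<noteq> 0" using Q nz by auto
  then have "e = 1" using homogeneous_degree_unique[OF ef(1) l1] by simp
  have "?l dvd 1 \<or> Q dvd 1" using irr Q by (rule irreducibleD)
  then show False
  proof
    assume "?l dvd 1"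
    from homogeneous_unit[OF l1 this] show False by simp
  next
    assume "Q dvd 1"
    from homogeneous_unit[OF ef(2) this] show False using ef(3) \<open>e = 1\<close> F(2) by simp
  qed
qed

lemma ex_extra_slopes:
  fixes U0 :: "'a::field_char_0 set"
  assumes "finite U0"
  shows "\<exists>U. finite U \<and> card U = n \<and> U \<inter> U0 = {}"
proof -
  have "infinite (UNIV - U0)" using assms infinite_UNIV_char_0[where 'a = 'a] by simp
  then obtain U where "finite U" "card U = n" "U \<subseteq> UNIV - U0"
    using infinite_arbitrarily_large by blast
  then show ?thesis by blast
qed

theorem unexpected_form_unique:
  fixes F G :: "'k::field_char_0 ratfun poly3"
  assumes Z: "finite Z" and adm: "admits_unexpected Z (m + 1) m"
    and F: "F \<in> fat_system Z (m + 1) m" "irreducible F"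
    and G: "G \<in> fat_system Z (m + 1) m"
  shows "\<exists>c. G = Cst c * F"
proof (rule ccontr)
  assume not: "\<nexists>c. G = Cst c * F"
  let ?fat = "fat_system Z (m + 1) m"
  let ?P = "generic_point :: 'k ratfun ^ 3"
  let ?D = "dir_deriv ?P"
  let ?w = "\<lambda>u. pencil1 + u *s pencil2"
  let ?U0 = "(\<lambda>p. slope (const_point p)) ` Z"
  note id = comm_ring_hom_id and dim = admits_unexpected_dim[OF Z adm]
  have hom: "homogeneous (Suc m) H" and mult: "H \<in> ideal_power (vanishing_ideal {?P}) m" if "H \<in> ?fat" for H
    using fat_systemD[OF that] by simp_all
  have Fnz: "F \<noteq> 0" using F(2) by (auto simp: irreducible_def)
  have U0: "finite ?U0" "card ?U0 = card Z"
    using Z inj_slope_const_point by (auto intro!: card_image inj_onI)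
  have sub: "form_space.subspace ?fat" "?fat \<subseteq> form_space.span (monomials (m + 1))"
    by (rule subspace_fat_system fat_system_span)+
  show False
  proof (cases "?D F = 0")
    case False
    \<comment> \<open>The roots missing from 2m + 2. Truncated subtraction asks for none if
      \<open>Z\<close> already supplies enough.\<close>
    obtain U1 where U1: "finite U1" "card U1 = 2 * m + 2 - card Z" "U1 \<inter> ?U0 = {}"
      using ex_extra_slopes[OF U0(1)] by blast
    let ?V = "\<lambda>H. ?D H * F - ?D F * H"
    let ?K = "{H \<in> ?fat. \<forall>u\<in>U1. eval3 (?w u) (?V H) = 0}"
    have Vadd: "?V (x + y) = ?V x + ?V y" for x y
      by (simp add: dir_deriv_add distrib_left distrib_right)
    have Vscale: "?V (Cst c * x) = Cst c * ?V x" for c x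
      unfolding dir_deriv_scale right_diff_distrib by (simp only: mult_ac)
    have K: "form_space.dim ?fat \<le> form_space.dim ?K + card U1"
      by (rule form_space_dim_kernel[OF U1(1) sub(1) finite_monomials sub(2)])
        (simp_all only: Vadd Vscale eval_hom_add[OF id] eval_hom_mult[OF id] eval_hom_Cst[OF id])
    \<comment> \<open>If \<open>Z\<close> has at most 2m + 2 points, the extra conditions leave
      dimension at least (2m + 4 - card Z) - (2m + 2 - card Z) = 2. If it has more, no condition was
      imposed and \<open>G\<close> itself serves.\<close>
    have "\<exists>H\<in>?K. \<nexists>c. H = Cst c * F"
    proof (cases "card Z \<le> 2 * m + 2")
      case True
      show ?thesis
      proof (rule ccontr)
        assume "\<not> (\<exists>H\<in>?K. \<nexists>c. H = Cst c * F)"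
        then have "\<exists>c. H = Cst c * F" if "H \<in> ?K" for H using that by blast
        note KF = this
        have "?K \<subseteq> form_space.span {F}"
        proof
          fix H assume "H \<in> ?K"
          then obtain c where c: "H = Cst c * F" using KF by blast
          show "H \<in> form_space.span {F}"
            unfolding c by (rule form_space.span_scale) (rule form_space.span_base, simp)
        qed
        then have "form_space.dim ?K \<le> card {F}" by (intro form_space.dim_le_card) simp_all
        then show False using K dim U1(2) True by simp
      qed
    next
      case False
      then have "U1 = {}" using U1 by simp
      then have "G \<in> ?K" using G by simp
      then show ?thesis using not by (intro bexI[of _ G])
    qed
    then obtain H where H: "H \<in> ?fat" "\<forall>u\<in>U1. eval3 (?w u) (?V H) = 0" "\<nexists>c. H = Cst c * F"
      by blast
    have "?V H = 0"
    proof (rule pencil_vanishing[of "m + Suc m" _ "U1 \<union> ?U0"])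
      show "homogeneous (m + Suc m) (?V H)"
        using hom[OF F(1)] hom[OF H(1)]
        by (intro homogeneous_minus homogeneous_mult homogeneous_dir_deriv)
      show tr: "eval3 (x + s *s ?P) (?V H) = eval3 x (?V H)" for x s
      proof -
        note tF = eval_translate[OF hom[OF F(1)] mult[OF F(1)]] eval_dir_deriv_translate[OF hom[OF F(1)] mult[OF F(1)]]
        note tH = eval_translate[OF hom[OF H(1)] mult[OF H(1)]] eval_dir_deriv_translate[OF hom[OF H(1)] mult[OF H(1)]]
        let ?a = "eval3 x (?D H)" and ?b = "eval3 x (?D F)"
        have "eval3 (x + s *s ?P) (?V H) = ?a * (eval3 x F + s * ?b) - ?b * (eval3 x H + s * ?a)"
          by (simp only: eval_simps id tF tH)
        also have "\<dots> = ?a * eval3 x F - ?b * eval3 x H"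
          unfolding distrib_left mult.left_commute[of ?b s ?a] mult.left_commute[of ?a s ?b] mult.commute[of ?b ?a] by simp
        finally show ?thesis by (simp only: eval_simps id)
      qed
      show "finite (U1 \<union> ?U0)" using U1(1) U0(1) by simp
      show "m + Suc m < card (U1 \<union> ?U0)"
        using U1 U0 by (subst card_Un_disjoint) auto
      show "eval3 (?w u) (?V H) = 0" if u: "u \<in> U1 \<union> ?U0" for u
      proof (cases "u \<in> U1")
        case True
        then show ?thesis using H(2) by blast
      next
        case False
        then obtain p where p: "p \<in> Z" "u = slope (const_point p)" using u by blast
        let ?z = "const_point p"
        note o = offset_const_point[of p]
        \<comment> \<open>The constant point differs from a nonzero multiple of \<open>?w u\<close>
          by a multiple of P, so the zero of the invariant form moves to the pencil.\<close>
        have "eval3 ?z (?V H) = eval3 (offset ?z *s ?w u + ?z $ 0 *s ?P) (?V H)"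
          using pencil_decomposition'[OF o] unfolding p(2) by (rule arg_cong)
        also have "\<dots> = offset ?z ^ (m + Suc m) * eval3 (?w u) (?V H)"
          unfolding tr
          by (rule eval_hom_homogeneous_scale[OF id], intro homogeneous_minus homogeneous_mult homogeneous_dir_deriv hom F(1) H(1))
        finally have "offset ?z ^ (m + Suc m) * eval3 (?w u) (?V H) = eval3 ?z (?V H)" by (rule sym)
        also have "\<dots> = 0"
          by (simp only: eval_simps id fat_systemD(3)[OF F(1) p(1)] fat_systemD(3)[OF H(1) p(1)] mult_zero_right diff_self)
        finally have "offset ?z ^ (m + Suc m) = 0 \<or> eval3 (?w u) (?V H) = 0"
          by (rule mult_eq_0_iff[THEN iffD1])
        then show ?thesis using power_not_zero[OF o] by blast
      qed
    qed
    then have "?D F * H = F * ?D H" by (simp only: right_minus_eq mult.commute)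
    then have dvd: "F dvd ?D F * H" by (rule dvdI)
    \<comment> \<open>A prime \<open>F\<close> divides \<open>?D F\<close> or \<open>H\<close>. The
      first is a nonzero form of smaller degree, so \<open>F\<close> divides \<open>H\<close>, which
      has the same degree.\<close>
    have "prime_elem F" by (rule irreducible_imp_prime_poly3[OF F(2)])
    from prime_elem_dvd_multD[OF this dvd] show False
    proof
      assume "F dvd ?D F"
      moreover have "\<not> F dvd ?D F"
        by (rule not_dvd_homogeneous_smaller_degree[OF hom[OF F(1)] homogeneous_dir_deriv[OF hom[OF F(1)]] lessI False])
      ultimately show False by (rule notE[rotated])
    next
      assume "F dvd H"
      from dvd_homogeneous_same_degree[OF hom[OF F(1)] hom[OF H(1)] Fnz this] H(3) show False by (rule notE[rotated])
    qed
  next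
    case DF: True
    \<comment> \<open>The remaining case: \<open>F\<close> is a cone with vertex P.\<close>
    have tr: "eval3 (x + s *s ?P) F = eval3 x F" for x s
      unfolding eval_translate[OF hom[OF F(1)] mult[OF F(1)]] DF by (simp add: eval_simps)
    show False
    proof (cases "Z = {}")
      case False
      then obtain p where p: "p \<in> Z" by blast
      have "\<not> irreducible F"
        by (rule cone_reducible[OF hom[OF F(1)] dim(2) tr offset_const_point[of p] fat_systemD(3)[OF F(1) p]])
      then show False using F(2) by (rule notE)
    next
      case True
      \<comment> \<open>Here the dimension is at least 2m + 4. But m + 1 slopes force
        \<open>?D H\<close> to vanish, after which \<open>H\<close> is invariant and m + 2 slopes
        force it to vanish too: 2m + 3 conditions kill the system.\<close>
      obtain U :: "'k ratfun set" where U: "finite U" "card U = m + 2" using ex_extra_slopes[of "{}"] by blast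
      obtain U' :: "'k ratfun set" where U': "finite U'" "card U' = m + 1" using ex_extra_slopes[of "{}"] by blast
      let ?\<phi> = "\<lambda>i H. case i of Inl u \<Rightarrow> eval3 (?w u) H | Inr u \<Rightarrow> eval3 (?w u) (?D H)"
      let ?K = "{H \<in> ?fat. \<forall>i\<in>U <+> U'. ?\<phi> i H = 0}"
      have "form_space.dim ?fat \<le> form_space.dim ?K + card (U <+> U')"
        by (rule form_space_dim_kernel[OF finite_Plus[OF U(1) U'(1)] sub(1) finite_monomials sub(2)])
          (simp_all add: dir_deriv_add dir_deriv_scale eval_simps split: sum.split)
      then have "form_space.dim ?K \<noteq> 0" using dim True U U' by (simp add: card_Plus)
      moreover have "?K \<subseteq> form_space.span {}"
      proof
        fix H assume "H \<in> ?K"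
        then have H: "H \<in> ?fat" "\<And>u. u \<in> U \<Longrightarrow> eval3 (?w u) H = 0" "\<And>u. u \<in> U' \<Longrightarrow> eval3 (?w u) (?D H) = 0"
          by (blast, force, force)
        have D0: "?D H = 0"
          using homogeneous_dir_deriv[OF hom[OF H(1)]] eval_dir_deriv_translate[OF hom[OF H(1)] mult[OF H(1)]] U'(1)
          by (rule pencil_vanishing) (use U'(2) H(3) in simp_all)
        have trH: "eval3 (x + s *s ?P) H = eval3 x H" for x s
          unfolding eval_translate[OF hom[OF H(1)] mult[OF H(1)]] D0 by (simp add: eval_simps)
        have "H = 0"
          using hom[OF H(1)] trH U(1) by (rule pencil_vanishing) (use U(2) H(2) in simp_all)
        then show "H \<in> form_space.span {}" by simp
      qed
      then have "form_space.dim ?K \<le> card ({} :: 'k ratfun poly3 set)" by (intro form_space.dim_le_card) simp_all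
      ultimately show False by simp
    qed
  qed
qed

section \<open>Free syzygy modules\<close>

lemma Var_decompose:
  fixes p :: "'a::comm_ring_1 poly3"
  shows "\<exists>q r. p = Var i * q + r \<and> (\<forall>t. lk r t = (if lk t i = 0 then lk p t else 0))"
proof -
  let ?K = "Poly_Mapping.keys p"
  define q where "q = (\<Sum>t\<in>{t \<in> ?K. lk t i \<noteq> 0}. Poly_Mapping.single (t - Poly_Mapping.single i 1) (lk p t))"
  define r where "r = (\<Sum>t\<in>{t \<in> ?K. lk t i = 0}. Poly_Mapping.single t (lk p t))"
  have "Var i * q = (\<Sum>t\<in>{t \<in> ?K. lk t i \<noteq> 0}. Poly_Mapping.single t (lk p t))"
    unfolding q_def sum_distrib_left Var_def mult_single
  proof (rule sum.cong[OF refl])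
    fix t assume "t \<in> {t \<in> ?K. lk t i \<noteq> 0}"
    then have "t - Poly_Mapping.single i 1 + Poly_Mapping.single i 1 = t" by (intro single_1_minus_add) simp
    then show "Poly_Mapping.single (Poly_Mapping.single i 1 + (t - Poly_Mapping.single i 1)) (1 * lk p t) = Poly_Mapping.single t (lk p t)"
      by (simp only: add.commute mult_1_left)
  qed
  moreover have "(\<Sum>t\<in>?K. Poly_Mapping.single t (lk p t)) =
      (\<Sum>t\<in>{t \<in> ?K. lk t i \<noteq> 0}. Poly_Mapping.single t (lk p t)) + r"
  proof -
    have "?K = {t \<in> ?K. lk t i \<noteq> 0} \<union> {t \<in> ?K. lk t i = 0}" by auto
    then have "(\<Sum>t\<in>?K. Poly_Mapping.single t (lk p t)) =
        (\<Sum>t\<in>{t \<in> ?K. lk t i \<noteq> 0} \<union> {t \<in> ?K. lk t i = 0}. Poly_Mapping.single t (lk p t))" by (rule arg_cong)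
    also have "\<dots> = (\<Sum>t\<in>{t \<in> ?K. lk t i \<noteq> 0}. Poly_Mapping.single t (lk p t)) + r"
      unfolding r_def by (rule sum.union_disjoint) auto
    finally show ?thesis .
  qed
  ultimately have 1: "p = Var i * q + r" by (simp only: poly_mapping_sum_single[symmetric])
  have r: "lk r t = (if lk t i = 0 then lk p t else 0)" for t
  proof -
    have "lk r t = (\<Sum>s\<in>{t \<in> ?K. lk t i = 0}. if s = t then lk p t else 0)"
      unfolding r_def lookup_sum by (rule sum.cong) (auto simp: lookup_single when_def)
    then show ?thesis by (simp add: in_keys_iff)
  qed
  from 1 r show ?thesis by blast
qed

lemma Var_dvdI:
  fixes p :: "'a::comm_ring_1 poly3"
  assumes "\<And>t :: 3 \<Rightarrow>\<^sub>0 nat. lk t i = 0 \<Longrightarrow> lk p t = 0"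
  shows "Var i dvd p"
proof -
  obtain q r where *: "p = Var i * q + r" "\<And>t. lk r t = (if lk t i = 0 then lk p t else 0)"
    using Var_decompose[of p i] by blast
  have "r = 0"
  proof (rule poly_mapping_eqI)
    show "lk r t = lk 0 t" for t using * assms[of t] by (cases "lk t i = 0") simp_all
  qed
  then show ?thesis using *(1) by simp
qed

lemma Var_dvd_of_mult_eq:
  fixes X Y :: "'a::comm_ring_1 poly3"
  assumes "Var i * X = Var j * Y" "i \<noteq> j"
  shows "Var j dvd X"
proof (rule Var_dvdI)
  fix t :: "3 \<Rightarrow>\<^sub>0 nat" assume t: "lk t j = 0"
  have "lk X t = lk (Var i * X) (t + Poly_Mapping.single i 1)" by (rule lookup_Var_mult[symmetric])
  also have "\<dots> = 0"
    unfolding assms(1) by (rule lookup_Var_mult_eq_0) (use t assms(2) in \<open>simp add: lookup_add lookup_single\<close>)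
  finally show "lk X t = 0" .
qed

text \<open>The variables form a regular sequence. Divide \<open>a\<close> by \<open>Var 1\<close>:
  the remainder has no term free of \<open>Var 2\<close>, since times \<open>Var 0\<close> such a
  term could cancel in neither of the other two products. Dividing out these parts leaves a relation
  between two variables.\<close>

lemma koszul_exact:
  fixes a b c :: "'a::idom poly3"
  assumes "Var 0 * a + Var 1 * b + Var 2 * c = 0"
  shows "\<exists>r0 r1 r2. a = Var 2 * r1 - Var 1 * r2 \<and> b = Var 0 * r2 - Var 2 * r0 \<and> c = Var 1 * r0 - Var 0 * r1"
proof -
  obtain q r where q: "a = Var 1 * q + r" "\<And>t. lk r t = (if lk t 1 = 0 then lk a t else 0)"
    using Var_decompose[of a 1] by blast
  have "Var 2 dvd r"
  proof (rule Var_dvdI)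
    fix t :: "3 \<Rightarrow>\<^sub>0 nat" assume t: "lk t 2 = 0"
    show "lk r t = 0"
    proof (cases "lk t 1 = 0")
      case True
      let ?t = "t + Poly_Mapping.single 0 1"
      have "lk (Var 1 * b) ?t = 0" by (rule lookup_Var_mult_eq_0) (simp add: lookup_add lookup_single True)
      moreover have "lk (Var 2 * c) ?t = 0" by (rule lookup_Var_mult_eq_0) (simp add: lookup_add lookup_single t)
      moreover have "lk (Var 0 * a) ?t + lk (Var 1 * b) ?t + lk (Var 2 * c) ?t = 0"
        unfolding lookup_add[symmetric] assms by simp
      ultimately show ?thesis unfolding lookup_Var_mult q(2) by simp
    qed (simp add: q(2))
  qed
  then obtain d where d: "r = Var 2 * d" by (rule dvdE)
  let ?X = "b + Var 0 * q" and ?Y = "c + Var 0 * d"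
  have "Var 1 * ?X + Var 2 * ?Y = Var 0 * (Var 1 * q + Var 2 * d) + Var 1 * b + Var 2 * c"
    by (simp only: distrib_left mult.left_commute add_ac)
  also have "\<dots> = 0" using assms unfolding q(1) d .
  finally have XY: "Var 1 * ?X = Var 2 * (- ?Y)"
    unfolding mult_minus_right by (rule eq_neg_iff_add_eq_0[THEN iffD2])
  then have "Var 2 dvd ?X" by (rule Var_dvd_of_mult_eq) simp
  then obtain e where e: "?X = Var 2 * e" by (rule dvdE)
  have "Var 2 * (Var 1 * e) = Var 2 * (- ?Y)" using XY unfolding e by (simp only: mult.left_commute)
  then have Y: "Var 1 * e = - ?Y" by (rule mult_left_cancel[THEN iffD1, rotated]) simp
  have "a = Var 2 * d - Var 1 * (- q)" unfolding q(1) d by simp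
  moreover have "b = Var 0 * (- q) - Var 2 * (- e)" using e by (simp add: eq_diff_eq)
  moreover have "Var 1 * (- e) = c + Var 0 * d" by (simp only: mult_minus_right Y minus_minus)
  then have "c = Var 1 * (- e) - Var 0 * d" by (simp only: eq_diff_eq)
  ultimately show ?thesis by blast
qed

text \<open>As a map in \<open>s\<close>, its image is the ideal generated by the entries of
  \<open>g\<close> and its kernel is their syzygy module.\<close>

definition pair_with :: "'a::comm_ring_1 ^ 3 \<Rightarrow> 'a ^ 3 \<Rightarrow> 'a" where
  "pair_with g s = (\<Sum>i\<in>UNIV. s $ i * g $ i)"

lemma pair_with_add: "pair_with g (s + t) = pair_with g s + pair_with g t"
  by (simp add: pair_with_def distrib_right sum.distrib)

lemma pair_with_diff: "pair_with g (s - t) = pair_with g s - pair_with g t"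
  by (simp add: pair_with_def left_diff_distrib sum_subtractf)

lemma pair_with_scale: "pair_with g (c *s s) = c * pair_with g s"
  unfolding pair_with_def sum_distrib_left vector_smult_component mult.assoc ..

lemma pair_with_0 [simp]: "pair_with g 0 = 0"
  by (simp add: pair_with_def)

lemma pair_with_sum: "pair_with g (sum f A) = (\<Sum>a\<in>A. pair_with g (f a))"
  by (induction A rule: infinite_finite_induct) (simp_all add: pair_with_add)

text \<open>A free module has depth three, so the Koszul cycle formed by the differences
  \<open>y\<^sub>j \<sigma>\<^sub>i - y\<^sub>i \<sigma>\<^sub>j\<close> of syzygies is a boundary: a free syzygy module makes the ideal saturated.\<close>

lemma free_syzygies_saturated:
  fixes g :: "'a::idom poly3 ^ 3"
  assumes free: "free_submodule {s. pair_with g s = 0}"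
    and h: "\<And>i. \<exists>s. Var i * h = pair_with g s"
  shows "\<exists>s. h = pair_with g s"
proof -
  let ?M = "{s. pair_with g s = 0}"
  obtain B where B: "B \<subseteq> ?M" "pvec.independent B" "pvec.span B = ?M"
    using free unfolding free_submodule_def by blast
  let ?r = "pvec.representation B"
  have "\<forall>i. \<exists>s. Var i * h = pair_with g s" using h by blast
  then obtain \<sigma> where \<sigma>: "\<And>i. Var i * h = pair_with g (\<sigma> i)" by metis
  let ?\<tau> = "\<lambda>i j. Var j *s \<sigma> i - Var i *s \<sigma> j"
  \<comment> \<open>Both terms pair with \<open>g\<close> to
    \<open>Var i * Var j * h\<close>.\<close>
  have \<tau>: "?\<tau> i j \<in> pvec.span B" for i j
    unfolding B(3) mem_Collect_eq pair_with_diff pair_with_scale \<sigma>[symmetric] by (simp only: mult.left_commute diff_self)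
  have cyc: "Var 0 *s ?\<tau> 1 2 + Var 1 *s ?\<tau> 2 0 + Var 2 *s ?\<tau> 0 1 = 0"
  proof -
    have 1: "Var 1 * Var 0 = (Var 0 * Var 1 :: 'a poly3)" "Var 2 * Var 0 = (Var 0 * Var 2 :: 'a poly3)" "Var 2 * Var 1 = (Var 1 * Var 2 :: 'a poly3)"
      by (rule mult.commute)+
    show ?thesis unfolding vector_ssub_ldistrib vector_smult_assoc 1 by simp
  qed
  \<comment> \<open>Freeness enters here: the cyclic relation between vectors holds in each
    coordinate over the basis, where exactness for polynomials applies.\<close>
  have rep: "Var 0 * ?r (?\<tau> 1 2) b + Var 1 * ?r (?\<tau> 2 0) b + Var 2 * ?r (?\<tau> 0 1) b = 0" for b
  proof -
    have add: "?r (v + w) b = ?r v b + ?r w b" if "v \<in> pvec.span B" "w \<in> pvec.span B" for v w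
      using pvec.representation_add[OF B(2) that(2,1)] by (rule fun_cong)
    have scale: "?r (c *s v) b = c * ?r v b" if "v \<in> pvec.span B" for c v
      using pvec.representation_scale[OF B(2) that, of c] by (rule fun_cong)
    have "?r (Var 0 *s ?\<tau> 1 2 + Var 1 *s ?\<tau> 2 0 + Var 2 *s ?\<tau> 0 1) b =
        Var 0 * ?r (?\<tau> 1 2) b + Var 1 * ?r (?\<tau> 2 0) b + Var 2 * ?r (?\<tau> 0 1) b"
      by (simp only: add scale pvec.span_add pvec.span_scale \<tau>)
    then show ?thesis unfolding cyc pvec.representation_zero by (rule sym)
  qed
  have "\<forall>b. \<exists>r0 r1. ?r (?\<tau> 0 1) b = Var 1 * r0 - Var 0 * r1" using koszul_exact[OF rep] by blast
  then obtain r0 r1 where r: "\<And>b. ?r (?\<tau> 0 1) b = Var 1 * r0 b - Var 0 * r1 b" by metis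
  let ?S = "{b. ?r (?\<tau> 0 1) b \<noteq> 0}"
  have S: "finite ?S" "?S \<subseteq> B"
    using pvec.finite_representation[of B] pvec.representation_ne_zero[of B] by blast+
  define \<rho>0 where "\<rho>0 = (\<Sum>b\<in>?S. r0 b *s b)"
  define \<rho>1 where "\<rho>1 = (\<Sum>b\<in>?S. r1 b *s b)"
  have "?\<tau> 0 1 = (\<Sum>b\<in>?S. ?r (?\<tau> 0 1) b *s b)"
    by (rule pvec.sum_nonzero_representation_eq[OF B(2) \<tau>, symmetric])
  also have "\<dots> = Var 1 *s \<rho>0 - Var 0 *s \<rho>1"
    unfolding r \<rho>0_def \<rho>1_def pvec.scale_sum_right pvec.scale_left_diff_distrib sum_subtractf pvec.scale_scale ..
  finally have \<tau>\<rho>: "?\<tau> 0 1 = Var 1 *s \<rho>0 - Var 0 *s \<rho>1" .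
  \<comment> \<open>The boundary corrects \<sigma> by syzygies so that the differences vanish. Hence
    \<open>Var 0\<close> divides the corrected vector, and the quotient pairs with \<open>g\<close>
    to \<open>h\<close>.\<close>
  have eq: "Var 1 *s (\<sigma> 0 - \<rho>0) = Var 0 *s (\<sigma> 1 - \<rho>1)"
  proof -
    have "a - c = b - d" if e: "a - b = c - d" for a b c d :: "'a poly3 ^ 3"
    proof -
      have "a = c - d + b" using e by (simp only: diff_eq_eq)
      then show ?thesis by simp
    qed
    note * = this
    show ?thesis
      unfolding pvec.scale_right_diff_distrib by (rule *) (rule \<tau>\<rho>)
  qed
  have "pair_with g b = 0" if "b \<in> ?S" for b using S(2) B(1) that by blast
  then have g0: "pair_with g \<rho>0 = 0"
    unfolding \<rho>0_def pair_with_sum pair_with_scale by simp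
  have "Var 0 dvd (\<sigma> 0 - \<rho>0) $ i" for i
  proof (rule Var_dvd_of_mult_eq[of 1])
    show "Var 1 * (\<sigma> 0 - \<rho>0) $ i = Var 0 * (\<sigma> 1 - \<rho>1) $ i"
      using arg_cong[OF eq, of "\<lambda>v. v $ i"] by (simp only: vector_smult_component)
  qed simp
  then have "\<forall>i. \<exists>w. (\<sigma> 0 - \<rho>0) $ i = Var 0 * w" unfolding dvd_def by blast
  then obtain w where w: "\<And>i. (\<sigma> 0 - \<rho>0) $ i = Var 0 * w i" by metis
  have "\<sigma> 0 - \<rho>0 = Var 0 *s (\<chi> i. w i)"
    unfolding Finite_Cartesian_Product.vec_eq_iff by (simp only: w vector_smult_component vec_lambda_beta simp_thms)
  then have "pair_with g (\<sigma> 0) - pair_with g \<rho>0 = Var 0 * pair_with g (\<chi> i. w i)"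
    unfolding pair_with_diff[symmetric] pair_with_scale[symmetric] by (rule arg_cong)
  then have "Var 0 * h = Var 0 * pair_with g (\<chi> i. w i)" unfolding g0 \<sigma> by simp
  then have "h = pair_with g (\<chi> i. w i)" by (rule mult_left_cancel[THEN iffD1, rotated]) simp
  then show ?thesis by (rule exI)
qed

lemma lookup_linear_form_mult:
  fixes k :: "'a::comm_ring_1 poly3"
  shows "lk ((\<Sum>i\<in>UNIV. Var i * Cst (y i)) * k) t =
    (\<Sum>i\<in>UNIV. if lk t i = 0 then 0 else y i * lk k (t - Poly_Mapping.single i 1))"
proof -
  have "lk (Var i * Cst (y i) * k) t = (if lk t i = 0 then 0 else y i * lk k (t - Poly_Mapping.single i 1))" for i
  proof (cases "lk t i = 0")
    case True
    then show ?thesis unfolding mult.assoc lookup_Var_mult_eq_0[OF True] by simp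
  next
    case False
    have "lk (Var i * (Cst (y i) * k)) (t - Poly_Mapping.single i 1 + Poly_Mapping.single i 1) = y i * lk k (t - Poly_Mapping.single i 1)"
      unfolding lookup_Var_mult lookup_Cst_mult ..
    then show ?thesis unfolding single_1_minus_add[OF False] mult.assoc using False by simp
  qed
  then show ?thesis unfolding sum_distrib_right lookup_sum by simp
qed

text \<open>McCoy's theorem modulo an ideal \<open>J\<close>, for a linear form with coefficients \<open>y\<^sub>i\<close>: the
  multiples \<open>y\<^sub>i k\<close> of a counterexample \<open>k\<close> have fewer coefficients outside \<open>J\<close>.\<close>

lemma mccoy_linear_form:
  fixes J :: "'a::comm_ring_1 set" and k :: "'a poly3"
  assumes J: "0 \<in> J" "\<And>a b. a \<in> J \<Longrightarrow> b \<in> J \<Longrightarrow> a + b \<in> J" "\<And>a b. b \<in> J \<Longrightarrow> a * b \<in> J"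
    and sat: "\<And>c. (\<And>i. y i * c \<in> J) \<Longrightarrow> c \<in> J"
    and "\<And>t. lk ((\<Sum>i\<in>UNIV. Var i * Cst (y i)) * k) t \<in> J"
  shows "lk k t \<in> J"
  using assms(5)
proof (induction "card {t. lk k t \<notin> J}" arbitrary: k t rule: less_induct)
  case less
  note IH = less.hyps and fk = less.prems
  let ?bad = "{t. lk k t \<notin> J}"
  let ?e = "\<lambda>i::3. Poly_Mapping.single i (1::nat)"
  have Jsum: "sum f A \<in> J" if "\<And>a. a \<in> A \<Longrightarrow> f a \<in> J" for f :: "3 \<Rightarrow> 'a" and A
    using that by (induction A rule: infinite_finite_induct) (simp_all add: J)
  have Jdiff: "a \<in> J" if "a + b \<in> J" "b \<in> J" for a b
  proof -
    have "(a + b) + (- 1) * b \<in> J" by (intro J that)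
    then show ?thesis by simp
  qed
  show ?case
  proof (rule ccontr)
    assume "lk k t \<notin> J"
    have "?bad \<subseteq> Poly_Mapping.keys k" using J(1) by (auto simp: in_keys_iff)
    then have fin: "finite ?bad" by (rule finite_subset) simp
    have "t \<in> ?bad" by (rule CollectI) fact
    then have ne: "?bad \<noteq> {}" by (metis empty_iff)
    define T where "T = Max ?bad"
    have T: "lk k T \<notin> J" using Max_in[OF fin ne] unfolding T_def by (rule CollectD)
    have above: "lk k s \<in> J" if "T < s" for s
    proof (rule ccontr)
      assume "lk k s \<notin> J"
      then have "s \<le> T" unfolding T_def by (intro Max_ge fin) blast
      with that show False by simp
    qed
    \<comment> \<open>Largest variables first. In the coefficient at \<open>T + ?e i\<close>, a
      smaller variable meets a coefficient of \<open>k\<close> beyond T, which lies in J, and a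
      larger one is covered by the inner induction. What remains is
      \<open>y i * lk k T\<close>.\<close>
    have "\<forall>s. y i * lk k s \<in> J" for i
    proof (induction "card {j. ?e i < ?e j}" arbitrary: i rule: less_induct)
      case (less i)
      have bigger: "\<forall>s. y j * lk k s \<in> J" if "?e i < ?e j" for j
      proof (rule less.hyps)
        have "{l. ?e j < ?e l} \<subset> {l. ?e i < ?e l}" 
        proof
          show "{l. ?e j < ?e l} \<subseteq> {l. ?e i < ?e l}" using less_trans[OF that] by blast
          show "{l. ?e j < ?e l} \<noteq> {l. ?e i < ?e l}" using that by blast
        qed
        then show "card {l. ?e j < ?e l} < card {l. ?e i < ?e l}" by (intro psubset_card_mono) simp_all
      qed
      let ?c = "\<lambda>j. if lk (T + ?e i) j = 0 then 0 else y j * lk k (T + ?e i - ?e j)"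
      have other: "?c j \<in> J" if "j \<noteq> i" for j
      proof (cases "lk (T + ?e i) j = 0")
        case False
        have ji: "?e j \<noteq> ?e i"
        proof
          assume "?e j = ?e i"
          then have "lk (?e j) j = lk (?e i) j" by (rule arg_cong)
          then show False using lookup_single_not_eq[of i j "1::nat"] that by simp
        qed
        show ?thesis
        proof (cases "?e i < ?e j")
          case True
          then show ?thesis using bigger J(1) by simp
        next
          case not_less: False
          have "?e j < ?e i" using not_less ji by simp
          then have "T + ?e j < T + ?e i" by (rule add_strict_left_mono)
          also have "T + ?e i = T + ?e i - ?e j + ?e j" by (rule single_1_minus_add[OF False, symmetric])
          finally have "T < T + ?e i - ?e j" by (rule add_less_imp_less_right)
          then have "lk k (T + ?e i - ?e j) \<in> J" by (rule above)
          then have "y j * lk k (T + ?e i - ?e j) \<in> J" by (rule J(3))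
          then show ?thesis using J(1) by simp
        qed
      qed (use J(1) in simp)
      have "lk ((\<Sum>i\<in>UNIV. Var i * Cst (y i)) * k) (T + ?e i) = ?c i + (\<Sum>j\<in>UNIV - {i}. ?c j)"
        unfolding lookup_linear_form_mult by (rule sum.remove) simp_all
      then have "?c i + (\<Sum>j\<in>UNIV - {i}. ?c j) \<in> J" using fk[of "T + ?e i"] by (simp only:)
      then have "?c i \<in> J" by (rule Jdiff) (rule Jsum, use other in blast)
      then have yT: "y i * lk k T \<in> J" by (simp add: lookup_add)
      \<comment> \<open>The multiple \<open>y i\<close> of \<open>k\<close> satisfies the same
        hypothesis and has lost the bad coefficient at T, so the outer induction applies.\<close>
      have "lk (Cst (y i) * k) s \<in> J" for s
      proof (rule IH)
        have "{t. lk (Cst (y i) * k) t \<notin> J} \<subset> ?bad"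
        proof
          show "{t. lk (Cst (y i) * k) t \<notin> J} \<subseteq> ?bad" using J(3) by (auto simp: lookup_Cst_mult)
          show "{t. lk (Cst (y i) * k) t \<notin> J} \<noteq> ?bad" using T yT by (auto simp: lookup_Cst_mult)
        qed
        then show "card {t. lk (Cst (y i) * k) t \<notin> J} < card ?bad" by (rule psubset_card_mono[OF fin])
      next
        show "lk ((\<Sum>i\<in>UNIV. Var i * Cst (y i)) * (Cst (y i) * k)) t \<in> J" for t
          unfolding mult.left_commute[of _ "Cst (y i)"] lookup_Cst_mult by (intro J(3) fk)
      qed
      then show ?case by (simp add: lookup_Cst_mult)
    qed
    note yk = this
    have "lk k T \<in> J" by (rule sat, rule yk[THEN spec])
    with T show False by (rule notE)
  qed
qed

section \<open>Clearing denominators over the field of the generic point\<close>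

lemma ratfun_set_fraction:
  assumes "x \<in> ratfun_set"
  shows "\<exists>e q n. homogeneous e q \<and> homogeneous e n \<and> q \<noteq> 0 \<and> x = Fract n (q :: 'k::field poly3)"
  using assms
proof (induction rule: ratfun_set.induct)
  case (const c)
  show ?case
    by (intro exI[of _ 0] exI[of _ "1 :: 'k poly3"] exI[of _ "Cst c"]) simp
next
  case (gen i)
  show ?case
    by (intro exI[of _ 1] exI[of _ "Var 0 :: 'k poly3"] exI[of _ "Var i"]) simp
next
  case (add x y)
  then obtain e q n e' q' n' where *: "homogeneous e q" "homogeneous e n" "q \<noteq> 0" "x = Fract n q"
    "homogeneous e' q'" "homogeneous e' n'" "q' \<noteq> 0" "y = Fract n' q'" by blast
  have "x + y = Fract (n * q' + n' * q) (q * q')" using * by simp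
  moreover have "homogeneous (e + e') (q * q')" "homogeneous (e + e') (n * q')" "homogeneous (e' + e) (n' * q)"
    using * by (auto intro: homogeneous_mult)
  then have "homogeneous (e + e') (q * q')" "homogeneous (e + e') (n * q' + n' * q)"
    by (simp_all only: homogeneous_add add.commute[of e' e])
  moreover have "q * q' \<noteq> 0" using * by simp
  ultimately show ?case by blast
next
  case (uminus x)
  then obtain e q n where *: "homogeneous e q" "homogeneous e n" "q \<noteq> 0" "x = Fract n q" by blast
  then have "- x = Fract (- n) q" by simp
  with * homogeneous_uminus[of e n] show ?case by blast
next
  case (mult x y)
  then obtain e q n e' q' n' where *: "homogeneous e q" "homogeneous e n" "q \<noteq> 0" "x = Fract n q"
    "homogeneous e' q'" "homogeneous e' n'" "q' \<noteq> 0" "y = Fract n' q'" by blast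
  have "x * y = Fract (n * n') (q * q')" using * by simp
  moreover have "homogeneous (e + e') (q * q')" "homogeneous (e + e') (n * n')"
    using * by (auto intro: homogeneous_mult)
  moreover have "q * q' \<noteq> 0" using * by simp
  ultimately show ?case by blast
next
  case (inverse x)
  then obtain e q n where *: "homogeneous e q" "homogeneous e n" "q \<noteq> 0" "x = Fract n q" by blast
  show ?case
  proof (cases "n = 0")
    case True
    then have "x = 0" using * by (simp add: Zero_fract_def eq_fract)
    then have "inverse x = 0" by (simp only: inverse_zero)
    then show ?thesis unfolding Zero_fract_def
      by (intro exI[of _ 0] exI[of _ "1 :: 'k poly3"] exI[of _ 0]) simp
  next
    case False
    have "inverse x = Fract q n" using * by simp
    with * False show ?thesis by blast
  qed
qed

lemma ratfun_fraction:
  fixes x :: "'k::field ratfun"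
  shows "\<exists>e q n. homogeneous e q \<and> homogeneous e n \<and> at_P q \<noteq> 0 \<and> x * at_P q = at_P n"
proof -
  obtain e q n where *: "homogeneous e q" "homogeneous e n" "q \<noteq> 0" "Rep_ratfun x = Fract n (q :: 'k poly3)"
    using ratfun_set_fraction[OF Rep_ratfun[of x]] by blast
  let ?a = "Fract (Var 0) 1 :: 'k poly3 fract"
  have a: "?a ^ e \<noteq> 0" by (rule power_not_zero) (simp add: Fract_eq_0)
  have "?a ^ e * Rep_ratfun (x * at_P q) = Fract n q * Fract q 1"
    unfolding times_ratfun.rep_eq Fract_homogeneous[OF *(1)] *(4) by (simp only: mult.left_commute)
  also have "\<dots> = Fract n 1" using *(3) by (simp add: eq_fract)
  also have "\<dots> = ?a ^ e * Rep_ratfun (at_P n)" by (rule Fract_homogeneous[OF *(2)])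
  finally have "Rep_ratfun (x * at_P q) = Rep_ratfun (at_P n)" by (rule mult_left_cancel[OF a, THEN iffD1])
  then have "x * at_P q = at_P n" by (rule ratfun_eqI)
  moreover have "at_P q \<noteq> 0" using at_P_eq_0_homogeneous[OF *(1)] *(3) by blast
  ultimately show ?thesis using *(1,2) by blast
qed

text \<open>A single degree for all numerators makes the lifted polynomials homogeneous in
  \<open>a\<close>, as required for recovering identities from their values at P.\<close>

lemma common_denominator:
  fixes X :: "'k::field ratfun set"
  assumes "finite X"
  shows "\<exists>e q. homogeneous e q \<and> at_P q \<noteq> 0 \<and> (\<forall>x\<in>X. \<exists>n. homogeneous e n \<and> x * at_P q = at_P n)"
  using assms
proof (induction X rule: finite_induct)
  case empty
  have "homogeneous 0 (1 :: 'k poly3)" "at_P (1 :: 'k poly3) \<noteq> 0" by (simp_all add: eval_simps)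
  then show ?case by blast
next
  case (insert y X)
  from insert.IH obtain e q where eq: "homogeneous e q" "at_P q \<noteq> 0" "\<And>x. x \<in> X \<Longrightarrow> \<exists>n. homogeneous e n \<and> x * at_P q = at_P n"
    by blast
  obtain e' q' n' where y: "homogeneous e' q'" "homogeneous e' n'" "at_P q' \<noteq> 0" "y * at_P q' = at_P n'"
    using ratfun_fraction[of y] by blast
  note P = crh_mult[OF comm_ring_hom_at_P]
  have "\<exists>n. homogeneous (e + e') n \<and> x * at_P (q * q') = at_P n" if x: "x \<in> insert y X" for x
  proof (cases "x = y")
    case True
    have "y * at_P (q * q') = at_P (q * n')" unfolding P y(4)[symmetric] by (simp only: mult.left_commute)
    then show ?thesis using homogeneous_mult[OF eq(1) y(2)] True by blast
  next
    case False
    then obtain n where n: "homogeneous e n" "x * at_P q = at_P n" using eq(3)[of x] x by blast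
    have "x * at_P (q * q') = at_P (n * q')" unfolding P n(2)[symmetric] by (simp only: mult.assoc)
    then show ?thesis using homogeneous_mult[OF n(1) y(1)] by blast
  qed
  moreover have "homogeneous (e + e') (q * q')" by (rule homogeneous_mult[OF eq(1) y(1)])
  moreover have "at_P (q * q') \<noteq> 0" unfolding P using eq(2) y(3) by simp
  ultimately show ?case by blast
qed

lemma lift_form:
  fixes H :: "'k::field ratfun poly3"
  assumes "\<And>t. t \<in> Poly_Mapping.keys H \<Longrightarrow> \<exists>n. homogeneous e n \<and> lk H t * at_P q = at_P n"
  shows "\<exists>H'. (\<forall>t. homogeneous e (lk H' t)) \<and> at_generic H' = Cst (at_P q) * H"
proof -
  obtain n where n: "\<And>t. t \<in> Poly_Mapping.keys H \<Longrightarrow> homogeneous e (n t) \<and> lk H t * at_P q = at_P (n t)"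
    using assms by metis
  define H' where "H' = (\<Sum>t\<in>Poly_Mapping.keys H. Poly_Mapping.single t (n t))"
  have l: "lk H' t = (if t \<in> Poly_Mapping.keys H then n t else 0)" for t
  proof -
    have "lk H' t = (\<Sum>s\<in>Poly_Mapping.keys H. if s = t then n t else 0)"
      unfolding H'_def lookup_sum by (rule sum.cong) (auto simp: lookup_single when_def)
    then show ?thesis by simp
  qed
  have "\<forall>t. homogeneous e (lk H' t)" unfolding l using n by simp
  moreover have "at_generic H' = Cst (at_P q) * H"
  proof (rule poly_mapping_eqI)
    fix t
    show "lk (at_generic H') t = lk (Cst (at_P q) * H) t"
    proof (cases "t \<in> Poly_Mapping.keys H")
      case True
      then show ?thesis using n[OF True] unfolding lookup_at_generic l lookup_Cst_mult by (simp add: mult.commute)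
    next
      case False
      then have "lk H t = 0" by (simp add: in_keys_iff)
      with False show ?thesis unfolding lookup_at_generic l lookup_Cst_mult by (simp add: crh_0[OF comm_ring_hom_at_P])
    qed
  qed
  ultimately show ?thesis by blast
qed

section \<open>Exchanging the two groups of variables\<close>

lemma homogeneous_swap_vars_iff: "homogeneous e (swap_vars G) \<longleftrightarrow> (\<forall>t. homogeneous e (lk (G :: 'k::comm_ring_1 poly3 poly3) t))"
proof -
  have nz: "lk G t \<noteq> 0 \<longleftrightarrow> (\<exists>u. lk (lk G t) u \<noteq> 0)" for G :: "'k poly3 poly3" and t
    by (auto simp: poly_mapping_eq_iff fun_eq_iff)
  show ?thesis unfolding homogeneous_iff[of e "swap_vars G"] nz lookup_swap_vars unfolding homogeneous_iff by blast
qed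

lemma bihomogeneous_iff_swap: "bihomogeneous s d G \<longleftrightarrow> homogeneous d G \<and> homogeneous s (swap_vars (G :: 'k::comm_ring_1 poly3 poly3))"
  unfolding bihomogeneous_def homogeneous_swap_vars_iff ..

lemma swap_vars_swap_vars: "swap_vars (swap_vars G) = (G :: 'k::comm_ring_1 poly3 poly3)"
  by (intro poly_mapping_eqI) (simp only: lookup_swap_vars)

lemma at_generic_eq_0:
  assumes "homogeneous s (swap_vars G)" "at_generic G = 0"
  shows "G = 0"
proof (rule poly_mapping_eqI)
  fix t
  have "at_P (lk G t) = 0" unfolding lookup_at_generic[symmetric] assms(2) by simp
  moreover have "homogeneous s (lk G t)" using assms(1) unfolding homogeneous_swap_vars_iff by (rule spec)
  ultimately have "lk G t = 0" by (intro at_P_eq_0_homogeneous)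
  then show "lk G t = lk 0 t" by simp
qed

lemma swap_vars_Var: "swap_vars (Var i) = Cst (Var i :: 'k::comm_ring_1 poly3)"
  unfolding swap_vars_def
  by (subst eval_hom_Var[OF comm_ring_hom_eval_hom[OF comm_ring_hom_comp[OF comm_ring_hom_Cst comm_ring_hom_Cst]]]) simp

lemma swap_vars_Cst_Var: "swap_vars (Cst (Var i :: 'k::comm_ring_1 poly3)) = Var i"
  using swap_vars_swap_vars[of "Var i"] unfolding swap_vars_Var .

lemma swap_vars_Cst: "swap_vars (Cst p) = Poly_Mapping.map Cst (p :: 'k::comm_ring_1 poly3)"
proof -
  note CC = comm_ring_hom_comp[OF comm_ring_hom_Cst comm_ring_hom_Cst]
  show ?thesis unfolding swap_vars_def eval_hom_Cst[OF comm_ring_hom_eval_hom[OF CC]] map_eq_eval_hom[OF comm_ring_hom_Cst] ..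
qed

lemma at_generic_map_Cst: "at_generic (Poly_Mapping.map Cst p) = Poly_Mapping.map ratfun_const p"
  by (rule poly_mapping_eqI) (simp add: lookup_at_generic lookup_map at_P_Cst crh_0[OF comm_ring_hom_ratfun_const])

lemma at_generic_Cst: "at_generic (Cst p) = Cst (at_P p)"
  unfolding at_generic_eq_map by (rule map_Cst) (rule crh_0[OF comm_ring_hom_at_P])

lemma at_generic_Var: "at_generic (Var i) = Var i"
  unfolding at_generic_eq_map by (rule map_Var) (rule crh_0[OF comm_ring_hom_at_P] crh_1[OF comm_ring_hom_at_P])+

lemma eval_swap_at_generic:
  "eval_hom (eval_hom ratfun_const y) generic_point (swap_vars G) = eval3 y (at_generic G)"
  unfolding eval_swap_vars[OF comm_ring_hom_ratfun_const] eval_at_generic[OF comm_ring_hom_id] ..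

text \<open>The line dual to P; it contains all points
  \<open>cross_prod generic_point x\<close>.\<close>

definition generic_line :: "'k::field ratfun poly3" where
  "generic_line = (\<Sum>i\<in>UNIV. Var i * Cst (generic_point $ i))"

text \<open>After clearing denominators, saturation and McCoy's theorem put the coefficients of \<open>k\<close> in the
  ideal generated by \<open>g\<close>; subtracting a multiple of the equation of the line from \<open>s\<close> leaves syzygies over \<open>K\<close>.\<close>

lemma lift_syzygy:
  fixes g :: "'k::field poly3 ^ 3" and s :: "'k ratfun poly3 ^ 3"
  assumes free: "free_submodule {s. pair_with g s = 0}"
    and s: "pair_with (\<chi> i. Poly_Mapping.map ratfun_const (g $ i)) s = generic_line * k"
  shows "\<exists>q T S. q \<noteq> 0 \<and> finite (T :: (3 \<Rightarrow>\<^sub>0 nat) set) \<and> (\<forall>t. pair_with g (S t) = 0) \<and>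
    (\<forall>y i. (\<Sum>j\<in>UNIV. y $ j * generic_point $ j) = 0 \<longrightarrow>
      q * eval3 y (s $ i) =
      (\<Sum>t\<in>T. (\<Prod>j\<in>UNIV. generic_point $ j ^ lk t j) * eval_hom ratfun_const y (S t $ i)))"
proof -
  note sw = crh_simps[OF comm_ring_hom_swap_vars] and ag = crh_simps[OF comm_ring_hom_at_generic]
    and rc = comm_ring_hom_ratfun_const
  let ?X = "(\<Union>i\<in>UNIV. lk (s $ i) ` Poly_Mapping.keys (s $ i)) \<union> lk k ` Poly_Mapping.keys k"
  obtain e q where q: "homogeneous e q" "at_P q \<noteq> 0" "\<And>x. x \<in> ?X \<Longrightarrow> \<exists>n. homogeneous e n \<and> x * at_P q = at_P n"
    using common_denominator[of ?X] by auto
  have "\<forall>i. \<exists>H'. (\<forall>t. homogeneous e (lk H' t)) \<and> at_generic H' = Cst (at_P q) * s $ i"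
    by (intro allI lift_form q(3)) auto
  then obtain s' where s': "\<And>i t. homogeneous e (lk (s' i) t)" "\<And>i. at_generic (s' i) = Cst (at_P q) * s $ i"
    by metis
  obtain k' where k': "\<forall>t. homogeneous e (lk k' t)" "at_generic k' = Cst (at_P q) * k"
    using lift_form[of k e q] q(3) by blast
  let ?f = "\<Sum>i\<in>UNIV. Var i * Cst (Var i) :: 'k poly3 poly3"
  \<comment> \<open>The factor a_0, which is 1 at P, compensates for the degree in \<open>a\<close>
    of the line equation: both sides then have degree e + 1 and the identity can be lifted from
    P.\<close>
  let ?E = "Cst (Var 0) * (\<Sum>i\<in>UNIV. s' i * Poly_Mapping.map Cst (g $ i)) - ?f * k'"
  have swf: "swap_vars ?f = ?f"
    unfolding sw swap_vars_Var swap_vars_Cst_Var by (simp only: mult.commute)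
  have hs: "homogeneous e (swap_vars (s' i))" for i
    unfolding homogeneous_swap_vars_iff by (rule allI) (rule s'(1))
  have hk: "homogeneous e (swap_vars k')"
    unfolding homogeneous_swap_vars_iff by (rule k'(1))
  have "homogeneous (Suc e) (swap_vars ?E)"
  proof -
    have "homogeneous (1 + (e + 0)) (swap_vars (Cst (Var 0) * (\<Sum>i\<in>UNIV. s' i * Poly_Mapping.map Cst (g $ i))))"
      unfolding sw swap_vars_Cst_Var swap_vars_Cst[symmetric] swap_vars_swap_vars
      by (intro homogeneous_mult homogeneous_sum homogeneous_Var homogeneous_Cst hs)
    moreover have "homogeneous ((1 + 0) + e) (swap_vars (?f * k'))"
      unfolding sw(4) swf
      by (intro homogeneous_mult homogeneous_sum homogeneous_Var homogeneous_Cst hk)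
    ultimately show ?thesis unfolding sw(6) by (intro homogeneous_minus) simp_all
  qed
  moreover have "at_generic ?E = 0"
  proof -
    have "at_generic ?E = Cst (at_P q) * (pair_with (\<chi> i. Poly_Mapping.map ratfun_const (g $ i)) s - generic_line * k)"
      unfolding ag at_generic_Cst at_generic_Var at_generic_map_Cst s' k' at_P_Var generic_point_0 Cst_1 mult_1_left
        pair_with_def generic_line_def right_diff_distrib sum_distrib_left
      by (simp only: mult.assoc mult.left_commute[of "Cst (at_P q)"] vec_lambda_beta)
    then show ?thesis unfolding s by simp
  qed
  ultimately have E: "?E = 0" by (rule at_generic_eq_0)
  let ?k = "swap_vars k'" and ?s = "\<lambda>i. Var 0 * swap_vars (s' i)"
  have sum: "(\<Sum>i\<in>UNIV. ?s i * Cst (g $ i)) = ?f * ?k"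
  proof -
    have "swap_vars ?E = 0" unfolding E by (rule sw)
    then have "Var 0 * (\<Sum>i\<in>UNIV. swap_vars (s' i) * Cst (g $ i)) - ?f * ?k = 0"
      unfolding sw(6) sw(4)[of ?f] swf unfolding sw(3,4,8) swap_vars_Cst_Var swap_vars_Cst[symmetric] swap_vars_swap_vars .
    then show ?thesis unfolding right_minus_eq sum_distrib_left mult.assoc .
  qed
  let ?J = "range (pair_with g)"
  have lk_sum: "lk (\<Sum>i\<in>UNIV. H i * Cst (g $ i)) t = pair_with g (\<chi> i. lk (H i) t)" for H t
    unfolding lookup_sum mult.commute[of _ "Cst (g $ _)"] lookup_Cst_mult pair_with_def by (simp only: mult.commute vec_lambda_beta)
  have kJ: "lk ?k t \<in> ?J" for t
  proof (rule mccoy_linear_form[where y = "\<lambda>i. Var i"])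
    show "0 \<in> ?J" by (rule range_eqI[of _ _ 0]) simp
    show "a + b \<in> ?J" if ab: "a \<in> ?J" "b \<in> ?J" for a b
    proof -
      obtain u v where "a = pair_with g u" "b = pair_with g v" using ab by blast
      then show ?thesis by (intro range_eqI[of _ _ "u + v"]) (simp only: pair_with_add)
    qed
    show "a * b \<in> ?J" if b: "b \<in> ?J" for a b
    proof -
      obtain v where "b = pair_with g v" using b by blast
      then show ?thesis by (intro range_eqI[of _ _ "a *s v"]) (simp only: pair_with_scale)
    qed
    show "c \<in> ?J" if c: "\<And>i. Var i * c \<in> ?J" for c
    proof -
      have "\<exists>s. c = pair_with g s"
        by (rule free_syzygies_saturated[OF free]) (use c in blast)
      then show ?thesis by blast
    qed
    show "lk (?f * ?k) t \<in> ?J" for t unfolding sum[symmetric] lk_sum by (rule rangeI)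
  qed
  then have "\<forall>t. \<exists>u. lk ?k t = pair_with g u" by blast
  then obtain \<tau> where \<tau>: "\<And>t. lk ?k t = pair_with g (\<tau> t)" by metis
  define \<tau>' where "\<tau>' i = (\<Sum>t\<in>Poly_Mapping.keys ?k. Poly_Mapping.single t (\<tau> t $ i))" for i
  have \<tau>k: "(\<Sum>i\<in>UNIV. \<tau>' i * Cst (g $ i)) = ?k"
  proof (rule poly_mapping_eqI)
    fix t
    have "lk (\<tau>' i) t = (if t \<in> Poly_Mapping.keys ?k then \<tau> t $ i else 0)" for i
    proof -
      have "lk (\<tau>' i) t = (\<Sum>u\<in>Poly_Mapping.keys ?k. if u = t then \<tau> t $ i else 0)"
        unfolding \<tau>'_def lookup_sum by (rule sum.cong) (auto simp: lookup_single when_def)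
      then show ?thesis by simp
    qed
    then have "lk (\<Sum>i\<in>UNIV. \<tau>' i * Cst (g $ i)) t = pair_with g (\<chi> i. if t \<in> Poly_Mapping.keys ?k then \<tau> t $ i else 0)"
      unfolding lk_sum by simp
    also have "\<dots> = lk ?k t"
    proof (cases "t \<in> Poly_Mapping.keys ?k")
      case True
      then show ?thesis unfolding \<tau> by simp
    next
      case False
      then show ?thesis by (simp add: in_keys_iff pair_with_def)
    qed
    finally show "lk (\<Sum>i\<in>UNIV. \<tau>' i * Cst (g $ i)) t = lk ?k t" .
  qed
  let ?r = "\<lambda>i. ?s i - ?f * \<tau>' i"
  have r0: "(\<Sum>i\<in>UNIV. ?r i * Cst (g $ i)) = 0"
    unfolding left_diff_distrib sum_subtractf mult.assoc[of ?f] sum_distrib_left[symmetric] \<tau>k sum by simp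
  let ?T = "\<Union>i\<in>UNIV. Poly_Mapping.keys (?r i)"
  let ?S = "\<lambda>t. \<chi> i. lk (?r i) t"
  have fin: "finite ?T" by simp
  have syz: "pair_with g (?S t) = 0" for t unfolding lk_sum[symmetric] r0 by simp
  have ev: "at_P q * eval3 y (s $ i) =
      (\<Sum>t\<in>?T. (\<Prod>j\<in>UNIV. generic_point $ j ^ lk t j) * eval_hom ratfun_const y (?S t $ i))"
    if y: "(\<Sum>j\<in>UNIV. y $ j * generic_point $ j) = 0" for y i
  proof -
    let ?h = "eval_hom (eval_hom ratfun_const y) generic_point"
    have e: "comm_ring_hom (eval_hom ratfun_const y)" using rc by simp
    note h = crh_simps[OF comm_ring_hom_eval_hom[OF e]]
    \<comment> \<open>On the dual line of P the subtracted multiple of \<open>?f\<close> is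
      invisible, so the syzygies have the same values as the original field up to the
      denominator.\<close>
    have hf: "?h ?f = 0"
      unfolding h eval_hom_Var[OF e] eval_hom_Cst[OF e] eval_hom_Var[OF rc] using y by (simp only: mult.commute)
    have "?h (?r i) = at_P q * eval3 y (s $ i)"
      unfolding h(6) h(4) hf eval_swap_at_generic s'(2) eval_hom_Var[OF e] generic_point_0
      by (simp add: eval_simps)
    moreover have "?h (?r i) = (\<Sum>t\<in>?T. eval_hom ratfun_const y (lk (?r i) t) * (\<Prod>j\<in>UNIV. generic_point $ j ^ lk t j))"
      by (rule eval_hom_superset[where h = "eval_hom ratfun_const y", OF crh_0[OF e]]) (simp, blast)
    ultimately show ?thesis by (simp only: mult.commute vec_lambda_beta)
  qed
  show ?thesis
    by (intro exI[of _ "at_P q"] exI[of _ ?T] exI[of _ ?S] conjI allI impI) (rule q(2) fin syz ev, assumption?)+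
qed

section \<open>Forms defined by vector fields\<close>

definition cross_prod :: "'a::comm_ring_1 ^ 3 \<Rightarrow> 'a ^ 3 \<Rightarrow> 'a ^ 3" where
  "cross_prod v w = vec3 (v $ 1 * w $ 2 - v $ 2 * w $ 1) (v $ 2 * w $ 0 - v $ 0 * w $ 2) (v $ 0 * w $ 1 - v $ 1 * w $ 0)"

lemma cross_prod_nth [simp]:
  "cross_prod v w $ 0 = v $ 1 * w $ 2 - v $ 2 * w $ 1"
  "cross_prod v w $ 1 = v $ 2 * w $ 0 - v $ 0 * w $ 2"
  "cross_prod v w $ 2 = v $ 0 * w $ 1 - v $ 1 * w $ 0"
  by (simp_all add: cross_prod_def)

lemma vec3_eqI: "v $ 0 = w $ 0 \<Longrightarrow> v $ 1 = w $ 1 \<Longrightarrow> v $ 2 = w $ 2 \<Longrightarrow> v = (w :: 'a ^ 3)"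
  unfolding Finite_Cartesian_Product.vec_eq_iff all_3 by blast

lemma cross_prod_hom:
  assumes "comm_ring_hom h"
  shows "(\<chi> i. h (cross_prod v w $ i)) = cross_prod (\<chi> i. h (v $ i)) (\<chi> i. h (w $ i))"
  by (rule vec3_eqI) (simp_all add: crh_minus[OF assms] crh_mult[OF assms])

lemma cross_prod_self: "cross_prod v v = 0"
  by (rule vec3_eqI) (simp_all add: mult.commute)

lemma cross_prod_orthogonal_left: "(\<Sum>i\<in>UNIV. cross_prod v w $ i * v $ i) = 0"
  by (simp add: sum_UNIV_3 algebra_simps)

lemma cross_prod_orthogonal_right: "(\<Sum>i\<in>UNIV. cross_prod v w $ i * w $ i) = 0"
  by (simp add: sum_UNIV_3 algebra_simps)

lemma homogeneous_subst:
  assumes "homogeneous d p" "\<And>i. homogeneous 1 (Y $ i)" "\<And>c. homogeneous 0 (h c)"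
  shows "homogeneous d (eval_hom h Y p :: 'a::comm_ring_1 poly3)"
  unfolding eval_hom_def
proof (rule homogeneous_sum)
  fix t assume "t \<in> Poly_Mapping.keys p"
  then have d: "d = 0 + (\<Sum>i\<in>UNIV. lk t i * 1)"
    using assms(1) by (simp add: homogeneous_def mdeg_def)
  show "homogeneous d (h (lk p t) * (\<Prod>i\<in>UNIV. Y $ i ^ lk t i))"
    unfolding d by (intro homogeneous_mult homogeneous_prod homogeneous_power assms) simp
qed

text \<open>\<open>\<Phi>(a,x) = S(a \<times> x) \<sqdot> x\<close>\<close>

definition duality_form :: "'k::comm_ring_1 poly3 ^ 3 \<Rightarrow> 'k poly3 poly3" where
  "duality_form S = (\<Sum>i\<in>UNIV. eval_hom (\<lambda>c. Cst (Cst c)) (cross_prod (\<chi> j. Cst (Var j)) (\<chi> j. Var j)) (S $ i) * Var i)"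

lemma comm_ring_hom_Cst_Cst [simp]: "comm_ring_hom (\<lambda>c. Cst (Cst c))"
  by (rule comm_ring_hom_comp[OF comm_ring_hom_Cst comm_ring_hom_Cst])

lemma hom_duality_form:
  assumes g: "comm_ring_hom g"
  shows "g (duality_form S) = (\<Sum>i\<in>UNIV. eval_hom (\<lambda>c. g (Cst (Cst c)))
    (cross_prod (\<chi> j. g (Cst (Var j))) (\<chi> j. g (Var j))) (S $ i) * g (Var i))"
  unfolding duality_form_def crh_sum[OF g] crh_mult[OF g] eval_hom_comp[OF g comm_ring_hom_Cst_Cst] cross_prod_hom[OF g]
  by simp

lemma eval_duality_form:
  assumes h: "comm_ring_hom h"
  shows "eval_hom (eval_hom h v) w (duality_form S) = (\<Sum>i\<in>UNIV. eval_hom h (cross_prod v w) (S $ i) * w $ i)"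
proof -
  have e: "comm_ring_hom (eval_hom h v)" using h by simp
  have v: "(\<chi> j. eval_hom (eval_hom h v) w (Cst (Var j))) = v"
    unfolding eval_hom_Cst[OF e] eval_hom_Var[OF h] by simp
  have w: "(\<chi> j. eval_hom (eval_hom h v) w (Var j)) = w"
    unfolding eval_hom_Var[OF e] by simp
  have c: "(\<lambda>c. eval_hom (eval_hom h v) w (Cst (Cst c))) = h"
    by (rule ext) (simp only: eval_hom_Cst[OF e] eval_hom_Cst[OF h])
  show ?thesis
    unfolding hom_duality_form[OF comm_ring_hom_eval_hom[OF e]] v w c eval_hom_Var[OF e] by simp
qed

lemma swap_vars_Cst_Cst: "swap_vars (Cst (Cst c)) = Cst (Cst (c :: 'k::comm_ring_1))"
  unfolding swap_vars_Cst by (rule map_Cst) simp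

lemma swap_duality_form:
  "swap_vars (duality_form S) = (\<Sum>i\<in>UNIV. eval_hom (\<lambda>c. Cst (Cst c)) (cross_prod (\<chi> j. Var j) (\<chi> j. Cst (Var j))) (S $ i) * Cst (Var i))"
  unfolding hom_duality_form[OF comm_ring_hom_swap_vars] swap_vars_Cst_Var swap_vars_Var swap_vars_Cst_Cst ..

lemma homogeneous_cross_prod:
  assumes "\<And>i. homogeneous a (v $ i)" "\<And>i. homogeneous b (w $ i)"
  shows "homogeneous (a + b) (cross_prod v w $ i :: 'a::comm_ring_1 poly3)"
proof -
  have w: "homogeneous (a + b) (v $ i * w $ j)" for i j by (rule homogeneous_mult[OF assms])
  have "\<forall>i. homogeneous (a + b) (cross_prod v w $ i)"
    unfolding all_3 cross_prod_nth by (intro conjI homogeneous_minus w)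
  then show ?thesis by (rule spec)
qed

text \<open>The cross product has degree one in each group of variables; \<open>S\<close> raises
  this to \<open>m\<close>, and the final factor adds one in \<open>x\<close> only.\<close>

lemma bihomogeneous_duality_form:
  assumes S: "\<And>i. homogeneous m (S $ i)"
  shows "bihomogeneous m (m + 1) (duality_form S)"
  unfolding bihomogeneous_iff_swap
proof
  have "homogeneous 1 (cross_prod (\<chi> j. Cst (Var j)) (\<chi> j. Var j) $ i :: 'a poly3 poly3)" for i
    using homogeneous_cross_prod[of 0 "\<chi> j. Cst (Var j)" 1 "\<chi> j. Var j"] by simp
  then show "homogeneous (m + 1) (duality_form S)"
    unfolding duality_form_def
    by (intro homogeneous_sum homogeneous_mult homogeneous_Var homogeneous_subst S) simp_all
  have Y: "homogeneous 1 (cross_prod (\<chi> j. Var j) (\<chi> j. Cst (Var j)) $ i :: 'a poly3 poly3)" for i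
    using homogeneous_cross_prod[of 1 "\<chi> j. Var j" 0 "\<chi> j. Cst (Var j)"] by simp
  have "homogeneous (m + 0) (swap_vars (duality_form S))"
    unfolding swap_duality_form
    by (intro homogeneous_sum homogeneous_mult homogeneous_Cst homogeneous_subst S Y)
  then show "homogeneous m (swap_vars (duality_form S))" by simp
qed

lemma at_generic_Cst_Var: "at_generic (Cst (Var i)) = Cst (generic_point $ i)"
  unfolding at_generic_Cst at_P_Var ..

lemma vanishing_ideal_cross_prod:
  "cross_prod (\<chi> j. Cst (v $ j)) (\<chi> j. Var j) $ i \<in> vanishing_ideal {v :: 'a::comm_ring_1 ^ 3}"
  "cross_prod (\<chi> j. Var j) (\<chi> j. Cst (v $ j)) $ i \<in> vanishing_ideal {v}"
proof -
  note id = comm_ring_hom_eval_hom[OF comm_ring_hom_id]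
  have z: "eval3 v (cross_prod (\<chi> j. Cst (v $ j)) (\<chi> j. Var j) $ i) = 0" "eval3 v (cross_prod (\<chi> j. Var j) (\<chi> j. Cst (v $ j)) $ i) = 0"
  proof -
    have 1: "(\<chi> i. eval3 v (cross_prod (\<chi> j. Cst (v $ j)) (\<chi> j. Var j) $ i)) = 0"
      and 2: "(\<chi> i. eval3 v (cross_prod (\<chi> j. Var j) (\<chi> j. Cst (v $ j)) $ i)) = 0"
      unfolding cross_prod_hom[OF id] by (simp_all add: eval_simps cross_prod_self)
    from arg_cong[OF 1, of "\<lambda>v. v $ i"] show "eval3 v (cross_prod (\<chi> j. Cst (v $ j)) (\<chi> j. Var j) $ i) = 0"
      by (simp only: vec_lambda_beta zero_index)
    from arg_cong[OF 2, of "\<lambda>v. v $ i"] show "eval3 v (cross_prod (\<chi> j. Var j) (\<chi> j. Cst (v $ j)) $ i) = 0"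
      by (simp only: vec_lambda_beta zero_index)
  qed
  have "homogeneous (0 + 1) (cross_prod (\<chi> j. Cst (v $ j)) (\<chi> j. Var j) $ i)"
    by (rule homogeneous_cross_prod) simp_all
  then show "cross_prod (\<chi> j. Cst (v $ j)) (\<chi> j. Var j) $ i \<in> vanishing_ideal {v}"
    by (rule vanishing_idealI) (use z in simp)
  have "homogeneous (1 + 0) (cross_prod (\<chi> j. Var j) (\<chi> j. Cst (v $ j)) $ i)"
    by (rule homogeneous_cross_prod) simp_all
  then show "cross_prod (\<chi> j. Var j) (\<chi> j. Cst (v $ j)) $ i \<in> vanishing_ideal {v}"
    by (rule vanishing_idealI) (use z in simp)
qed

lemma ideal_power_sum: "(\<And>a. a \<in> A \<Longrightarrow> f a \<in> ideal_power I n) \<Longrightarrow> sum f A \<in> ideal_power I n"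
  by (induction A rule: infinite_finite_induct) (simp_all add: ideal_power_zero ideal_power_add)

text \<open>The form is a combination of polynomials of degree \<open>m\<close> in the entries of a
  \<times> x, and these vanish where a = x, whichever group of variables is specialised.\<close>

lemma at_generic_duality_form:
  assumes S: "\<And>i. homogeneous m (S $ i)"
  shows "at_generic (duality_form S) \<in> ideal_power (vanishing_ideal {generic_point}) m"
    and "at_generic (swap_vars (duality_form S)) \<in> ideal_power (vanishing_ideal {generic_point}) m"
proof -
  note ag = comm_ring_hom_at_generic
  show "at_generic (duality_form S) \<in> ideal_power (vanishing_ideal {generic_point}) m"
    unfolding hom_duality_form[OF ag] at_generic_Cst_Var at_generic_Var mult.commute[of _ "Var _"]
    by (intro ideal_power_sum ideal_power_scale eval_hom_in_ideal_power S vanishing_ideal_cross_prod)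
  show "at_generic (swap_vars (duality_form S)) \<in> ideal_power (vanishing_ideal {generic_point}) m"
    unfolding swap_duality_form crh_sum[OF ag] crh_mult[OF ag] eval_hom_comp[OF ag comm_ring_hom_Cst_Cst]
      cross_prod_hom[OF ag] mult.commute[of _ "at_generic (Cst _)"]
    by (simp add: at_generic_Cst_Var at_generic_Var)
      (intro ideal_power_sum ideal_power_scale eval_hom_in_ideal_power S vanishing_ideal_cross_prod)
qed

lemma eval_at_generic_duality_form:
  "eval3 x (at_generic (duality_form S)) = (\<Sum>i\<in>UNIV. eval_hom ratfun_const (cross_prod generic_point x) (S $ i) * x $ i)"
  unfolding eval_at_generic[OF comm_ring_hom_id] by (rule eval_duality_form[OF comm_ring_hom_ratfun_const])

lemma duality_form_translate:
  fixes S :: "'k::comm_ring_1 poly3 ^ 3"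
  shows "eval_hom (eval3 (v + s *s w)) w (duality_form S) = eval_hom (eval3 v) w (duality_form S)"
proof -
  have "cross_prod (v + s *s w) w = cross_prod v w"
    by (rule vec3_eqI) (simp_all add: algebra_simps)
  then show ?thesis unfolding eval_duality_form[OF comm_ring_hom_id] by (simp only:)
qed

definition linear_form :: "'a::comm_ring_1 ^ 3 \<Rightarrow> 'a poly3" where
  "linear_form v = (\<Sum>i\<in>UNIV. Cst (v $ i) * Var i)"

lemma eval_linear_form: "eval3 x (linear_form v) = (\<Sum>i\<in>UNIV. v $ i * x $ i)"
  unfolding linear_form_def by (simp add: eval_simps)

text \<open>The point y = v \<times> u is common to both lines. Modulo their equations x_k is
  congruent to (x_j / y_j) y_k, so H(x) is congruent to a multiple of H(y) = 0.\<close>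

lemma homogeneous_vanishing_at_cross_prod:
  fixes v u :: "'a::field_char_0 ^ 3"
  assumes H: "homogeneous d H" and j: "cross_prod v u $ j \<noteq> 0" and 0: "eval3 (cross_prod v u) H = 0"
  shows "\<exists>a b. H = a * linear_form v + b * linear_form u"
proof -
  let ?y = "cross_prod v u" and ?I = "ideal.span {linear_form v, linear_form u}"
  note id = comm_ring_hom_id
  have comb: "a * linear_form v + b * linear_form u \<in> ?I" for a b
    by (intro ideal.span_add ideal.span_scale ideal.span_base) simp_all
  have p: "Cst (?y $ i) * Var k - Cst (?y $ k) * Var i \<in> ?I" if "(i, k) \<in> {(1, 2), (2, 0), (0, 1)}" for i k
  proof -
    \<comment> \<open>The coefficients come from (v \<times> u) \<times> x = (v \<sqdot> x) u - (u
      \<sqdot> x) v.\<close>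
    have "\<exists>a b. Cst (?y $ i) * Var k - Cst (?y $ k) * Var i = Cst a * linear_form v + Cst b * linear_form u"
    proof -
      have i1: "Cst (?y $ 1) * Var 2 - Cst (?y $ 2) * Var 1 = Cst (u $ 0) * linear_form v + Cst (- v $ 0) * linear_form u"
        by (rule poly3_eqI) (simp add: eval_simps eval_linear_form sum_UNIV_3 algebra_simps)
      have i2: "Cst (?y $ 2) * Var 0 - Cst (?y $ 0) * Var 2 = Cst (u $ 1) * linear_form v + Cst (- v $ 1) * linear_form u"
        by (rule poly3_eqI) (simp add: eval_simps eval_linear_form sum_UNIV_3 algebra_simps)
      have i3: "Cst (?y $ 0) * Var 1 - Cst (?y $ 1) * Var 0 = Cst (u $ 2) * linear_form v + Cst (- v $ 2) * linear_form u"
        by (rule poly3_eqI) (simp add: eval_simps eval_linear_form sum_UNIV_3 algebra_simps)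
      from that consider "i = 1" "k = 2" | "i = 2" "k = 0" | "i = 0" "k = 1" by auto
      then show ?thesis
      proof cases
        case 1
        show ?thesis unfolding 1 by (rule exI, rule exI, rule i1)
      next
        case 2
        show ?thesis unfolding 2 by (rule exI, rule exI, rule i2)
      next
        case 3
        show ?thesis unfolding 3 by (rule exI, rule exI, rule i3)
      qed
    qed
    then show ?thesis using comb by metis
  qed
  have q: "Cst (?y $ k) * Var i - Cst (?y $ i) * Var k \<in> ?I" if "(i, k) \<in> {(1, 2), (2, 0), (0, 1)}" for i k
    using ideal.span_neg[OF p[OF that]] by (simp only: minus_diff_eq)
  have z: "Cst (?y $ k) * Var k - Cst (?y $ k) * Var k \<in> ?I" for k
    unfolding diff_self by (rule ideal.span_zero)
  have "\<forall>i k. Cst (?y $ i) * Var k - Cst (?y $ k) * Var i \<in> ?I"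
    unfolding all_3 by (intro conjI z; (rule p q; simp))
  then have all: "Cst (?y $ j) * Var k - Cst (?y $ k) * Var j \<in> ?I" for k by blast
  let ?c = "inverse (?y $ j)"
  let ?v = "(\<chi> i. Var i) :: 'a poly3 ^ 3" and ?w = "(Cst ?c * Var j) *s (\<chi> i. Cst (?y $ i)) :: 'a poly3 ^ 3"
  have "eval_hom Cst ?v H - eval_hom Cst ?w H \<in> ?I"
  proof (rule eval_cong_mod[OF _ comm_ring_hom_Cst])
    fix k
    have "Cst ?c * (Cst (?y $ j) * Var k - Cst (?y $ k) * Var j) \<in> ?I" by (rule ideal.span_scale[OF all])
    moreover have "Cst ?c * (Cst (?y $ j) * Var k - Cst (?y $ k) * Var j) = ?v $ k - ?w $ k"
    proof -
      have "Cst ?c * Cst (?y $ j) = (1 :: 'a poly3)" using j by (simp add: crh_mult[OF comm_ring_hom_Cst, symmetric])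
      then have "Cst ?c * (Cst (?y $ j) * Var k) = Var k" by (simp only: mult.assoc[symmetric] mult_1_left)
      then show ?thesis unfolding right_diff_distrib by (simp add: mult_ac)
    qed
    ultimately show "?v $ k - ?w $ k \<in> ?I" by (simp only:)
  qed
  moreover have "eval_hom Cst ?w H = 0"
  proof -
    have "eval_hom Cst (\<chi> i. Cst (?y $ i)) H = Cst (eval3 ?y H)"
      by (rule eval_hom_comp[OF comm_ring_hom_Cst id, symmetric])
    then show ?thesis unfolding eval_hom_homogeneous_scale[OF comm_ring_hom_Cst H] 0 by simp
  qed
  ultimately have "H \<in> ?I" by simp
  then show ?thesis
  proof (induction rule: span_ideal_induct)
    case (base p)
    then consider "p = linear_form v" | "p = linear_form u" by blast
    then show ?case
    proof cases
      case 1
      then have "p = 1 * linear_form v + 0 * linear_form u" by simp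
      then show ?thesis by (intro exI)
    next
      case 2
      then have "p = 0 * linear_form v + 1 * linear_form u" by simp
      then show ?thesis by (intro exI)
    qed
  next
    case zero
    have "0 = 0 * linear_form v + 0 * linear_form u" by simp
    then show ?case by (intro exI)
  next
    case (add p q)
    then obtain a b a' b' where "p = a * linear_form v + b * linear_form u" "q = a' * linear_form v + b' * linear_form u"
      by (elim exE)
    then have "p + q = (a + a') * linear_form v + (b + b') * linear_form u" by (simp add: distrib_right)
    then show ?case by (intro exI)
  next
    case (scale c p)
    then obtain a b where "p = a * linear_form v + b * linear_form u" by (elim exE)
    then have "c * p = (c * a) * linear_form v + (c * b) * linear_form u" by (simp add: distrib_left mult.assoc)
    then show ?case by (intro exI)
  qed
qed

text \<open>Write \<open>F(x) = x\<^sub>0 F\<^sub>1(x') + F(x')\<close> with \<open>x' = x - x\<^sub>0 P\<close>, a function of \<open>P \<times> x\<close>, and expand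
  \<open>F(x')\<close> by Euler's identity.\<close>

lemma ex_vector_field:
  fixes F :: "'k::field_char_0 ratfun poly3"
  assumes F: "homogeneous (Suc m) F" "F \<in> ideal_power (vanishing_ideal {generic_point}) m"
  shows "\<exists>\<sigma>. (\<forall>i. homogeneous m (\<sigma> $ i)) \<and>
    (\<forall>x. (\<Sum>i\<in>UNIV. eval3 (cross_prod generic_point x) (\<sigma> $ i) * x $ i) = eval3 x F)"
proof -
  note id = comm_ring_hom_id
  let ?P = "generic_point :: 'k ratfun ^ 3"
  \<comment> \<open>Substituting y = P \<times> x into (0, y_2, -y_1) recovers x' = x - x_0
    P.\<close>
  let ?w = "vec3 0 (Var 2) (- Var 1) :: 'k ratfun poly3 ^ 3"
  let ?E = "eval_hom Cst ?w"
  define c where "c = (inverse (of_nat (Suc m)) :: 'k ratfun)"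
  have c: "c * of_nat (Suc m) = 1" unfolding c_def by (rule left_inverse) (simp only: of_nat_eq_0_iff nat.distinct not_False_eq_True)
  let ?g = "\<lambda>i. Cst c * ?E (pd i F)"
  \<comment> \<open>In the pairing with x the corrections in the first entry turn x_1 and x_2 into
    x'_1 and x'_2, as Euler's identity at x' requires; x'_0 is 0.\<close>
  let ?\<sigma> = "vec3 (?E (dir_deriv ?P F) - Cst (?P $ 1) * ?g 1 - Cst (?P $ 2) * ?g 2) (?g 1) (?g 2)"
  have ev: "eval3 (cross_prod ?P x) (?E q) = eval3 (x + (- x $ 0) *s ?P) q" for x q
  proof -
    have "eval3 (cross_prod ?P x) (?E q) = eval_hom (\<lambda>c. eval3 (cross_prod ?P x) (Cst c)) (\<chi> i. eval3 (cross_prod ?P x) (?w $ i)) q"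
      by (rule eval_hom_comp[OF comm_ring_hom_eval_hom[OF id] comm_ring_hom_Cst])
    also have "(\<lambda>c. eval3 (cross_prod ?P x) (Cst c)) = (\<lambda>c. c)" by (simp add: eval_hom_Cst)
    also have "(\<chi> i. eval3 (cross_prod ?P x) (?w $ i)) = x + (- x $ 0) *s ?P"
      by (rule vec3_eqI) (simp_all add: eval_simps mult.commute)
    finally show ?thesis .
  qed
  have hE: "homogeneous m (?E q)" if "homogeneous m q" for q
  proof (rule homogeneous_subst[OF that])
    have "\<forall>i. homogeneous 1 (?w $ i)"
      unfolding all_3 vec3_nth by (intro conjI homogeneous_0 homogeneous_Var homogeneous_uminus)
    then show "homogeneous 1 (?w $ i)" for i by (rule spec)
  qed simp
  have hg: "homogeneous m (?g i)" for i by (intro homogeneous_Cst_mult hE homogeneous_pd F(1))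
  have "\<forall>i. homogeneous m (?\<sigma> $ i)"
    unfolding all_3 vec3_nth by (intro conjI homogeneous_minus homogeneous_Cst_mult[OF hg] hg hE homogeneous_dir_deriv F(1))
  moreover have "(\<Sum>i\<in>UNIV. eval3 (cross_prod ?P x) (?\<sigma> $ i) * x $ i) = eval3 x F" for x
  proof -
    let ?x = "x + (- x $ 0) *s ?P"
    have x: "?x $ 0 = 0" "?x $ 1 = x $ 1 - x $ 0 * ?P $ 1" "?x $ 2 = x $ 2 - x $ 0 * ?P $ 2" by simp_all
    have g: "eval3 (cross_prod ?P x) (?g i) = c * eval3 ?x (pd i F)" for i
      by (simp only: eval_simps id ev)
    have euler: "?x $ 1 * eval3 ?x (pd 1 F) + ?x $ 2 * eval3 ?x (pd 2 F) = of_nat (Suc m) * eval3 ?x F"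
    proof -
      have "eval3 ?x (\<Sum>i\<in>UNIV. Var i * pd i F) = eval3 ?x (Cst (of_nat (Suc m)) * F)"
        unfolding euler_identity[OF F(1)] ..
      then show ?thesis by (simp only: eval_simps id sum_UNIV_3 x(1) mult_zero_left add_0_left)
    qed
    have "(\<Sum>i\<in>UNIV. eval3 (cross_prod ?P x) (?\<sigma> $ i) * x $ i) =
        (eval3 ?x (dir_deriv ?P F) - ?P $ 1 * (c * eval3 ?x (pd 1 F)) - ?P $ 2 * (c * eval3 ?x (pd 2 F))) * x $ 0
        + (c * eval3 ?x (pd 1 F)) * x $ 1 + (c * eval3 ?x (pd 2 F)) * x $ 2"
      unfolding sum_UNIV_3 vec3_nth crh_minus[OF comm_ring_hom_eval_hom[OF id]] g
      by (simp only: eval_simps id ev g)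
    also have "\<dots> = x $ 0 * eval3 ?x (dir_deriv ?P F) + c * (?x $ 1 * eval3 ?x (pd 1 F) + ?x $ 2 * eval3 ?x (pd 2 F))"
      unfolding x by (simp add: algebra_simps)
    also have "\<dots> = x $ 0 * eval3 ?x (dir_deriv ?P F) + (c * of_nat (Suc m)) * eval3 ?x F"
      unfolding euler mult.assoc ..
    also have "\<dots> = eval3 (?x + x $ 0 *s ?P) F"
      unfolding c eval_translate[OF F] by simp
    also have "?x + x $ 0 *s ?P = x" by (rule vec3_eqI) simp_all
    finally show ?thesis .
  qed
  ultimately show ?thesis by (intro exI[of _ ?\<sigma>] conjI allI) blast+
qed

section \<open>The arrangement dual to the points\<close>

abbreviation line_form :: "'k::field proj2 \<Rightarrow> 'k ratfun poly3" where
  "line_form p \<equiv> linear_form (const_point p)"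

lemma map_arrangement_form:
  "Poly_Mapping.map ratfun_const (arrangement_form Z) = (\<Prod>p\<in>Z. line_form p)"
proof -
  note rc = comm_ring_hom_ratfun_const
  have "Poly_Mapping.map ratfun_const (dual_line p) = line_form p" for p :: "'a proj2"
    unfolding dual_line_def linear_form_def crh_sum[OF comm_ring_hom_map[OF rc]] crh_mult[OF comm_ring_hom_map[OF rc]]
      map_Cst[where h = ratfun_const, OF crh_0[OF rc]] map_Var[where h = ratfun_const, OF crh_0[OF rc] crh_1[OF rc]]
    by (simp add: const_point_def)
  then show ?thesis unfolding arrangement_form_def crh_prod[OF comm_ring_hom_map[OF rc]] by simp
qed

lemma pd_arrangement_form:
  fixes Z :: "'k::field_char_0 proj2 set"
  assumes "finite Z"
  shows "Poly_Mapping.map ratfun_const (pd i (arrangement_form Z)) =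
    (\<Sum>p\<in>Z. Cst (const_point p $ i) * (\<Prod>q\<in>Z - {p}. line_form q))"
proof -
  have "pd i (line_form p) = Cst (const_point p $ i)" for p :: "'k proj2"
    unfolding linear_form_def by (rule pd_linear_form)
  then show ?thesis
    unfolding pd_map[OF comm_ring_hom_ratfun_const, symmetric] map_arrangement_form pd_prod[OF assms] by simp
qed

lemma homogeneous_linear_form: "homogeneous 1 (linear_form v)"
  unfolding linear_form_def by (intro homogeneous_sum homogeneous_Cst_mult homogeneous_Var)

lemma homogeneous_arrangement_form:
  assumes "finite Z"
  shows "homogeneous (card Z) (arrangement_form Z)"
proof -
  have "homogeneous (\<Sum>p\<in>Z. 1) (arrangement_form Z)"
    unfolding arrangement_form_def dual_line_def
    by (rule homogeneous_prod[OF assms]) (intro homogeneous_sum homogeneous_Cst_mult homogeneous_Var)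
  then show ?thesis by simp
qed

text \<open>Both sides are the determinant of P, \<open>x\<close> and \<open>z\<close>, the right
  one in the coordinates of the pencil.\<close>

lemma eval_line_form_cross:
  "eval3 (cross_prod generic_point x) (linear_form z) =
    (x $ 1 - x $ 0 * generic_point $ 1) * offset z - (z $ 1 - z $ 0 * generic_point $ 1) * offset x"
  unfolding eval_linear_form offset_def sum_UNIV_3 cross_prod_nth generic_point_0 by (simp add: algebra_simps)

text \<open>Constant points collinear with P have the same slope, and slopes separate constant
  points.\<close>

lemma eval_line_form_cross_const_point:
  "eval3 (cross_prod generic_point (const_point p)) (line_form q) = 0 \<longleftrightarrow> p = q"
proof
  assume "eval3 (cross_prod generic_point (const_point p)) (line_form q) = 0"
  then have "slope (const_point p) = slope (const_point q)"
    unfolding eval_line_form_cross slope_def using offset_const_point[of p] offset_const_point[of q]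
    by (simp add: frac_eq_eq)
  then show "p = q" by (rule inj_slope_const_point)
next
  assume "p = q"
  then show "eval3 (cross_prod generic_point (const_point p)) (line_form q) = 0"
    unfolding eval_line_form_cross by simp
qed

lemma cross_prod_const_point_nonzero: "\<exists>j. cross_prod generic_point (const_point p) $ j \<noteq> 0"
proof (rule ccontr)
  assume "\<not> (\<exists>j. cross_prod generic_point (const_point p) $ j \<noteq> 0)"
  then have "cross_prod generic_point (const_point p) $ j = 0" for j by blast
  from this[of 1] this[of 2] have "offset (const_point p) = 0"
    unfolding offset_def cross_prod_nth generic_point_0 by (simp add: algebra_simps)
  then show False using offset_const_point[of p] by (rule notE[rotated])
qed

text \<open>The point P \<times> p lies on the line dual to \<open>p\<close> and on no other line of
  the arrangement. By the product rule the gradient there is a nonzero multiple of \<open>p\<close>,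
  to which the syzygy is orthogonal.\<close>

lemma syzygy_vanishes_on_points:
  fixes Z :: "'k::field_char_0 proj2 set"
  assumes Z: "finite Z" "p \<in> Z" and S: "pair_with (\<chi> i. pd i (arrangement_form Z)) S = 0"
  shows "(\<Sum>i\<in>UNIV. eval_hom ratfun_const (cross_prod generic_point (const_point p)) (S $ i) * const_point p $ i) = 0"
proof -
  note id = comm_ring_hom_id and rc = comm_ring_hom_ratfun_const
  let ?y = "cross_prod generic_point (const_point p)"
  let ?e = "eval_hom ratfun_const ?y"
  note e = crh_simps[OF comm_ring_hom_eval_hom[OF rc]] and ei = crh_simps[OF comm_ring_hom_eval_hom[OF id]]
  let ?D = "\<Prod>r\<in>Z - {p}. eval3 ?y (line_form r)"
  have D: "?D \<noteq> 0" using Z(1) by (simp add: eval_line_form_cross_const_point)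
  have g: "?e (pd i (arrangement_form Z)) = const_point p $ i * ?D" for i
  proof -
    have "?e (pd i (arrangement_form Z)) = eval3 ?y (Poly_Mapping.map ratfun_const (pd i (arrangement_form Z)))"
      by (rule eval_hom_map[OF id rc, symmetric])
    also have "\<dots> = (\<Sum>q\<in>Z. const_point q $ i * (\<Prod>r\<in>Z - {q}. eval3 ?y (line_form r)))"
      unfolding pd_arrangement_form[OF Z(1)] ei eval_hom_Cst[OF id] ..
    also have "\<dots> = (\<Sum>q\<in>{p}. const_point q $ i * (\<Prod>r\<in>Z - {q}. eval3 ?y (line_form r)))"
    proof (rule sum.mono_neutral_right[OF Z(1)])
      show "\<forall>q\<in>Z - {p}. const_point q $ i * (\<Prod>r\<in>Z - {q}. eval3 ?y (line_form r)) = 0"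
      proof
        fix q assume "q \<in> Z - {p}"
        then have "p \<in> Z - {q}" using Z(2) by blast
        then have "(\<Prod>r\<in>Z - {q}. eval3 ?y (line_form r)) = 0"
          using Z(1) eval_line_form_cross_const_point[of p p] by (intro prod_zero) auto
        then show "const_point q $ i * (\<Prod>r\<in>Z - {q}. eval3 ?y (line_form r)) = 0" by simp
      qed
    qed (use Z(2) in simp)
    finally show ?thesis by simp
  qed
  have "?e (pair_with (\<chi> i. pd i (arrangement_form Z)) S) = 0" unfolding S by (rule e)
  then have "(\<Sum>i\<in>UNIV. ?e (S $ i) * const_point p $ i) * ?D = 0"
    by (simp only: pair_with_def e g vec_lambda_beta sum_distrib_right mult.assoc)
  with D show ?thesis by (simp only: mult_eq_0_iff simp_thms)
qed

lemma pair_with_hcomp: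
  assumes "\<And>i. homogeneous n (g $ i)" "pair_with g S = 0"
  shows "pair_with g (\<chi> i. hcomp m (S $ i)) = 0"
proof -
  have "hcomp (m + n) (pair_with g S) = pair_with g (\<chi> i. hcomp m (S $ i))"
    unfolding pair_with_def hcomp_sum mult.commute[of "S $ _"] hcomp_mult_homogeneous[OF assms(1)]
    by (simp add: mult.commute)
  then show ?thesis unfolding assms(2) by simp
qed

lemma hcomp_eval_hom:
  assumes h: "comm_ring_hom h" "\<And>c. homogeneous 0 (h c)" and Y: "\<And>i. homogeneous 1 (Y $ i)"
  shows "hcomp d (eval_hom h Y p) = eval_hom h Y (hcomp d p)"
proof (induction p rule: poly3_additive_induct)
  case (1 t c)
  have s: "homogeneous (mdeg t) (Poly_Mapping.single t c)" by (rule homogeneous_single) (rule refl)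
  have e: "homogeneous (mdeg t) (eval_hom h Y (Poly_Mapping.single t c))"
    by (rule homogeneous_subst[OF s Y h(2)])
  show ?case unfolding hcomp_homogeneous[OF s] hcomp_homogeneous[OF e]
    by (simp add: crh_0[OF comm_ring_hom_eval_hom[OF h(1)]])
next
  case (2 p q)
  then show ?case by (simp only: hcomp_add eval_hom_add[OF h(1)])
qed

lemma hcomp_at_generic_duality_form:
  "hcomp (m + 1) (at_generic (duality_form S)) = at_generic (duality_form (\<chi> i. hcomp m (S $ i)))"
proof -
  note ag = comm_ring_hom_at_generic
  have h: "(\<lambda>c. at_generic (Cst (Cst c))) = (\<lambda>c. Cst (ratfun_const c))"
    by (rule ext) (simp only: at_generic_Cst at_P_Cst)
  have Y: "homogeneous 1 (cross_prod (\<chi> j. Cst (generic_point $ j)) (\<chi> j. Var j) $ i)" for i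
    using homogeneous_cross_prod[of 0 "\<chi> j. Cst (generic_point $ j)" 1 "\<chi> j. Var j"] by simp
  show ?thesis
    unfolding hom_duality_form[OF ag] h at_generic_Cst_Var at_generic_Var hcomp_sum mult.commute[of _ "Var _"]
      hcomp_mult_homogeneous[OF homogeneous_Var]
      hcomp_eval_hom[OF comm_ring_hom_Cst_comp[OF comm_ring_hom_ratfun_const] homogeneous_Cst Y]
    by (simp add: hcomp_eval_hom[OF comm_ring_hom_Cst_comp[OF comm_ring_hom_ratfun_const] homogeneous_Cst Y])
qed

lemma duality_form_in_fat_system:
  fixes Z :: "'k::field_char_0 proj2 set"
  assumes Z: "finite Z" and hom: "\<And>i. homogeneous m (S $ i)"
    and S: "pair_with (\<chi> i. pd i (arrangement_form Z)) S = 0"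
  shows "at_generic (duality_form S) \<in> fat_system Z (m + 1) m"
proof (rule fat_systemI)
  show "homogeneous (m + 1) (at_generic (duality_form S))"
    by (rule homogeneous_at_generic[OF bihomogeneous_duality_form[OF hom]])
  show "at_generic (duality_form S) \<in> ideal_power (vanishing_ideal {generic_point}) m"
    by (rule at_generic_duality_form(1)[OF hom])
  show "eval3 (const_point p) (at_generic (duality_form S)) = 0" if "p \<in> Z" for p
    unfolding eval_at_generic_duality_form by (rule syzygy_vanishes_on_points[OF Z that S])
qed

text \<open>Vanishing of \<open>F\<close> at \<open>p\<close> means that \<sigma> \<sqdot> p
  vanishes at P \<times> p, the intersection of the lines dual to P and \<open>p\<close>, so it is a
  combination of their equations. Weighted with the other lines and summed over \<open>Z\<close>,
  this puts \<sigma> applied to \<Lambda> in the ideal of the dual line of P and \<Lambda>; Euler's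
  identity removes the multiple of \<Lambda>.\<close>

lemma ex_syzygy_on_generic_line:
  fixes Z :: "'k::field_char_0 proj2 set"
  assumes Z: "finite Z" and F: "F \<in> fat_system Z (m + 1) m"
  shows "\<exists>s k. pair_with (\<chi> i. Poly_Mapping.map ratfun_const (pd i (arrangement_form Z))) s = generic_line * k \<and>
    (\<forall>x. (\<Sum>i\<in>UNIV. eval3 (cross_prod generic_point x) (s $ i) * x $ i) = eval3 x F)"
proof -
  note id = comm_ring_hom_id
  let ?P = "generic_point :: 'k ratfun ^ 3"
  let ?g = "\<chi> i. Poly_Mapping.map ratfun_const (pd i (arrangement_form Z))"
  let ?R = "\<lambda>p. \<Prod>q\<in>Z - {p}. line_form q" and ?L = "\<Prod>q\<in>Z. line_form q"
  have F': "homogeneous (Suc m) F" "F \<in> ideal_power (vanishing_ideal {?P}) m"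
    using fat_systemD[OF F] by simp_all
  obtain \<sigma> where \<sigma>: "\<forall>i. homogeneous m (\<sigma> $ i)"
    "\<forall>x. (\<Sum>i\<in>UNIV. eval3 (cross_prod ?P x) (\<sigma> $ i) * x $ i) = eval3 x F"
    using ex_vector_field[OF F'] by (elim exE conjE)
  let ?H = "\<lambda>p. \<Sum>i\<in>UNIV. \<sigma> $ i * Cst (const_point p $ i)"
  have "\<forall>p\<in>Z. \<exists>a b. ?H p = a * linear_form ?P + b * line_form p"
  proof
    fix p assume p: "p \<in> Z"
    obtain j where j: "cross_prod ?P (const_point p) $ j \<noteq> 0" using cross_prod_const_point_nonzero by blast
    have "homogeneous (m + 0) (?H p)" by (intro homogeneous_sum homogeneous_mult \<sigma>(1)[rule_format] homogeneous_Cst)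
    then have h: "homogeneous m (?H p)" by simp
    have "eval3 (cross_prod ?P (const_point p)) (?H p) = eval3 (const_point p) F"
      unfolding \<sigma>(2)[rule_format, symmetric] by (simp only: eval_simps id)
    also have "\<dots> = 0" by (rule fat_systemD(3)[OF F p])
    finally show "\<exists>a b. ?H p = a * linear_form ?P + b * line_form p"
      by (rule homogeneous_vanishing_at_cross_prod[OF h j])
  qed
  from bchoice[OF this] obtain a where "\<forall>p\<in>Z. \<exists>b. ?H p = a p * linear_form ?P + b * line_form p" by (elim exE)
  from bchoice[OF this] obtain b where "\<forall>p\<in>Z. ?H p = a p * linear_form ?P + b p * line_form p" by (elim exE)
  note ab = this[rule_format]
  define A where "A = (\<Sum>p\<in>Z. a p * ?R p)"
  define B where "B = (\<Sum>p\<in>Z. b p)"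
  have pair: "pair_with ?g \<sigma> = linear_form ?P * A + ?L * B"
  proof -
    have "pair_with ?g \<sigma> = (\<Sum>i\<in>UNIV. \<Sum>p\<in>Z. \<sigma> $ i * Cst (const_point p $ i) * ?R p)"
      unfolding pair_with_def vec_lambda_beta pd_arrangement_form[OF Z] sum_distrib_left mult.assoc ..
    also have "\<dots> = (\<Sum>p\<in>Z. ?H p * ?R p)"
      unfolding sum_distrib_right by (rule sum.swap)
    also have "\<dots> = (\<Sum>p\<in>Z. linear_form ?P * (a p * ?R p) + ?L * b p)"
    proof (rule sum.cong[OF refl])
      fix p assume p: "p \<in> Z"
      have L: "?L = line_form p * ?R p" by (rule prod.remove[OF Z p])
      show "?H p * ?R p = linear_form ?P * (a p * ?R p) + ?L * b p"
        unfolding ab[OF p] L distrib_right by (simp only: mult_ac)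
    qed
    finally show ?thesis unfolding A_def B_def sum.distrib sum_distrib_left .
  qed
  let ?n = "of_nat (card Z) :: 'k ratfun" and ?v = "(\<chi> i. Var i) :: 'k ratfun poly3 ^ 3"
  define c where "c = Cst (inverse ?n) * B"
  have euler: "pair_with ?g ?v = Cst ?n * ?L"
  proof -
    have "homogeneous (\<Sum>p\<in>Z. 1) ?L"
      by (rule homogeneous_prod[OF Z]) (rule homogeneous_linear_form)
    then have h: "homogeneous (card Z) ?L" by simp
    show ?thesis
      unfolding pair_with_def vec_lambda_beta pd_map[OF comm_ring_hom_ratfun_const, symmetric] map_arrangement_form
      by (rule euler_identity[OF h])
  qed
  \<comment> \<open>For empty \<open>Z\<close> the inverse of 0 is 0, and then \<open>B\<close> is
    an empty sum.\<close>
  have cn: "c * (Cst ?n * ?L) = ?L * B"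
  proof (cases "card Z = 0")
    case True
    then have "B = 0" unfolding B_def using Z by simp
    then show ?thesis unfolding c_def by simp
  next
    case False
    then have "inverse ?n * ?n = 1" by (intro left_inverse) (simp only: of_nat_eq_0_iff not_False_eq_True)
    then have "Cst (inverse ?n) * Cst ?n = (1 :: 'k ratfun poly3)"
      unfolding crh_mult[OF comm_ring_hom_Cst, symmetric] by simp
    moreover have "c * (Cst ?n * ?L) = (Cst (inverse ?n) * Cst ?n) * (?L * B)"
      unfolding c_def by (simp only: mult_ac)
    ultimately show ?thesis by simp
  qed
  let ?s = "\<sigma> - c *s ?v"
  have "generic_line = linear_form ?P"
    unfolding generic_line_def linear_form_def by (simp only: mult.commute)
  then have "pair_with ?g ?s = generic_line * A"
    unfolding pair_with_diff pair_with_scale pair euler cn by simp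
  moreover have "(\<Sum>i\<in>UNIV. eval3 (cross_prod ?P x) (?s $ i) * x $ i) = eval3 x F" for x
  proof -
    let ?y = "cross_prod ?P x"
    \<comment> \<open>The correction contributes a multiple of (P \<times> x) \<sqdot> x =
      0.\<close>
    have "(\<Sum>i\<in>UNIV. eval3 ?y (?s $ i) * x $ i) =
        (\<Sum>i\<in>UNIV. eval3 ?y (\<sigma> $ i) * x $ i) - eval3 ?y c * (\<Sum>i\<in>UNIV. ?y $ i * x $ i)"
      unfolding sum_distrib_left sum_subtractf[symmetric]
      by (rule sum.cong[OF refl])
        (simp only: vector_minus_component vector_smult_component vec_lambda_beta eval_simps id left_diff_distrib mult.assoc)
    then show ?thesis unfolding cross_prod_orthogonal_right \<sigma>(2)[rule_format] by simp
  qed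
  ultimately show ?thesis by (intro exI[of _ ?s] exI[of _ A] conjI allI)
qed

theorem unexpected_form_duality:
  fixes F :: "'k::field_char_0 ratfun poly3"
  assumes Z: "finite Z" and adm: "admits_unexpected Z (m + 1) m"
    and F: "F \<in> fat_system Z (m + 1) m" "irreducible F" and free: "free_arrangement Z"
  shows "\<exists>S c. (\<forall>i. homogeneous m (S $ i)) \<and> c \<noteq> 0 \<and> F = Cst c * at_generic (duality_form S)"
proof -
  note id = comm_ring_hom_id
  let ?P = "generic_point :: 'k ratfun ^ 3"
  let ?g = "(\<chi> i. pd i (arrangement_form Z)) :: 'k poly3 ^ 3"
  have fr: "free_submodule {s. pair_with ?g s = 0}"
    using free unfolding free_arrangement_def jacobian_syzygies_def pair_with_def vec_lambda_beta .
  obtain s k where s: "pair_with (\<chi> i. Poly_Mapping.map ratfun_const (pd i (arrangement_form Z))) s = generic_line * k"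
    "\<forall>x. (\<Sum>i\<in>UNIV. eval3 (cross_prod ?P x) (s $ i) * x $ i) = eval3 x F"
    using ex_syzygy_on_generic_line[OF Z F(1)] by (elim exE conjE)
  have "pair_with (\<chi> i. Poly_Mapping.map ratfun_const (?g $ i)) s = generic_line * k"
    unfolding vec_lambda_beta by (rule s(1))
  from lift_syzygy[OF fr this] obtain q T S where q: "q \<noteq> 0" and T: "finite (T :: (3 \<Rightarrow>\<^sub>0 nat) set)"
    and S: "\<forall>t. pair_with ?g (S t) = 0"
    and ev: "\<forall>y i. (\<Sum>j\<in>UNIV. y $ j * ?P $ j) = 0 \<longrightarrow> q * eval3 y (s $ i) =
      (\<Sum>t\<in>T. (\<Prod>j\<in>UNIV. ?P $ j ^ lk t j) * eval_hom ratfun_const y (S t $ i))"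
    by (elim exE conjE)
  let ?p = "\<lambda>t. \<Prod>j\<in>UNIV. ?P $ j ^ lk t j"
  let ?S = "\<lambda>t. \<chi> i. hcomp m (S t $ i)"
  let ?B = "\<lambda>t. at_generic (duality_form (?S t))"
  have "Cst q * F = (\<Sum>t\<in>T. Cst (?p t) * at_generic (duality_form (S t)))"
  proof (rule poly3_eqI)
    fix x
    let ?y = "cross_prod ?P x"
    have "eval3 x (Cst q * F) = (\<Sum>i\<in>UNIV. (q * eval3 ?y (s $ i)) * x $ i)"
      unfolding mult.assoc sum_distrib_left[symmetric] s(2)[rule_format] by (simp only: eval_simps id)
    also have "\<dots> = (\<Sum>i\<in>UNIV. \<Sum>t\<in>T. ?p t * (eval_hom ratfun_const ?y (S t $ i) * x $ i))"
      unfolding ev[rule_format, OF cross_prod_orthogonal_left] sum_distrib_right mult.assoc ..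
    also have "\<dots> = (\<Sum>t\<in>T. ?p t * (\<Sum>i\<in>UNIV. eval_hom ratfun_const ?y (S t $ i) * x $ i))"
      unfolding sum_distrib_left by (rule sum.swap)
    also have "\<dots> = eval3 x (\<Sum>t\<in>T. Cst (?p t) * at_generic (duality_form (S t)))"
      unfolding eval_at_generic_duality_form[symmetric] by (simp only: eval_simps id)
    finally show "eval3 x (Cst q * F) = eval3 x (\<Sum>t\<in>T. Cst (?p t) * at_generic (duality_form (S t)))" .
  qed
  \<comment> \<open>The lifted syzygies need not be homogeneous. Their components of degree
    \<open>m\<close> are exactly what contributes to degree \<open>m + 1\<close>.\<close>
  then have "hcomp (m + 1) (Cst q * F) = hcomp (m + 1) (\<Sum>t\<in>T. Cst (?p t) * at_generic (duality_form (S t)))"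
    by (rule arg_cong)
  then have sum: "Cst q * F = (\<Sum>t\<in>T. Cst (?p t) * ?B t)"
    unfolding hcomp_sum hcomp_mult_homogeneous[OF homogeneous_Cst] hcomp_homogeneous[OF fat_systemD(1)[OF F(1)]]
      diff_zero hcomp_at_generic_duality_form by simp
  \<comment> \<open>For empty \<open>Z\<close> the truncated degree does no harm: the arrangement
    form is 1 and its derivatives are 0.\<close>
  have "homogeneous (card Z - 1) (?g $ i)" for i
  proof (cases "card Z")
    case 0
    then have "Z = {}" using Z by simp
    then show ?thesis by (simp add: arrangement_form_def pd_1)
  next
    case (Suc n)
    have "homogeneous (Suc n) (arrangement_form Z)" using homogeneous_arrangement_form[OF Z] Suc by simp
    then show ?thesis using Suc by (simp add: homogeneous_pd)
  qed
  then have "pair_with ?g (?S t) = 0" for t by (rule pair_with_hcomp) (rule S[rule_format])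
  then have "?B t \<in> fat_system Z (m + 1) m" for t
    by (intro duality_form_in_fat_system[OF Z]) simp_all
  then have "\<forall>t. \<exists>c. ?B t = Cst c * F" using unexpected_form_unique[OF Z adm F] by blast
  from choice[OF this] obtain c where "\<forall>t. ?B t = Cst (c t) * F" by (elim exE)
  note c = this[rule_format]
  have "F \<noteq> 0" using F(2) by (auto simp: irreducible_def)
  then have "Cst q * F \<noteq> 0" using q by simp
  then have nz: "(\<Sum>t\<in>T. Cst (?p t) * (Cst (c t) * F)) \<noteq> 0" unfolding sum c .
  \<comment> \<open>Every summand is a multiple of \<open>F\<close>, and their combination is a
    nonzero multiple of it, so one syzygy alone represents \<open>F\<close>.\<close>
  have "\<exists>t. c t \<noteq> 0"
  proof (rule ccontr)
    assume "\<not> (\<exists>t. c t \<noteq> 0)"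
    then have "\<And>t. c t = 0" by blast
    with nz show False by simp
  qed
  then obtain t where t: "c t \<noteq> 0" by (elim exE)
  have "Cst (inverse (c t)) * ?B t = (Cst (inverse (c t)) * Cst (c t)) * F" unfolding c by (simp only: mult.assoc)
  also have "Cst (inverse (c t)) * Cst (c t) = (1 :: 'k ratfun poly3)"
    using t by (simp add: crh_mult[OF comm_ring_hom_Cst, symmetric])
  finally have "F = Cst (inverse (c t)) * ?B t" by simp
  moreover have "\<forall>i. homogeneous m (?S t $ i)" by simp
  moreover have "inverse (c t) \<noteq> 0" using t by simp
  ultimately show ?thesis by (intro exI[of _ "?S t"] exI[of _ "inverse (c t)"] conjI)
qed

section \<open>The form \<open>F\<^sup>*\<close>\<close>

text \<open>\<open>S(a \<times> x) \<sqdot> x\<close> is constant along \<open>a + s x\<close>, a nonconstant form in \<open>a\<close> is not.\<close>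

lemma duality_form_no_factor:
  fixes S :: "'k::field_char_0 poly3 ^ 3"
  assumes nz: "duality_form S \<noteq> 0" and A: "homogeneous e A" and d: "Cst A dvd duality_form S"
  shows "e = 0"
proof -
  obtain \<Psi> where \<Psi>: "duality_form S = Cst A * \<Psi>" using d by (elim dvdE)
  have A0: "A \<noteq> 0" using nz \<Psi> by auto
  let ?E = "\<lambda>v w. eval_hom (eval3 v) w :: 'k poly3 poly3 \<Rightarrow> 'k"
  have id: "comm_ring_hom (eval3 v)" for v :: "'k ^ 3" by simp
  note E = comm_ring_hom_eval_hom[OF id]
  \<comment> \<open>After the swap, \<open>A\<close> is read in the variables x. This allows a
    choice of \<open>v\<close> and \<open>w\<close> at which the duality form and A(w) are both
    nonzero; A(w) is the top coefficient along v + s w.\<close>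
  have "swap_vars (Cst A) \<noteq> 0"
  proof
    assume "swap_vars (Cst A) = 0"
    then have "swap_vars (swap_vars (Cst A)) = 0" by (simp only: crh_0[OF comm_ring_hom_swap_vars])
    then show False using A0 by (simp add: swap_vars_swap_vars)
  qed
  with nz have "duality_form S * swap_vars (Cst A) \<noteq> 0" by simp
  then obtain v w where "?E v w (duality_form S * swap_vars (Cst A)) \<noteq> ?E v w 0"
    using poly3_poly3_eqI[of "duality_form S * swap_vars (Cst A)" 0] by auto
  then have k: "?E v w (duality_form S) \<noteq> 0" and w: "eval3 w A \<noteq> 0"
    unfolding crh_mult[OF E] crh_0[OF E] eval_swap_vars[OF comm_ring_hom_id] eval_hom_Cst[OF id] by simp_all
  define L where "L = line_poly (\<lambda>c. c) v w A"
  define M where "M = line_poly (\<lambda>c. c) v w (Poly_Mapping.map (eval3 w) (swap_vars \<Psi>))"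
  \<comment> \<open>The product is constant in s by translation invariance and nonzero, so its
    factor \<open>L\<close> has degree 0.\<close>
  have "poly (L * M) s = poly [:?E v w (duality_form S):] s" for s
  proof -
    have "poly M s = ?E (v + s *s w) w \<Psi>"
      unfolding M_def poly_line_poly[OF comm_ring_hom_id] eval_hom_map[OF comm_ring_hom_id id] eval_swap_vars[OF comm_ring_hom_id] ..
    moreover have "poly L s = ?E (v + s *s w) w (Cst A)"
      unfolding L_def poly_line_poly[OF comm_ring_hom_id] eval_hom_Cst[OF id] ..
    ultimately have "poly (L * M) s = ?E (v + s *s w) w (duality_form S)"
      unfolding poly_mult \<Psi> crh_mult[OF E] by (simp only:)
    then show ?thesis unfolding duality_form_translate by simp
  qed
  then have "poly (L * M) = poly [:?E v w (duality_form S):]" by (rule ext)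
  then have LM: "L * M = [:?E v w (duality_form S):]" by (simp only: poly_eq_poly_eq_iff)
  then have "L \<noteq> 0" "M \<noteq> 0" using k by auto
  then have "degree L = 0" using arg_cong[OF LM, of degree] by (simp add: degree_mult_eq)
  moreover have "coeff L e = eval3 w A"
    unfolding L_def by (rule coeff_line_poly_top[OF comm_ring_hom_id A])
  then have "e \<le> degree L" using w by (intro le_degree) simp
  ultimately show ?thesis by simp
qed

text \<open>Descent: a common non-unit factor is a form of positive degree, and cancelling it lowers
  the degree of the numerator.\<close>

lemma coprime_homogeneous_fraction:
  fixes p q :: "'k::field poly3"
  assumes "homogeneous d p" "homogeneous e q" "p \<noteq> 0" "q \<noteq> 0"
  shows "\<exists>i j p' q'. homogeneous i p' \<and> homogeneous j q' \<and> p' \<noteq> 0 \<and> q' \<noteq> 0 \<and> p * q' = p' * q \<and>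
    (\<forall>D. D dvd p' \<longrightarrow> D dvd q' \<longrightarrow> D dvd 1)"
  using assms
proof (induction d arbitrary: e p q rule: less_induct)
  case (less d)
  show ?case
  proof (cases "\<forall>D. D dvd p \<longrightarrow> D dvd q \<longrightarrow> D dvd 1")
    case True
    then show ?thesis
      by (intro exI[of _ d] exI[of _ e] exI[of _ p] exI[of _ q] conjI less.prems refl)
  next
    case False
    then obtain D where D: "D dvd p" "D dvd q" "\<not> D dvd 1" by auto
    then obtain a b where ab: "p = D * a" "q = D * b" by (elim dvdE)
    have nz: "D \<noteq> 0" "a \<noteq> 0" "b \<noteq> 0" using less.prems(3,4) unfolding ab by simp_all
    obtain f g where fg: "homogeneous f D" "homogeneous g a" "f + g = d"
      using less.prems(1,3) unfolding ab(1) by (rule homogeneous_factors)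
    obtain f' h where h: "homogeneous h b"
      using less.prems(2,4) unfolding ab(2) by (rule homogeneous_factors)
    have "f \<noteq> 0"
    proof
      assume "f = 0"
      then have "homogeneous 0 D" using fg(1) by (simp only:)
      from homogeneous_0_unit[OF this nz(1)] D(3) show False by (rule notE[rotated])
    qed
    then have "g < d" using fg(3) by linarith
    from less.IH[OF this fg(2) h nz(2,3)] obtain i j p' q' where
      *: "homogeneous i p'" "homogeneous j q'" "p' \<noteq> 0" "q' \<noteq> 0" "a * q' = p' * b"
        "\<forall>D. D dvd p' \<longrightarrow> D dvd q' \<longrightarrow> D dvd 1"
      by (elim exE conjE)
    have "p * q' = p' * q" unfolding ab mult.assoc *(5) by (rule mult.left_commute)
    with * show ?thesis
      by (intro exI[of _ i] exI[of _ j] exI[of _ p'] exI[of _ q'] conjI)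
  qed
qed

lemma Cst_dvdI:
  fixes G :: "'a::comm_ring_1 poly3"
  assumes "\<And>t. c dvd lk G t"
  shows "Cst c dvd G"
proof -
  have "Cst c dvd Poly_Mapping.single t (lk G t)" for t
  proof -
    obtain b where "lk G t = c * b" using assms[of t] by (elim dvdE)
    then have "Poly_Mapping.single t (lk G t) = Cst c * Poly_Mapping.single t b"
      by (simp add: Cst_def mult_single)
    then show ?thesis by (rule dvdI)
  qed
  then have "Cst c dvd (\<Sum>t\<in>Poly_Mapping.keys G. Poly_Mapping.single t (lk G t))"
    by (intro dvd_sum)
  then show ?thesis by (simp only: poly_mapping_sum_single[symmetric])
qed

text \<open>The last condition of \<open>is_star\<close>; a factor of bi-degree (e,0) is a constant
  in \<open>x\<close> and is written as such.\<close>

definition primitive_form :: "'k::field poly3 poly3 \<Rightarrow> bool" where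
  "primitive_form G \<longleftrightarrow> (\<forall>e A. homogeneous e A \<longrightarrow> Cst A dvd G \<longrightarrow> e = 0)"

lemma primitive_form_iff:
  "primitive_form G \<longleftrightarrow> (\<forall>e A. e > 0 \<longrightarrow> bihomogeneous e 0 A \<longrightarrow> \<not> A dvd G)"
proof
  assume *: "primitive_form G"
  show "\<forall>e A. e > 0 \<longrightarrow> bihomogeneous e 0 A \<longrightarrow> \<not> A dvd G"
  proof (intro allI impI notI)
    fix e A assume e: "e > 0" and A: "bihomogeneous e 0 A" "A dvd G"
    have "homogeneous 0 A" "homogeneous e (lk A 0)" using A(1) unfolding bihomogeneous_def by simp_all
    then have "Cst (lk A 0) dvd G" using homogeneous_degree_0[of A] A(2) by simp
    with * \<open>homogeneous e (lk A 0)\<close> have "e = 0" unfolding primitive_form_def by (elim allE impE)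
    with e show False by simp
  qed
next
  assume *: "\<forall>e A. e > 0 \<longrightarrow> bihomogeneous e 0 A \<longrightarrow> \<not> A dvd G"
  show "primitive_form G" unfolding primitive_form_def
  proof (intro allI impI)
    fix e A assume A: "homogeneous e A" "Cst A dvd G"
    have "bihomogeneous e 0 (Cst A)" unfolding bihomogeneous_def
      using A(1) by (auto simp: Cst_def lookup_single when_def homogeneous_single)
    then show "e = 0" using * A(2) by (cases "e = 0") simp_all
  qed
qed

text \<open>As in the lemma of Gauss: a prime factor of \<open>p\<close> does not divide
  \<open>q\<close>, so it divides every coefficient of \<open>H\<close>, against
  primitivity.\<close>

lemma unit_of_primitive:
  fixes p q :: "'k::field poly3"
  assumes pq: "homogeneous d p" "p \<noteq> 0" "\<And>D. D dvd p \<Longrightarrow> D dvd q \<Longrightarrow> D dvd 1"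
    and eq: "Cst p * G = Cst q * H" and H: "primitive_form H"
  shows "\<exists>c. c \<noteq> 0 \<and> p = Cst c"
proof -
  have "p dvd 1"
  proof (rule ccontr)
    assume "\<not> p dvd 1"
    from ex_prime_factor_homogeneous[OF pq(1,2) this] obtain \<pi> where \<pi>: "prime_elem \<pi>" "\<pi> dvd p"
      by (elim exE conjE)
    have nu: "\<not> \<pi> dvd 1" using \<pi>(1) unfolding prime_elem_def by (elim conjE)
    then have nq: "\<not> \<pi> dvd q" using pq(3)[OF \<pi>(2)] by (rule contrapos_nn)
    have "\<pi> dvd lk H t" for t
    proof -
      have "p * lk G t = q * lk H t" using arg_cong[OF eq, of "\<lambda>F. lk F t"] unfolding lookup_Cst_mult .
      then have "\<pi> dvd q * lk H t" using dvd_mult2[OF \<pi>(2), of "lk G t"] by (simp only:)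
      then have "\<pi> dvd q \<or> \<pi> dvd lk H t" by (rule prime_elem_dvd_multD[OF \<pi>(1)])
      with nq show ?thesis by simp
    qed
    then have d: "Cst \<pi> dvd H" by (rule Cst_dvdI)
    obtain a where a: "p = \<pi> * a" using \<pi>(2) by (elim dvdE)
    obtain e f where e: "homogeneous e \<pi>" using pq(1,2) unfolding a by (rule homogeneous_factors)
    with d H have "e = 0" unfolding primitive_form_def by (elim allE impE)
    with e have "homogeneous 0 \<pi>" by (simp only:)
    moreover have "\<pi> \<noteq> 0" using pq(2) a by auto
    ultimately have "\<pi> dvd 1" by (rule homogeneous_0_unit)
    with nu show False by (rule notE)
  qed
  from homogeneous_unit[OF pq(1) this] have "homogeneous 0 p" using pq(1) by (simp only:)
  then have "p = Cst (lk p 0)" by (rule homogeneous_degree_0)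
  then show ?thesis using pq(2) by (intro exI[of _ "lk p 0"]) auto
qed

text \<open>Reduce the ratio of \<open>p\<close> and \<open>q\<close> to lowest terms. Primitivity
  of \<open>H\<close> makes the numerator constant, that of \<open>G\<close> the
  denominator.\<close>

lemma primitive_form_unique:
  fixes p q :: "'k::field poly3"
  assumes pq: "homogeneous d p" "homogeneous e q" "p \<noteq> 0" "q \<noteq> 0"
    and eq: "Cst p * G = Cst q * H" and GH: "primitive_form G" "primitive_form H"
  shows "\<exists>c. c \<noteq> 0 \<and> G = Cst (Cst c) * H"
proof -
  note C = crh_mult[OF comm_ring_hom_Cst]
  obtain i j p' q' where
    *: "homogeneous i p'" "homogeneous j q'" "p' \<noteq> 0" "q' \<noteq> 0" "p * q' = p' * q"
      "\<forall>D. D dvd p' \<longrightarrow> D dvd q' \<longrightarrow> D dvd 1"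
    using coprime_homogeneous_fraction[OF pq] by (elim exE conjE)
  have "Cst q * (Cst p' * G) = Cst (p' * q) * G" unfolding C by (simp only: mult_ac)
  also have "\<dots> = Cst q' * (Cst p * G)" unfolding *(5)[symmetric] C by (simp only: mult_ac)
  also have "\<dots> = Cst q * (Cst q' * H)" unfolding eq by (simp only: mult_ac)
  finally have eq': "Cst p' * G = Cst q' * H" using pq(4) by simp
  obtain a where a: "a \<noteq> 0" "p' = Cst a"
    using unit_of_primitive[OF *(1,3) _ eq' GH(2)] *(6) by auto
  obtain b where b: "b \<noteq> 0" "q' = Cst b"
    using unit_of_primitive[OF *(2,4) _ eq'[symmetric] GH(1)] *(6) by auto
  have "Cst (Cst (inverse a)) * (Cst (Cst a) * G) = Cst (Cst (inverse a)) * (Cst (Cst b) * H)"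
    using eq' unfolding a b by (simp only:)
  then have "G = Cst (Cst (inverse a * b)) * H"
    unfolding mult.assoc[symmetric] C[symmetric] using a(1) by simp
  with a(1) b(1) show ?thesis by (intro exI[of _ "inverse a * b"]) simp
qed

lemma map_Rep_ratfun_eq_iff:
  "Poly_Mapping.map Rep_ratfun F = Cst x * Poly_Mapping.map (\<lambda>c. Fract c 1) G \<longleftrightarrow>
    (\<forall>t. Rep_ratfun (lk F t) = x * Fract (lk (G :: 'k::field poly3 poly3) t) 1)"
proof -
  have "lk (Poly_Mapping.map Rep_ratfun F) t = Rep_ratfun (lk F t)" for t
    by (rule lookup_map) (rule crh_0[OF comm_ring_hom_Rep_ratfun])
  moreover have "lk (Cst x * Poly_Mapping.map (\<lambda>c. Fract c 1) G) t = x * Fract (lk G t) 1" for t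
    unfolding lookup_Cst_mult by (subst lookup_map) (simp_all add: crh_0[OF comm_ring_hom_Fract])
  ultimately show ?thesis unfolding poly_mapping_eq_iff fun_eq_iff by (simp only:)
qed

text \<open>The form \<Phi> itself satisfies \<open>is_star F\<close>, so the chosen
  \<open>star F\<close> does as well, and primitivity forces the two to agree up to a
  scalar.\<close>

lemma star_eq:
  fixes \<Phi> :: "'k::field poly3 poly3"
  assumes \<Phi>: "bihomogeneous m d \<Phi>" "\<Phi> \<noteq> 0" "primitive_form \<Phi>" and c: "c \<noteq> 0" and F: "F = Cst c * at_generic \<Phi>"
  shows "\<exists>k. k \<noteq> 0 \<and> star F = Cst (Cst k) * \<Phi>"
proof -
  \<comment> \<open>The coefficients of \<Phi> have degree \<open>m\<close> in \<open>a\<close>, so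
    their values at P are the coefficients divided by this power of a_0; it joins the denominator of
    \<open>c\<close>.\<close>
  let ?V = "Var 0 ^ m :: 'k poly3"
  have V: "homogeneous (m * 1) ?V" by (intro homogeneous_power homogeneous_Var)
  obtain e q n where q: "homogeneous e q" "homogeneous e n" "q \<noteq> 0" and Rc: "Rep_ratfun c = Fract n q"
    using ratfun_set_fraction[OF Rep_ratfun[of c]] by (elim exE conjE)
  have n: "n \<noteq> 0"
  proof
    assume "n = 0"
    then have "Rep_ratfun c = 0" using Rc q(3) by (simp add: Zero_fract_def eq_fract)
    with c show False by (simp only: Rep_ratfun_eq_0_iff)
  qed
  have nz: "q * ?V \<noteq> 0" using q(3) by simp
  have RF: "Rep_ratfun (lk F t) = Fract n (q * ?V) * Fract (lk \<Phi> t) 1" for t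
  proof -
    have "homogeneous m (lk \<Phi> t)" using \<Phi>(1) unfolding bihomogeneous_def by (elim conjE allE)
    note 1 = Fract_homogeneous[OF this]
    have v: "Fract ?V 1 = (Fract (Var 0) 1 ^ m :: 'k poly3 fract)" by (rule crh_power[OF comm_ring_hom_Fract])
    have "Fract n q = Fract n (q * ?V) * Fract ?V 1" using q(3) by (simp add: eq_fract)
    then show ?thesis
      unfolding F lookup_Cst_mult lookup_at_generic times_ratfun.rep_eq Rc 1 v by (simp only: mult.assoc)
  qed
  obtain i j B H where
    BH: "homogeneous i B" "homogeneous j H" "B \<noteq> 0" "H \<noteq> 0" "n * H = B * (q * ?V)"
      "\<forall>D. D dvd B \<longrightarrow> D dvd H \<longrightarrow> D dvd 1"
    using coprime_homogeneous_fraction[OF q(2) homogeneous_mult[OF q(1) V] n nz] by (elim exE conjE)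
  have "Fract n (q * ?V) = Fract B H" using BH(5) unfolding eq_fract(1)[OF nz BH(4)] .
  then have "Poly_Mapping.map Rep_ratfun F = Cst (Fract B H) * Poly_Mapping.map (\<lambda>c. Fract c 1) \<Phi>"
    unfolding map_Rep_ratfun_eq_iff RF by (intro allI) (simp only:)
  then have "is_star F \<Phi>"
    unfolding is_star_def primitive_form_iff[symmetric]
    by (intro conjI exI[of _ B] exI[of _ H] exI[of _ i] exI[of _ j] exI[of _ m] exI[of _ d] BH \<Phi>)
  then have "is_star F (star F)" unfolding star_def by (rule someI)
  then obtain B' b H' h where
    s: "homogeneous b B'" "homogeneous h H'" "H' \<noteq> 0" "primitive_form (star F)"
      "Poly_Mapping.map Rep_ratfun F = Cst (Fract B' H') * Poly_Mapping.map (\<lambda>c. Fract c 1) (star F)"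
    unfolding is_star_def primitive_form_iff[symmetric] by (elim exE conjE)
  have eq: "n * H' * lk \<Phi> t = q * ?V * B' * lk (star F) t" for t
  proof -
    have "Fract n (q * ?V) * Fract (lk \<Phi> t) 1 = Fract B' H' * Fract (lk (star F) t) 1"
      using s(5) unfolding map_Rep_ratfun_eq_iff RF by (rule spec)
    then have "n * lk \<Phi> t * H' = B' * lk (star F) t * (q * ?V)"
      unfolding mult_fract mult_1_right eq_fract(1)[OF nz s(3)] .
    then show ?thesis by (simp only: mult_ac)
  qed
  \<comment> \<open>The definition of \<open>is_star\<close> leaves room for a zero numerator; it is
    excluded because \<Phi> is nonzero.\<close>
  have B': "B' \<noteq> 0"
  proof
    assume "B' = 0"
    then have "lk \<Phi> t = 0" for t using eq[of t] n s(3) by simp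
    then have "\<Phi> = 0" by (intro poly_mapping_eqI) simp
    with \<Phi>(2) show False by simp
  qed
  have eq': "Cst (q * ?V * B') * star F = Cst (n * H') * \<Phi>"
    by (rule poly_mapping_eqI) (simp only: lookup_Cst_mult eq)
  show ?thesis
    by (rule primitive_form_unique[OF homogeneous_mult[OF homogeneous_mult[OF q(1) V] s(1)] homogeneous_mult[OF q(2) s(2)] _ _ eq' s(4) \<Phi>(3)])
      (use nz n B' s(3) in simp_all)
qed

theorem theorem4p4:
  fixes Z :: "'k::{alg_closed_field, field_char_0} proj2 set"
    and m :: nat
    and F :: "'k ratfun poly3"
  assumes "finite Z"
    and "unexpected_form Z (m + 1) m F"
    and "irreducible F"
  shows
    "(\<forall>G. unexpected_form Z (m + 1) m G \<longrightarrow> same_curve F G) \<and>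
     (free_arrangement Z \<longrightarrow>
        bihomogeneous m (m + 1) (star F) \<and>
        has_multiplicity_at m (at_generic (swap_vars (star F))) generic_point) \<and>
     (\<forall>\<Phi> :: 'k poly3 poly3.
        bihomogeneous m (m + 1) \<Phi> \<longrightarrow>
        irreducible (at_generic \<Phi>) \<longrightarrow>
        has_multiplicity_at m (at_generic (swap_vars \<Phi>)) generic_point \<longrightarrow>
        has_multiplicity_at m (at_generic \<Phi>) generic_point \<longrightarrow>
        tangent_cone_form Cst m \<Phi> (\<chi> i. Var i) = (- 1) ^ m * swap_vars \<Phi> \<and>
        tangent_cone_form ratfun_const m (at_generic \<Phi>) generic_point =
          (- 1) ^ m * at_generic (swap_vars \<Phi>))"
proof (intro conjI allI impI)
  have F: "admits_unexpected Z (m + 1) m" "F \<in> fat_system Z (m + 1) m" "F \<noteq> 0"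
    using assms(2) unfolding unexpected_form_def by simp_all
  show "same_curve F G" if "unexpected_form Z (m + 1) m G" for G
  proof -
    have G: "G \<in> fat_system Z (m + 1) m" "G \<noteq> 0"
      using that unfolding unexpected_form_def by simp_all
    obtain c where c: "G = Cst c * F"
      using unexpected_form_unique[OF assms(1) F(1,2) assms(3) G(1)] by (elim exE)
    with G(2) have "c \<noteq> 0" by auto
    with c show ?thesis unfolding same_curve_def by (intro exI[of _ c] conjI)
  qed
  assume free: "free_arrangement Z"
  obtain S c where S: "\<forall>i. homogeneous m (S $ i)" and c: "c \<noteq> 0" and Fc: "F = Cst c * at_generic (duality_form S)"
    using unexpected_form_duality[OF assms(1) F(1,2) assms(3) free] by (elim exE conjE)
  let ?\<Phi> = "duality_form S"
  have b: "bihomogeneous m (m + 1) ?\<Phi>" by (rule bihomogeneous_duality_form) (rule S[rule_format])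
  have nz: "?\<Phi> \<noteq> 0"
  proof
    assume *: "?\<Phi> = 0"
    have "F = 0" unfolding Fc * crh_0[OF comm_ring_hom_at_generic] by simp
    with F(3) show False by (rule notE)
  qed
  have "primitive_form ?\<Phi>"
    unfolding primitive_form_def by (intro allI impI) (rule duality_form_no_factor[OF nz])
  from star_eq[OF b nz this c Fc] obtain k where k: "k \<noteq> 0" "star F = Cst (Cst k) * ?\<Phi>" by (elim exE conjE)
  have lk: "lk (star F) t = Cst k * lk ?\<Phi> t" for t unfolding k(2) lookup_Cst_mult ..
  have bi: "homogeneous (m + 1) ?\<Phi>" "\<And>t. homogeneous m (lk ?\<Phi> t)" using b unfolding bihomogeneous_def by simp_all
  show bs: "bihomogeneous m (m + 1) (star F)"
    unfolding bihomogeneous_def lk unfolding k(2) by (intro conjI allI homogeneous_Cst_mult bi)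
  note sw = bihomogeneous_swap_vars[OF bs]
  have sF: "swap_vars (star F) = Cst (Cst k) * swap_vars ?\<Phi>"
    unfolding k(2) crh_mult[OF comm_ring_hom_swap_vars] swap_vars_Cst_Cst ..
  show "has_multiplicity_at m (at_generic (swap_vars (star F))) generic_point"
  proof (rule has_multiplicity_atI)
    show "homogeneous m (at_generic (swap_vars (star F)))"
      by (rule homogeneous_at_generic[OF sw])
    \<comment> \<open>Specialising x to P keeps the form nonzero because it is homogeneous of degree
      \<open>m + 1\<close> in x.\<close>
    show "at_generic (swap_vars (star F)) \<noteq> 0"
    proof
      assume "at_generic (swap_vars (star F)) = 0"
      moreover have "homogeneous (m + 1) (swap_vars (swap_vars (star F)))"
        using sw unfolding bihomogeneous_iff_swap by (elim conjE)
      ultimately have "swap_vars (star F) = 0" by (intro at_generic_eq_0)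
      then have "swap_vars (swap_vars (star F)) = 0" by (simp only: crh_0[OF comm_ring_hom_swap_vars])
      with k nz show False unfolding swap_vars_swap_vars by simp
    qed
    show "at_generic (swap_vars (star F)) \<in> ideal_power (vanishing_ideal {generic_point}) m"
      unfolding sF crh_mult[OF comm_ring_hom_at_generic]
      by (intro ideal_power_scale at_generic_duality_form S[rule_format])
  qed
next
  fix \<Phi> :: "'k poly3 poly3"
  assume b: "bihomogeneous m (m + 1) \<Phi>" and "has_multiplicity_at m (at_generic (swap_vars \<Phi>)) generic_point"
  then have "at_generic (swap_vars \<Phi>) \<in> ideal_power (vanishing_ideal {generic_point}) m"
    unfolding has_multiplicity_at_def by (elim conjE)
  from tangent_cone_eq_swap_vars[OF b this]
  show *: "tangent_cone_form Cst m \<Phi> (\<chi> i. Var i) = (- 1) ^ m * swap_vars \<Phi>" .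
  \<comment> \<open>Forming the tangent cone commutes with the specialisation of \<open>a\<close> to
    P, so the identity over the polynomial ring suffices.\<close>
  show "tangent_cone_form ratfun_const m (at_generic \<Phi>) generic_point = (- 1) ^ m * at_generic (swap_vars \<Phi>)"
    unfolding at_generic_tangent_cone *
    by (simp only: crh_simps[OF comm_ring_hom_at_generic])
qed

end
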